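(* Suppose that assumptions (f-B), (f-L$'$), (f-M), (f-P) and (TIV) of the context hold and that the Hamiltonian is $H(t,x,p)=\frac12|p|^2$ (i.e. $h\equiv0$). Let the initial guess $\bar m_0$ be as in the context, and let the step sizes be $\delta_k=\frac{k_2}{k+k_1}$ with constants $1\le k_2\le k_1$. Let $r=2$ if $d=1$, and let $r$ be any number greater than $d$ if $d\ge2$. Let $(\bar m,\bar u)$ be the solution of the MFG system, let $(\bar M^k_{n,i},M^k_{n,i},\Gamma^k_{n,i},\Phi^k_{n,i},\Psi^k_{n,i})$ be the solution of the discrete GCG scheme, where the grid satisfies $$2d\nu\frac{\Delta t}{(\Delta x)^2}\le 1,$$ and put $U^k_{n,i}=-2\nu\log\Phi^k_{n,i}$. Suppose in addition that the solutions $\phi_k,\psi_k$ of the CH-GCG method satisfy $$\phi_k,\psi_k\in\mathcal{C}^{2,4}(Q),\qquad \|\phi_k\|_{\mathcal{C}^{2,4}(Q)}\le C,\qquad \|\psi_k\|_{\mathcal{C}^{2,4}(Q)}\le C$$ for all $k$, with a constant $C>0$ independent of $k$. Then there exist a constant $s>0$, functions $C^{(1)}_{\bar m}(k)>0$, $C^{(1)}_{\bar u}(k)>0$ of $k$, and constants $C^{(2)}_{\bar m}>0$, $C^{(2)}_{\bar u}>0$ (all independent of $\Delta t,\Delta x$; $s,C^{(2)}_{\bar m},C^{(2)}_{\bar u}$ also independent of $k$) such that $$I(\bar M^k,\bar m)\le C^{(1)}_{\bar m}(k)\left[\Delta t+(\Delta x)^2\right]+\frac{C^{(2)}_{\bar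 m}}{(k+k_1)^{s/r}},$$ $$E(U^k,\bar u)\le C^{(1)}_{\bar u}(k)\left[\Delta t+(\Delta x)^2\right]+\frac{C^{(2)}_{\bar u}}{(k+k_1)^{s/r}}$$ for all $k=0,1,\dots$, where the asymptotic growth of $C^{(1)}_{\bar m}(k)$ and $C^{(1)}_{\bar u}(k)$ as $k\to\infty$ is polynomially bounded from above and logarithmically bounded from below (i.e. between $a\log k$ and $b\,k^p$ for some constants $a,b,p>0$ and all large $k$).
   Context: Setting. $d\ge1$, $T>0$, $\nu>0$, $\mathbb{T}^d=(\mathbb{R}/\mathbb{Z})^d$, $Q=(0,T)\times\mathbb{T}^d$; $|\cdot|$ is the Euclidean norm. Functions on $Q$ of the classes below are understood to be continuous up to $t=0,T$. $\mathcal{D}_0(\mathbb{T}^d)=\{m\in\mathcal{C}(\mathbb{T}^d): m\ge0\}$. $\mathcal{C}^{k+\alpha}$ denotes Hölder spaces; $\mathcal{C}^{\alpha/2,\alpha}(Q)$ is the space of functions $\frac\alpha2$-Hölder in $t$ and $\alpha$-Hölder in $x$; $u\in\mathcal{C}^{1+\alpha/2,2+\alpha}(Q)$ means $\partial_tu,\partial_iu,\partial_i\partial_ju\in\mathcal{C}^{\alpha/2,\alpha}(Q)$. $\mathcal{C}^{\alpha/2,1+\alpha}$: $\frac\alpha2$-Hölder in $t$ and of class $\mathcal{C}^{1+\alpha}$ in $x$. $\mathcal{C}^{2,4}(Q)$: functions twice continuously differentiable in $t$ and four times in $x$, normed by the sup norms of these derivatives. Fix $q>d+2$; $W^{1,2,q}(Q)=W^{1,q}(Q)\cap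 L^q(0,T;W^{2,q}(\mathbb{T}^d))$. Data: Hamiltonian $H(t,x,p)=\frac12|p|^2$, coupling term $f(t,x,m)\in\mathbb{R}$ ($t\in[0,T]$, $x\in\mathbb{T}^d$, $m\in\mathcal{D}_0(\mathbb{T}^d)$; $f$ depends on $m$ as a function on $\mathbb{T}^d$), terminal datum $g$, initial density $m_0$. $f$ is also understood to be defined when $m$ is a nonnegative function piecewise constant on grid cells, with (f-B) and the first two inequalities of (f-L$'$) valid for such $m$ too. The constant $\alpha_0\in(0,1)$ is common to all assumptions. (f-B): $0\le f(t,x,m)\le C_0$ for some constant $C_0$. (f-L$'$): there are $C_0,L_f>0$ with $|f(t_2,x,m)-f(t_1,x,m)|\le C_0|t_2-t_1|^{\alpha_0}$ for all $t_1,t_2,x,m$, and, for functions $m_1,m_2$, $|f(t,x,m_2)-f(t,x,m_1)|\le L_f|m_2(x)-m_1(x)|$ for all $t,x$ (pointwise in $x$); moreover, if $m\in\mathcal{D}_0(\mathbb{T}^d)$ is Lipschitz, then $f(t,\cdot,m)$ is Lipschitz in $x$, and for each $R>0$ there is $C(R)$ such that if the Lipschitz constant of $m$ is at most $R$ then that of $f(t,\cdot,m)$ is at most $C(R)$ for all $t$. (f-M): $\int_{\mathbb{T}^d}[f(t,x,m_2)-f(t,x,m_1)][m_2(x)-m_1(x)]\,dx\ge0$ for $t\in[0,T]$, $m_1,m_2\in\mathcal{D}_0(\mathbb{T}^d)$. (f-P): there is a continuous $F:[0,T]\times\mathcal{D}_0(\mathbb{T}^d)\to\mathbb{R}$ with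 $F(t,m_2)-F(t,m_1)=\int_0^1\int_{\mathbb{T}^d}f(t,x,sm_2+(1-s)m_1)[m_2(x)-m_1(x)]\,dx\,ds$. (TIV): $g\in\mathcal{C}^{2+\alpha_0}(\mathbb{T}^d)$ and $m_0\in\mathcal{D}_0(\mathbb{T}^d)\cap\mathcal{C}^{2+\alpha_0}(\mathbb{T}^d)$. MFG system: $-\partial_tu-\nu\Delta u+H(t,x,\nabla u)=f(t,x,m(t,\cdot))$ in $Q$, $u(T,\cdot)=g$; $\partial_tm-\nu\Delta m-\nabla\cdot(m\nabla_pH(t,x,\nabla u))=0$ in $Q$, $m(0,\cdot)=m_0$. Under the assumptions it has a unique solution $(\bar u,\bar m)\in W^{1,2,q}(Q)^2$, which is classical (both components in $\mathcal{C}^{1+\alpha/2,2+\alpha}(Q)$ for some $\alpha\in(0,1)$). Initial guess: for a given $v\in\mathcal{C}^{\alpha_0/2,1+\alpha_0}(Q;\mathbb{R}^d)$, $\bar m_0$ is the unique classical solution of $\partial_t\bar m_0-\nu\Delta\bar m_0+\nabla\cdot(v\bar m_0)=0$ in $Q$, $\bar m_0(0)=m_0$ (it is nonnegative and lies in $\mathcal{C}^{1+\beta/2,2+\beta}(Q)\cap W^{1,2,q}(Q)$ for some $\beta\in(0,1)$). CH-GCG method (continuous level, $h\equiv0$). Starting from $\bar m_0$, for $k=0,1,\dots$: $\gamma_k(t,\cdot)=f(t,\cdot,\bar m_k(t,\cdot))$; $\partial_t\phi_k+\nu\Delta\phi_k=\frac1{2\nu}\gamma_k\phi_k$ in $Q$,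 $\phi_k(T,\cdot)=\exp(-g/(2\nu))$; $\partial_t\psi_k-\nu\Delta\psi_k=-\frac1{2\nu}\gamma_k\psi_k$ in $Q$, $\psi_k(0,\cdot)=m_0/\phi_k(0,\cdot)$; $m_k=\phi_k\psi_k$; $\bar m_{k+1}=(1-\delta_k)\bar m_k+\delta_km_k$. Grid. $N_t,N_x$ positive integers, $\Delta t=T/N_t$, $\Delta x=1/N_x$, $t_n=n\Delta t$ ($0\le n\le N_t$), $x_i=i\Delta x$ for multi-indices $i$ taken modulo $N_x$ in each component; $\Lambda_x=(\mathbb{Z}/N_x\mathbb{Z})^d$, $\Lambda=\{0,\dots,N_t\}\times\Lambda_x$. $i[\ell^\pm]=(i_1,\dots,i_\ell\pm1,\dots,i_d)$. For a grid function $\phi$: $D_2(\phi,n,i)=\sum_{\ell=1}^d\frac{\phi_{n,i[\ell^+]}-2\phi_{n,i}+\phi_{n,i[\ell^-]}}{(\Delta x)^2}$. Discrete GCG scheme ($h\equiv0$). Set $\bar M^0_{n,i}=\bar m_0(t_n,x_i)$. For $k=0,1,\dots$, with $\bar M^k_n:\mathbb{T}^d\to\mathbb{R}$ the piecewise constant function equal to $\bar M^k_{n,i}$ on $\prod_{\ell=1}^d[x_{i_\ell}-\frac{\Delta x}2,x_{i_\ell}+\frac{\Delta x}2)$: - $\Gamma^k_{n,i}=f(t_n,x_i,\bar M^k_n)$; - $\frac{\Phi^k_{n,i}-\Phi^k_{n-1,i}}{\Delta t}+\nu D_2(\Phi^k,n,i)=\frac1{2\nu}\Gamma^k_{n,i}\Phi^k_{n-1,i}$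 ($n=N_t,\dots,1$), $\Phi^k_{N_t,i}=\exp(-g(x_i)/(2\nu))$; - $\frac{\Psi^k_{n+1,i}-\Psi^k_{n,i}}{\Delta t}-\nu D_2(\Psi^k,n,i)=-\frac1{2\nu}\Gamma^k_{n,i}\Psi^k_{n+1,i}$ ($n=0,\dots,N_t-1$), $\Psi^k_{0,i}=m_0(x_i)/\Phi^k_{0,i}$; - $M^k_{n,i}=\Phi^k_{n,i}\Psi^k_{n,i}$, and $\bar M^{k+1}_{n,i}=(1-\delta_k)\bar M^k_{n,i}+\delta_kM^k_{n,i}$. Error measures. For a grid function $\phi$ on $\Lambda$ and a continuous $\psi$ on $Q$: $I(\phi,\psi)=\Big[\sum_{n=0}^{N_t-1}\big(\max_{i\in\Lambda_x}|\phi_{n,i}-\psi(t_n,x_i)|\big)^2\Delta t\Big]^{1/2}$ and $E(\phi,\psi)=\max_{(n,i)\in\Lambda}|\phi_{n,i}-\psi(t_n,x_i)|$. *)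

theory Defs
  imports "HOL-Analysis.Analysis"
begin

text \<open>
  The torus $T^d = (R/Z)^d$ with $d$ = \<open>CARD('d)\<close>: functions on it are \<open>1\<close>-periodic functions on
  \<open>real ^ 'd\<close>, and its integral is the integral over the unit cube \<open>cbox 0 1\<close>. For periodic
  functions, Lipschitz and Hoelder bounds over all representatives in \<open>real ^ 'd\<close> are the same as
  those with respect to the distance of the torus.
\<close>

definition periodic :: "(real ^ 'd \<Rightarrow> 'b) \<Rightarrow> bool" where
  "periodic w \<longleftrightarrow> (\<forall>x l. w (x + axis l 1) = w x)"

definition D0 :: "(real ^ 'd \<Rightarrow> real) set" where
  "D0 = {m. periodic m \<and> continuous_on UNIV m \<and> (\<forall>x. 0 \<le> m x)}"


section \<open>Derivatives\<close>

definition pd :: "'d \<Rightarrow> (real ^ 'd \<Rightarrow> real) \<Rightarrow> real ^ 'd \<Rightarrow> real" where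
  "pd l w x = deriv (\<lambda>h. w (x + h *\<^sub>R axis l 1)) 0"

definition pd_exists :: "'d \<Rightarrow> (real ^ 'd \<Rightarrow> real) \<Rightarrow> real ^ 'd \<Rightarrow> bool" where
  "pd_exists l w x \<longleftrightarrow> (\<lambda>h. w (x + h *\<^sub>R axis l 1)) field_differentiable at 0"

abbreviation pds :: "'d list \<Rightarrow> (real ^ 'd \<Rightarrow> real) \<Rightarrow> real ^ 'd \<Rightarrow> real" where
  "pds ls \<equiv> foldr pd ls"

definition grad :: "(real ^ 'd \<Rightarrow> real) \<Rightarrow> real ^ 'd \<Rightarrow> real ^ 'd" where
  "grad w x = (\<chi> l. pd l w x)"

definition div_x :: "(real ^ 'd \<Rightarrow> real ^ 'd) \<Rightarrow> real ^ 'd \<Rightarrow> real" where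
  "div_x w x = (\<Sum>l\<in>UNIV. pd l (\<lambda>y. w y $ l) x)"

definition lap :: "(real ^ 'd \<Rightarrow> real) \<Rightarrow> real ^ 'd \<Rightarrow> real" where
  "lap w x = (\<Sum>l\<in>UNIV. pd l (pd l w) x)"

text \<open>One-sided at \<open>t = 0\<close> and \<open>t = T\<close>.\<close>

definition dt :: "real \<Rightarrow> (real \<Rightarrow> real ^ 'd \<Rightarrow> real) \<Rightarrow> real \<Rightarrow> real ^ 'd \<Rightarrow> real" where
  "dt T u t x = vector_derivative (\<lambda>s. u s x) (at t within {0..T})"


section \<open>Function spaces\<close>

definition torus_C :: "nat \<Rightarrow> (real ^ 'd \<Rightarrow> real) \<Rightarrow> bool" where
  "torus_C b w \<longleftrightarrow> periodic w
     \<and> (\<forall>ls. length ls < b \<longrightarrow> (\<forall>l x. pd_exists l (pds ls w) x))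
     \<and> (\<forall>ls. length ls \<le> b \<longrightarrow> continuous_on UNIV (pds ls w))"

definition torus_holder :: "nat \<Rightarrow> real \<Rightarrow> (real ^ 'd \<Rightarrow> real) \<Rightarrow> bool" where
  "torus_holder b \<alpha> w \<longleftrightarrow> torus_C b w
     \<and> (\<forall>ls. length ls = b \<longrightarrow>
          (\<exists>K. \<forall>x y. \<bar>pds ls w x - pds ls w y\<bar> \<le> K * dist x y powr \<alpha>))"

text \<open>\<open>a\<close> continuous derivatives in \<open>t\<close> and \<open>b\<close> continuous derivatives in \<open>x\<close>, all up to
  \<open>t = 0, T\<close>; no mixed derivatives in \<open>(t, x)\<close> are involved.\<close>

definition par_C :: "nat \<Rightarrow> nat \<Rightarrow> real \<Rightarrow> (real \<Rightarrow> real ^ 'd \<Rightarrow> real) \<Rightarrow> bool" where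
  "par_C a b T u \<longleftrightarrow> (\<forall>t\<in>{0..T}. periodic (u t))
     \<and> (\<forall>j<a. \<forall>t\<in>{0..T}. \<forall>x. (\<lambda>s. (dt T ^^ j) u s x) differentiable (at t within {0..T}))
     \<and> (\<forall>j\<le>a. continuous_on ({0..T} \<times> UNIV) (\<lambda>(t, x). (dt T ^^ j) u t x))
     \<and> (\<forall>ls. length ls < b \<longrightarrow> (\<forall>t\<in>{0..T}. \<forall>l x. pd_exists l (pds ls (u t)) x))
     \<and> (\<forall>ls. length ls \<le> b \<longrightarrow> continuous_on ({0..T} \<times> UNIV) (\<lambda>(t, x). pds ls (u t) x))"

definition par_norm :: "nat \<Rightarrow> nat \<Rightarrow> real \<Rightarrow> (real \<Rightarrow> real ^ 'd \<Rightarrow> real) \<Rightarrow> real" where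
  "par_norm a b T u =
     (\<Sum>j\<le>a. SUP (t, x)\<in>{0..T} \<times> UNIV. \<bar>(dt T ^^ j) u t x\<bar>)
     + (\<Sum>ls | 1 \<le> length ls \<and> length ls \<le> b. SUP (t, x)\<in>{0..T} \<times> UNIV. \<bar>pds ls (u t) x\<bar>)"

definition par_holder :: "real \<Rightarrow> real \<Rightarrow> (real \<Rightarrow> real ^ 'd \<Rightarrow> real) \<Rightarrow> bool" where
  "par_holder \<alpha> T u \<longleftrightarrow> (\<forall>t\<in>{0..T}. periodic (u t))
     \<and> (\<exists>K. \<forall>s\<in>{0..T}. \<forall>t\<in>{0..T}. \<forall>x y.
          \<bar>u s x - u t y\<bar> \<le> K * (dist s t powr (\<alpha> / 2) + dist x y powr \<alpha>))"

text \<open>$C^{\alpha/2, 1+\alpha}(Q)$, with Hoelder constants uniform in the other variable. Boundedness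
  of \<open>u\<close> and of its gradient is automatic for periodic functions.\<close>

definition par_holder_x1 :: "real \<Rightarrow> real \<Rightarrow> (real \<Rightarrow> real ^ 'd \<Rightarrow> real) \<Rightarrow> bool" where
  "par_holder_x1 \<alpha> T u \<longleftrightarrow> (\<forall>t\<in>{0..T}. torus_C 1 (u t))
     \<and> (\<exists>K. (\<forall>s\<in>{0..T}. \<forall>t\<in>{0..T}. \<forall>x. \<bar>u s x - u t x\<bar> \<le> K * dist s t powr (\<alpha> / 2))
          \<and> (\<forall>t\<in>{0..T}. \<forall>l x y. \<bar>pd l (u t) x - pd l (u t) y\<bar> \<le> K * dist x y powr \<alpha>))"

text \<open>$C^{1+\alpha/2, 2+\alpha}(Q)$.\<close>

definition par_holder_12 :: "real \<Rightarrow> real \<Rightarrow> (real \<Rightarrow> real ^ 'd \<Rightarrow> real) \<Rightarrow> bool" where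
  "par_holder_12 \<alpha> T u \<longleftrightarrow> par_C 1 2 T u
     \<and> par_holder \<alpha> T (dt T u)
     \<and> (\<forall>l. par_holder \<alpha> T (\<lambda>t. pd l (u t)))
     \<and> (\<forall>l j. par_holder \<alpha> T (\<lambda>t. pd l (pd j (u t))))"

definition classical :: "real \<Rightarrow> (real \<Rightarrow> real ^ 'd \<Rightarrow> real) \<Rightarrow> bool" where
  "classical T u \<longleftrightarrow> (\<exists>\<alpha>. 0 < \<alpha> \<and> \<alpha> < 1 \<and> par_holder_12 \<alpha> T u)"


section \<open>Grid\<close>

definition grid :: "nat \<Rightarrow> (int ^ 'd) set" where
  "grid Nx = {i. \<forall>l. 0 \<le> i $ l \<and> i $ l < int Nx}"

definition grid_t :: "real \<Rightarrow> nat \<Rightarrow> nat \<Rightarrow> real" where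
  "grid_t T Nt n = real n * (T / real Nt)"

definition grid_x :: "nat \<Rightarrow> int ^ 'd \<Rightarrow> real ^ 'd" where
  "grid_x Nx i = (\<chi> l. of_int (i $ l) * (1 / real Nx))"

definition shift :: "nat \<Rightarrow> 'd \<Rightarrow> int \<Rightarrow> int ^ 'd \<Rightarrow> int ^ 'd" where
  "shift Nx l c i = (\<chi> j. if j = l then (i $ j + c) mod int Nx else i $ j)"

definition D2 :: "nat \<Rightarrow> (nat \<Rightarrow> int ^ 'd \<Rightarrow> real) \<Rightarrow> nat \<Rightarrow> int ^ 'd \<Rightarrow> real" where
  "D2 Nx \<phi> n i =
     (\<Sum>l\<in>UNIV. (\<phi> n (shift Nx l 1 i) - 2 * \<phi> n i + \<phi> n (shift Nx l (-1) i)) / (1 / real Nx)\<^sup>2)"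

text \<open>The value is \<open>M i\<close> on the cell of all \<open>x\<close> with
  $x_{i_l} - \Delta x/2 \le x_l < x_{i_l} + \Delta x/2$ modulo 1, that is,
  $i_l = \lfloor x_l / \Delta x + 1/2 \rfloor$ modulo $N_x$.\<close>

definition piecewise_const :: "nat \<Rightarrow> (int ^ 'd \<Rightarrow> real) \<Rightarrow> real ^ 'd \<Rightarrow> real" where
  "piecewise_const Nx M x = M (\<chi> l. \<lfloor>real Nx * x $ l + 1 / 2\<rfloor> mod int Nx)"

definition grid_densities :: "(real ^ 'd \<Rightarrow> real) set" where
  "grid_densities = {piecewise_const Nx M | Nx M. 0 < Nx \<and> (\<forall>i\<in>grid Nx. 0 \<le> M i)}"

definition err_I :: "real \<Rightarrow> nat \<Rightarrow> nat \<Rightarrow> (nat \<Rightarrow> int ^ 'd \<Rightarrow> real)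
    \<Rightarrow> (real \<Rightarrow> real ^ 'd \<Rightarrow> real) \<Rightarrow> real" where
  "err_I T Nt Nx \<phi> \<psi> = sqrt (\<Sum>n<Nt.
     (Max ((\<lambda>i. \<bar>\<phi> n i - \<psi> (grid_t T Nt n) (grid_x Nx i)\<bar>) ` grid Nx))\<^sup>2 * (T / real Nt))"

definition err_E :: "real \<Rightarrow> nat \<Rightarrow> nat \<Rightarrow> (nat \<Rightarrow> int ^ 'd \<Rightarrow> real)
    \<Rightarrow> (real \<Rightarrow> real ^ 'd \<Rightarrow> real) \<Rightarrow> real" where
  "err_E T Nt Nx \<phi> \<psi> =
     Max ((\<lambda>(n, i). \<bar>\<phi> n i - \<psi> (grid_t T Nt n) (grid_x Nx i)\<bar>) ` ({0..Nt} \<times> grid Nx))"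


section \<open>Assumptions on the data\<close>

text \<open>The coupling \<open>f\<close> is a function on $[0,T] \times T^d \times (D_0 \cup \mbox{grid densities})$;
  its values elsewhere are irrelevant.\<close>

type_synonym 'd coupling = "real \<Rightarrow> real ^ 'd \<Rightarrow> (real ^ 'd \<Rightarrow> real) \<Rightarrow> real"

definition coupling_on_torus :: "real \<Rightarrow> 'd::finite coupling \<Rightarrow> bool" where
  "coupling_on_torus T f \<longleftrightarrow>
     (\<forall>t\<in>{0..T}. \<forall>m\<in>D0 \<union> grid_densities. periodic (\<lambda>x. f t x m))"

definition f_B :: "real \<Rightarrow> 'd::finite coupling \<Rightarrow> bool" where
  "f_B T f \<longleftrightarrow>
     (\<exists>C0. \<forall>t\<in>{0..T}. \<forall>x. \<forall>m\<in>D0 \<union> grid_densities. 0 \<le> f t x m \<and> f t x m \<le> C0)"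

definition f_L' :: "real \<Rightarrow> real \<Rightarrow> 'd::finite coupling \<Rightarrow> bool" where
  "f_L' \<alpha>\<^sub>0 T f \<longleftrightarrow>
     (\<exists>C0>0. \<exists>Lf>0.
        (\<forall>t1\<in>{0..T}. \<forall>t2\<in>{0..T}. \<forall>x. \<forall>m\<in>D0 \<union> grid_densities.
           \<bar>f t2 x m - f t1 x m\<bar> \<le> C0 * \<bar>t2 - t1\<bar> powr \<alpha>\<^sub>0)
      \<and> (\<forall>t\<in>{0..T}. \<forall>x. \<forall>m1\<in>D0 \<union> grid_densities. \<forall>m2\<in>D0 \<union> grid_densities.
           \<bar>f t x m2 - f t x m1\<bar> \<le> Lf * \<bar>m2 x - m1 x\<bar>))
   \<and> (\<forall>R>0. \<exists>C. \<forall>t\<in>{0..T}. \<forall>m\<in>D0.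
        R-lipschitz_on UNIV m \<longrightarrow> C-lipschitz_on UNIV (\<lambda>x. f t x m))"

definition f_M :: "real \<Rightarrow> 'd::finite coupling \<Rightarrow> bool" where
  "f_M T f \<longleftrightarrow> (\<forall>t\<in>{0..T}. \<forall>m1\<in>D0. \<forall>m2\<in>D0.
     0 \<le> integral (cbox 0 1) (\<lambda>x. (f t x m2 - f t x m1) * (m2 x - m1 x)))"

text \<open>\<open>F\<close> is continuous on $[0,T] \times D_0$ with respect to the sup norm on $D_0$.\<close>

definition f_P :: "real \<Rightarrow> 'd::finite coupling \<Rightarrow> bool" where
  "f_P T f \<longleftrightarrow> (\<exists>F :: real \<Rightarrow> (real ^ 'd \<Rightarrow> real) \<Rightarrow> real.
     (\<forall>t\<in>{0..T}. \<forall>m\<in>D0. \<forall>\<epsilon>>0. \<exists>\<eta>>0. \<forall>t'\<in>{0..T}. \<forall>m'\<in>D0.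
        \<bar>t' - t\<bar> < \<eta> \<longrightarrow> (\<forall>x. \<bar>m' x - m x\<bar> < \<eta>) \<longrightarrow> \<bar>F t' m' - F t m\<bar> < \<epsilon>)
   \<and> (\<forall>t\<in>{0..T}. \<forall>m1\<in>D0. \<forall>m2\<in>D0.
        F t m2 - F t m1 = integral {0..1} (\<lambda>s. integral (cbox 0 1) (\<lambda>x.
          f t x (\<lambda>y. s * m2 y + (1 - s) * m1 y) * (m2 x - m1 x)))))"

definition TIV :: "real \<Rightarrow> (real ^ 'd \<Rightarrow> real) \<Rightarrow> (real ^ 'd \<Rightarrow> real) \<Rightarrow> bool" where
  "TIV \<alpha>\<^sub>0 g m\<^sub>0 \<longleftrightarrow> torus_holder 2 \<alpha>\<^sub>0 g \<and> m\<^sub>0 \<in> D0 \<and> torus_holder 2 \<alpha>\<^sub>0 m\<^sub>0"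


section \<open>The continuous problems\<close>

text \<open>Nonnegativity of \<open>m\<close> is part of the notion of solution because \<open>f t x\<close> is only given on
  nonnegative functions.\<close>

definition MFG_solution :: "real \<Rightarrow> real \<Rightarrow> (real \<Rightarrow> real ^ 'd \<Rightarrow> real ^ 'd \<Rightarrow> real)
    \<Rightarrow> 'd::finite coupling \<Rightarrow> (real ^ 'd \<Rightarrow> real) \<Rightarrow> (real ^ 'd \<Rightarrow> real)
    \<Rightarrow> (real \<Rightarrow> real ^ 'd \<Rightarrow> real) \<Rightarrow> (real \<Rightarrow> real ^ 'd \<Rightarrow> real) \<Rightarrow> bool" where
  "MFG_solution T \<nu> H f g m\<^sub>0 u m \<longleftrightarrow>
     classical T u \<and> classical T m \<and> (\<forall>t\<in>{0..T}. \<forall>x. 0 \<le> m t x)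
   \<and> (\<forall>t\<in>{0<..<T}. \<forall>x.
        - dt T u t x - \<nu> * lap (u t) x + H t x (grad (u t) x) = f t x (m t))
   \<and> (\<forall>x. u T x = g x)
   \<and> (\<forall>t\<in>{0<..<T}. \<forall>x.
        dt T m t x - \<nu> * lap (m t) x
        - div_x (\<lambda>y. m t y *\<^sub>R grad (H t y) (grad (u t) y)) x = 0)
   \<and> (\<forall>x. m 0 x = m\<^sub>0 x)"

definition initial_guess :: "real \<Rightarrow> real \<Rightarrow> (real \<Rightarrow> real ^ 'd \<Rightarrow> real ^ 'd)
    \<Rightarrow> (real ^ 'd \<Rightarrow> real) \<Rightarrow> (real \<Rightarrow> real ^ 'd \<Rightarrow> real) \<Rightarrow> bool" where
  "initial_guess T \<nu> v m\<^sub>0 mg \<longleftrightarrow>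
     classical T mg \<and> (\<forall>t\<in>{0..T}. \<forall>x. 0 \<le> mg t x)
   \<and> (\<forall>t\<in>{0<..<T}. \<forall>x.
        dt T mg t x - \<nu> * lap (mg t) x + div_x (\<lambda>y. mg t y *\<^sub>R v t y) x = 0)
   \<and> (\<forall>x. mg 0 x = m\<^sub>0 x)"

text \<open>\<open>mg\<close> is the initial guess and \<open>mb k\<close> the \<open>k\<close>-th averaged density; $m_k = \phi_k \psi_k$ is
  inserted directly.\<close>

definition CH_GCG :: "real \<Rightarrow> real \<Rightarrow> 'd::finite coupling
    \<Rightarrow> (real ^ 'd \<Rightarrow> real) \<Rightarrow> (real ^ 'd \<Rightarrow> real) \<Rightarrow> (nat \<Rightarrow> real) \<Rightarrow> (real \<Rightarrow> real ^ 'd \<Rightarrow> real)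
    \<Rightarrow> (nat \<Rightarrow> real \<Rightarrow> real ^ 'd \<Rightarrow> real) \<Rightarrow> (nat \<Rightarrow> real \<Rightarrow> real ^ 'd \<Rightarrow> real)
    \<Rightarrow> (nat \<Rightarrow> real \<Rightarrow> real ^ 'd \<Rightarrow> real) \<Rightarrow> bool" where
  "CH_GCG T \<nu> f g m\<^sub>0 \<delta> mg mb \<phi> \<psi> \<longleftrightarrow>
     (\<forall>t\<in>{0..T}. \<forall>x. mb 0 t x = mg t x)
   \<and> (\<forall>k. par_C 1 2 T (\<phi> k) \<and> par_C 1 2 T (\<psi> k)
      \<and> (\<forall>t\<in>{0<..<T}. \<forall>x.
           dt T (\<phi> k) t x + \<nu> * lap (\<phi> k t) x = 1 / (2 * \<nu>) * f t x (mb k t) * \<phi> k t x)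
      \<and> (\<forall>x. \<phi> k T x = exp (- g x / (2 * \<nu>)))
      \<and> (\<forall>t\<in>{0<..<T}. \<forall>x.
           dt T (\<psi> k) t x - \<nu> * lap (\<psi> k t) x = - (1 / (2 * \<nu>)) * f t x (mb k t) * \<psi> k t x)
      \<and> (\<forall>x. \<psi> k 0 x = m\<^sub>0 x / \<phi> k 0 x)
      \<and> (\<forall>t\<in>{0..T}. \<forall>x.
           mb (Suc k) t x = (1 - \<delta> k) * mb k t x + \<delta> k * (\<phi> k t x * \<psi> k t x)))"


section \<open>The discrete scheme\<close>

definition discrete_GCG :: "real \<Rightarrow> real \<Rightarrow> 'd::finite coupling
    \<Rightarrow> (real ^ 'd \<Rightarrow> real) \<Rightarrow> (real ^ 'd \<Rightarrow> real) \<Rightarrow> (nat \<Rightarrow> real) \<Rightarrow> (real \<Rightarrow> real ^ 'd \<Rightarrow> real)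
    \<Rightarrow> nat \<Rightarrow> nat
    \<Rightarrow> (nat \<Rightarrow> nat \<Rightarrow> int ^ 'd \<Rightarrow> real) \<Rightarrow> (nat \<Rightarrow> nat \<Rightarrow> int ^ 'd \<Rightarrow> real)
    \<Rightarrow> (nat \<Rightarrow> nat \<Rightarrow> int ^ 'd \<Rightarrow> real) \<Rightarrow> (nat \<Rightarrow> nat \<Rightarrow> int ^ 'd \<Rightarrow> real)
    \<Rightarrow> (nat \<Rightarrow> nat \<Rightarrow> int ^ 'd \<Rightarrow> real) \<Rightarrow> bool" where
  "discrete_GCG T \<nu> f g m\<^sub>0 \<delta> mg Nt Nx Mb M \<Gamma> \<Phi> \<Psi> \<longleftrightarrow>
     (\<forall>n\<le>Nt. \<forall>i\<in>grid Nx. Mb 0 n i = mg (grid_t T Nt n) (grid_x Nx i))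
   \<and> (\<forall>k. \<forall>i\<in>grid Nx.
        (\<forall>n\<le>Nt. \<Gamma> k n i = f (grid_t T Nt n) (grid_x Nx i) (piecewise_const Nx (Mb k n)))
      \<and> (\<forall>n\<in>{1..Nt}. (\<Phi> k n i - \<Phi> k (n - 1) i) / (T / real Nt) + \<nu> * D2 Nx (\<Phi> k) n i
           = 1 / (2 * \<nu>) * \<Gamma> k n i * \<Phi> k (n - 1) i)
      \<and> \<Phi> k Nt i = exp (- g (grid_x Nx i) / (2 * \<nu>))
      \<and> (\<forall>n<Nt. (\<Psi> k (n + 1) i - \<Psi> k n i) / (T / real Nt) - \<nu> * D2 Nx (\<Psi> k) n i
           = - (1 / (2 * \<nu>)) * \<Gamma> k n i * \<Psi> k (n + 1) i)
      \<and> \<Psi> k 0 i = m\<^sub>0 (grid_x Nx i) / \<Phi> k 0 i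
      \<and> (\<forall>n\<le>Nt. M k n i = \<Phi> k n i * \<Psi> k n i)
      \<and> (\<forall>n\<le>Nt. Mb (Suc k) n i = (1 - \<delta> k) * Mb k n i + \<delta> k * M k n i))"

definition log_poly_growth :: "(nat \<Rightarrow> real) \<Rightarrow> bool" where
  "log_poly_growth c \<longleftrightarrow> (\<exists>a>0. \<exists>b>0. \<exists>p>0.
     eventually (\<lambda>k. a * ln (real k) \<le> c k \<and> c k \<le> b * real k powr p) sequentially)"

end

theory Submission
  imports Defs
begin

text \<open>
  The error of the discrete iterates splits into the distance between the discrete and the continuous
  iterates and the distance between the continuous iterates and the solution of the system.

  \<^bold>\<open>Continuous part.\<close> The iteration is a conditional gradient (Frank--Wolfe) method for a convex
  functional. A density \<open>m\<close> with momentum \<open>Q\<close> and kinetic energy density \<open>e\<close> is called a state if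
  $\partial_t m = \nu\Delta m - \mathrm{div}\, Q$ holds weakly and
  $0 \le e + Q \cdot p + m |p|^2/2$ for all vectors \<open>p\<close> (\<open>fp_state\<close>). The last condition is
  linear in \<open>(m, Q, e)\<close>, so states can be averaged without any discussion of the zeros of \<open>m\<close>, and
  it stands for $|Q|^2 \le 2 m e$. If \<open>u\<close> solves the Hamilton--Jacobi equation with right-hand side
  \<open>\<gamma>\<close> and terminal value \<open>g\<close>, then testing the weak equation with \<open>u\<close> shows that the cost
  $\int\!\!\int (e + \gamma m) + \int g\, m(T)$ exceeds $\int u(0) m_0$ by the integral of
  $e + Q \cdot \nabla u + m |\nabla u|^2/2$ (\<open>fp_duality\<close>). This integrand is nonnegative, and it
  vanishes for the best response to \<open>\<gamma>\<close>, whose density is the product of the two Hopf--Cole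
  factors. Together with the convexity and smoothness of the potential \<open>F\<close> this gives
  $\varepsilon_{k+1} \le (1-\delta_k) \varepsilon_k + C \delta_k^2$ for the energy gap
  (\<open>energy_descent\<close>), hence $\varepsilon_k \le B (k+k_1)^{-1/2}$ (\<open>step_size_recursion\<close>). The same duality
  for the solution of the system bounds the squared deviation of the averaged momentum from the optimal one
  by a multiple of $\varepsilon_k$, and an energy estimate turns this into $\|m_k(t) - m(t)\|_{L^2}^2 \le C \varepsilon_k$
  uniformly in \<open>t\<close> (\<open>fp_energy_estimate\<close>). All averaged densities have a common Lipschitz
  constant, so the square of the $L^2$ norm controls the power $d+2$ of the maximum
  (\<open>lipschitz_max_le_mean_square\<close>). The maximum principle transfers the resulting rate to the factor
  \<open>\<phi>\<close> and thereby to \<open>u\<close>. The exponent $1/(2(d+2))$ found in this way is the value of \<open>s / r\<close>.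

  \<^bold>\<open>Discrete part.\<close> Under the stability condition an explicit diffusion step is an average of
  neighbouring values, so the schemes are stable in the maximum norm with constants that do not depend
  on the grid; since the zeroth order term has a sign, errors merely add up over the time steps
  (\<open>scheme_stability\<close>). With the consistency of the difference quotients, one iteration maps an
  error \<open>E\<close> of the averaged density to an error of at most $A (E + \Delta t + (\Delta x)^2)$
  (\<open>discrete_step_error\<close>). Averaging with weight $\delta_k \le k_2/(k+1)$ multiplies the sum of the error and the mesh
  term by at most $1 + A\delta_k$, and the product of these factors grows at most like the power $A k_2$ of \<open>k\<close>
  (\<open>discrete_density_error\<close>). The coefficient may be enlarged freely, so a power of $k+1$ also meets
  the logarithmic lower bound.
\<close>

section \<open>Periodic functions\<close>

lemma periodic_axis_int:
  assumes "periodic w"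
  shows "w (x + of_int c *\<^sub>R axis l 1) = w x"
proof -
  have up: "w (x + of_nat n *\<^sub>R axis l 1) = w x" for n x
  proof (induction n)
    case (Suc n)
    have "x + of_nat (Suc n) *\<^sub>R axis l 1 = (x + of_nat n *\<^sub>R axis l 1) + axis l 1"
      by (simp add: algebra_simps)
    then show ?case using Suc assms unfolding periodic_def by metis
  qed simp
  show ?thesis
  proof (cases c rule: int_cases2)
    case (nonneg n)
    then show ?thesis using up[of x n] by simp
  next
    case (nonpos n)
    then show ?thesis using up[of "x + of_int c *\<^sub>R axis l 1" n] by simp
  qed
qed

lemma periodic_lattice:
  fixes w :: "real ^ 'd::finite \<Rightarrow> 'b"
  assumes "periodic w"
  shows "w (x + (\<chi> l. real_of_int (c l))) = w x"
proof -
  have "w (x + (\<Sum>l\<in>S. of_int (c l) *\<^sub>R axis l 1)) = w x" if "finite S" for S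
    using that
  proof (induction S)
    case (insert l S)
    have "x + (\<Sum>l\<in>insert l S. of_int (c l) *\<^sub>R axis l 1)
        = (x + (\<Sum>l\<in>S. of_int (c l) *\<^sub>R axis l 1)) + of_int (c l) *\<^sub>R axis l 1"
      using insert by (simp add: algebra_simps)
    then have "w (x + (\<Sum>l\<in>insert l S. of_int (c l) *\<^sub>R axis l 1)) 
        = w (x + (\<Sum>l\<in>S. of_int (c l) *\<^sub>R axis l 1))"
      by (simp only: periodic_axis_int[OF assms])
    then show ?case using insert by simp
  qed simp
  from this[of UNIV] have "w (x + (\<Sum>l\<in>UNIV. of_int (c l) *\<^sub>R axis l 1)) = w x" by simp
  moreover have "(\<Sum>l\<in>UNIV. of_int (c l) *\<^sub>R axis l 1) = (\<chi> l. real_of_int (c l))"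
    by (simp add: vec_eq_iff axis_def if_distrib cong: if_cong)
  ultimately show ?thesis by simp
qed

text \<open>Every point of the torus has a representative in the unit cube, which is compact; this is how
  suprema over the whole space are attained.\<close>

lemma unit_cube_representative:
  fixes x :: "real ^ 'd::finite"
  obtains y where "y \<in> cbox 0 1" "\<And>w :: real ^ 'd \<Rightarrow> real. periodic w \<Longrightarrow> w x = w y"
proof
  show "(\<chi> l. frac (x $ l)) \<in> cbox 0 1"
    by (simp add: mem_box_cart frac_ge_0 less_imp_le[OF frac_lt_1])
  fix w :: "real ^ 'd \<Rightarrow> real" assume "periodic w"
  from periodic_lattice[OF this, of "\<chi> l. frac (x $ l)" "\<lambda>l. \<lfloor>x $ l\<rfloor>"]
  have "w ((\<chi> l. frac (x $ l)) + (\<chi> l. of_int \<lfloor>x $ l\<rfloor>)) = w (\<chi> l. frac (x $ l))" .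
  moreover have "(\<chi> l. frac (x $ l)) + (\<chi> l. of_int \<lfloor>x $ l\<rfloor>) = x"
    by (simp add: vec_eq_iff frac_def)
  ultimately show "w x = w (\<chi> l. frac (x $ l))" by simp
qed

lemma periodic_bounded:
  fixes u :: "real \<Rightarrow> real ^ 'd::finite \<Rightarrow> real"
  assumes "\<And>t. t \<in> {0..T} \<Longrightarrow> periodic (u t)" "continuous_on ({0..T} \<times> UNIV) (\<lambda>(t, x). u t x)"
  obtains B where "0 < B" "\<And>t x. t \<in> {0..T} \<Longrightarrow> \<bar>u t x\<bar> \<le> B"
proof -
  have "continuous_on ({0..T} \<times> cbox 0 1) (\<lambda>(t, x). u t x)"
    using assms(2) by (rule continuous_on_subset) auto
  then have "bounded ((\<lambda>(t, x). u t x) ` ({0..T} \<times> cbox (0 :: real ^ 'd) 1))"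
    by (intro compact_imp_bounded compact_continuous_image compact_Times) auto
  then obtain B where B: "0 < B" "\<And>t x. t \<in> {0..T} \<Longrightarrow> x \<in> cbox 0 1 \<Longrightarrow> \<bar>u t x\<bar> \<le> B"
    unfolding bounded_pos by (auto simp: image_iff) 
  show thesis
  proof (rule that[OF B(1)])
    fix t x assume t: "t \<in> {0..T}"
    obtain y where "y \<in> cbox 0 1" "\<And>w :: real ^ 'd \<Rightarrow> real. periodic w \<Longrightarrow> w x = w y"
      using unit_cube_representative[of x] by blast
    then show "\<bar>u t x\<bar> \<le> B" using B(2)[OF t] assms(1)[OF t] by metis
  qed
qed

lemma periodic_bounded_below:
  fixes u :: "real \<Rightarrow> real ^ 'd::finite \<Rightarrow> real"
  assumes "0 \<le> T" "\<And>t. t \<in> {0..T} \<Longrightarrow> periodic (u t)" "continuous_on ({0..T} \<times> UNIV) (\<lambda>(t, x). u t x)"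
  obtains t0 x0 where "t0 \<in> {0..T}" "\<And>t x. t \<in> {0..T} \<Longrightarrow> u t0 x0 \<le> u t x"
proof -
  have "continuous_on ({0..T} \<times> cbox 0 1) (\<lambda>(t, x). u t x)"
    using assms(3) by (rule continuous_on_subset) auto
  moreover have "compact ({0..T} \<times> cbox (0 :: real ^ 'd) 1)" by (intro compact_Times) auto
  moreover have "{0..T} \<times> cbox (0 :: real ^ 'd) 1 \<noteq> {}" 
    using assms(1) by (auto simp: interval_ne_empty_cart)
  ultimately obtain p where p: "p \<in> {0..T} \<times> cbox 0 1"
    "\<forall>q\<in>{0..T} \<times> cbox 0 1. (case p of (t, x) \<Rightarrow> u t x) \<le> (case q of (t, x) \<Rightarrow> u t x)"
    using continuous_attains_inf by metis
  obtain t0 x0 where [simp]: "p = (t0, x0)" by force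
  show thesis
  proof (rule that[of t0 x0])
    show "t0 \<in> {0..T}" using p by auto
    fix t x assume t: "t \<in> {0..T}"
    obtain y where y: "y \<in> cbox 0 1" "\<And>w :: real ^ 'd \<Rightarrow> real. periodic w \<Longrightarrow> w x = w y"
      using unit_cube_representative[of x] by blast
    have "u t0 x0 \<le> u t y" using p(2) t y(1) by auto
    then show "u t0 x0 \<le> u t x" using y(2)[OF assms(2)[OF t]] by simp
  qed
qed

section \<open>Partial derivatives of periodic functions\<close>

lemma pd_exists_imp_has_derivative:
  assumes "pd_exists l w x"
  shows "((\<lambda>h. w (x + h *\<^sub>R axis l 1)) has_real_derivative pd l w x) (at 0)"
  using assms unfolding pd_exists_def pd_def by (simp add: field_differentiable_derivI)

lemma has_derivative_imp_pd:
  assumes "((\<lambda>h. w (x + h *\<^sub>R axis l 1)) has_real_derivative D) (at 0)"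
  shows "pd_exists l w x" "pd l w x = D"
  using assms unfolding pd_exists_def pd_def
  by (auto simp: field_differentiable_def intro: DERIV_imp_deriv)

lemma pd_along_line:
  assumes "\<And>y. pd_exists l w y"
  shows "((\<lambda>h. w (x + h *\<^sub>R axis l 1)) has_real_derivative pd l w (x + s *\<^sub>R axis l 1)) (at s within S)"
proof -
  have "((\<lambda>h. w ((x + s *\<^sub>R axis l 1) + h *\<^sub>R axis l 1)) has_real_derivative pd l w (x + s *\<^sub>R axis l 1)) (at 0)"
    by (rule pd_exists_imp_has_derivative[OF assms])
  then have "((\<lambda>h. w (x + (s + h) *\<^sub>R axis l 1)) has_real_derivative pd l w (x + s *\<^sub>R axis l 1)) (at 0)"
    by (simp add: algebra_simps)
  then have "((\<lambda>h. w (x + h *\<^sub>R axis l 1)) has_real_derivative pd l w (x + s *\<^sub>R axis l 1)) (at s)"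
    using DERIV_at_within_shift[of "\<lambda>h. w (x + h *\<^sub>R axis l 1)" _ s 0 UNIV]
    by (simp add: add.commute)
  then show ?thesis by (rule DERIV_subset) simp
qed

lemma pd_periodic: "periodic w \<Longrightarrow> periodic (pd l w)"
  unfolding periodic_def pd_def by (simp add: add.assoc add.commute[of "axis _ _"])
    (simp add: add.assoc[symmetric])

lemma pds_periodic: "periodic w \<Longrightarrow> periodic (pds ls w)"
  by (induction ls) (auto intro: pd_periodic)

text \<open>The class \<open>torus_C 1\<close> without the detour over lists of directions. It is the domain of integration
  by parts and is closed under the algebraic operations that occur below.\<close>

definition C1_torus :: "(real ^ 'd \<Rightarrow> real) \<Rightarrow> bool" where
  "C1_torus w \<longleftrightarrow> periodic w \<and> (\<forall>l x. pd_exists l w x) \<and> continuous_on UNIV w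
     \<and> (\<forall>l. continuous_on UNIV (pd l w))"

lemma torus_C_imp_C1_torus:
  assumes "torus_C b w" "length ls < b"
  shows "C1_torus (pds ls w)"
proof -
  have c: "length ks \<le> b \<Longrightarrow> continuous_on UNIV (pds ks w)" for ks
    using assms(1) unfolding torus_C_def by blast
  have "continuous_on UNIV (pd l (pds ls w))" for l using c[of "l # ls"] assms(2) by simp
  moreover have "continuous_on UNIV (pds ls w)" using c[of ls] assms(2) by simp
  ultimately show ?thesis
    using assms pds_periodic[of w ls] unfolding torus_C_def C1_torus_def by blast
qed

lemma C1_torusD:
  assumes "C1_torus w"
  shows "periodic w" "pd_exists l w x" "continuous_on UNIV w" "continuous_on UNIV (pd l w)"
    "periodic (pd l w)"
  using assms unfolding C1_torus_def by (auto intro: pd_periodic)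

lemma C1_torus_continuous_on:
  assumes "C1_torus w"
  shows "continuous_on S w" "continuous_on S (pd l w)"
  using assms C1_torusD continuous_on_subset by blast+

lemma C1_torusI:
  assumes "periodic w" "continuous_on UNIV w"
    and "\<And>l x. ((\<lambda>h. w (x + h *\<^sub>R axis l 1)) has_real_derivative w' l x) (at 0)"
    and "\<And>l. continuous_on UNIV (w' l)"
  shows "C1_torus w" "pd l w = w' l"
proof -
  have *: "pd l w = w' l" for l using has_derivative_imp_pd(2)[OF assms(3)] by (simp add: fun_eq_iff)
  show "C1_torus w" unfolding C1_torus_def
    using assms * has_derivative_imp_pd(1)[OF assms(3)] by auto
  show "pd l w = w' l" by (rule *)
qed

lemma C1_torus_const: "C1_torus (\<lambda>x. c)" "pd l (\<lambda>x. c) = (\<lambda>x. 0)"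
  using C1_torusI[of "\<lambda>x. c" "\<lambda>l x. 0"] by (auto simp: periodic_def)

lemma C1_torus_mult:
  assumes "C1_torus v" "C1_torus w"
  shows "C1_torus (\<lambda>x. v x * w x)" "pd l (\<lambda>x. v x * w x) = (\<lambda>x. pd l v x * w x + v x * pd l w x)"
proof -
  have p: "periodic (\<lambda>x. v x * w x)" using assms by (auto simp: C1_torus_def periodic_def)
  have c: "continuous_on UNIV (\<lambda>x. v x * w x)"
    by (intro continuous_intros C1_torusD assms)
  have d: "((\<lambda>h. v (x + h *\<^sub>R axis l 1) * w (x + h *\<^sub>R axis l 1)) has_real_derivative
      pd l v x * w x + v x * pd l w x) (at 0)" for l x
    using DERIV_mult[OF pd_exists_imp_has_derivative[OF C1_torusD(2)[OF assms(1)], of x l]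
        pd_exists_imp_has_derivative[OF C1_torusD(2)[OF assms(2)], of x l]]
    by (simp add: mult.commute)
  have c': "continuous_on UNIV (\<lambda>x. pd l v x * w x + v x * pd l w x)" for l
    by (intro continuous_intros C1_torusD assms)
  show "C1_torus (\<lambda>x. v x * w x)" "pd l (\<lambda>x. v x * w x) = (\<lambda>x. pd l v x * w x + v x * pd l w x)"
    using C1_torusI[where w' = "\<lambda>l x. pd l v x * w x + v x * pd l w x", OF p c d c'] by auto
qed

lemma C1_torus_add:
  assumes "C1_torus v" "C1_torus w"
  shows "C1_torus (\<lambda>x. v x + w x)" "pd l (\<lambda>x. v x + w x) = (\<lambda>x. pd l v x + pd l w x)"
proof -
  have p: "periodic (\<lambda>x. v x + w x)" using assms by (auto simp: C1_torus_def periodic_def)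
  have c: "continuous_on UNIV (\<lambda>x. v x + w x)"
    by (intro continuous_intros C1_torusD assms)
  have d: "((\<lambda>h. v (x + h *\<^sub>R axis l 1) + w (x + h *\<^sub>R axis l 1)) has_real_derivative
      pd l v x + pd l w x) (at 0)" for l x
    using DERIV_add[OF pd_exists_imp_has_derivative[OF C1_torusD(2)[OF assms(1)], of x l]
        pd_exists_imp_has_derivative[OF C1_torusD(2)[OF assms(2)], of x l]] .
  have c': "continuous_on UNIV (\<lambda>x. pd l v x + pd l w x)" for l
    by (intro continuous_intros C1_torusD assms)
  show "C1_torus (\<lambda>x. v x + w x)" "pd l (\<lambda>x. v x + w x) = (\<lambda>x. pd l v x + pd l w x)"
    using C1_torusI[where w' = "\<lambda>l x. pd l v x + pd l w x", OF p c d c'] by auto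
qed

lemma C1_torus_cmult:
  fixes c :: real
  assumes "C1_torus w"
  shows "C1_torus (\<lambda>x. c * w x)" "pd l (\<lambda>x. c * w x) = (\<lambda>x. c * pd l w x)"
  using C1_torus_mult[OF C1_torus_const(1)[of c] assms] by (auto simp: C1_torus_const(2))

lemma C1_torus_diff:
  assumes "C1_torus v" "C1_torus w"
  shows "C1_torus (\<lambda>x. v x - w x)" "pd l (\<lambda>x. v x - w x) = (\<lambda>x. pd l v x - pd l w x)"
  using C1_torus_add[OF assms(1) C1_torus_cmult(1)[OF assms(2), of "-1"]] C1_torus_cmult(2)[OF assms(2), of _ "-1"]
  by auto

lemma C1_torus_compose:
  fixes G G' :: "real \<Rightarrow> real"
  assumes "C1_torus w" "\<And>x. w x \<in> S" "\<And>y. y \<in> S \<Longrightarrow> (G has_real_derivative G' y) (at y)"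
    and "continuous_on S G'"
  shows "C1_torus (\<lambda>x. G (w x))" "pd l (\<lambda>x. G (w x)) = (\<lambda>x. G' (w x) * pd l w x)"
proof -
  have p: "periodic (\<lambda>x. G (w x))" using assms by (auto simp: C1_torus_def periodic_def)
  have G: "continuous_on S G" using assms(3) by (meson DERIV_isCont continuous_at_imp_continuous_on)
  have w: "continuous_on UNIV w" using C1_torusD assms by blast
  have c: "continuous_on UNIV (\<lambda>x. G (w x))"
    using continuous_on_compose2[OF G w] assms(2) by blast
  have d: "((\<lambda>h. G (w (x + h *\<^sub>R axis l 1))) has_real_derivative G' (w x) * pd l w x) (at 0)" for l x
    using DERIV_chain2[OF _ pd_exists_imp_has_derivative[OF C1_torusD(2)[OF assms(1)], of x l], of G "G' (w x)"]
      assms(2,3) by simp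
  have c': "continuous_on UNIV (\<lambda>x. G' (w x) * pd l w x)" for l
  proof (rule continuous_on_mult)
    show "continuous_on UNIV (\<lambda>x. G' (w x))" using continuous_on_compose2[OF assms(4) w] assms(2) by blast
  qed (rule C1_torusD[OF assms(1)])
  show "C1_torus (\<lambda>x. G (w x))" "pd l (\<lambda>x. G (w x)) = (\<lambda>x. G' (w x) * pd l w x)"
    using C1_torusI[where w' = "\<lambda>l x. G' (w x) * pd l w x", OF p c d c'] by auto
qed

lemma C1_torus_divide:
  assumes "C1_torus v" "C1_torus w" "\<And>x. 0 < w x"
  shows "C1_torus (\<lambda>x. v x / w x)"
    "pd l (\<lambda>x. v x / w x) = (\<lambda>x. pd l v x / w x - v x * pd l w x / (w x)\<^sup>2)"
proof -
  have i: "C1_torus (\<lambda>x. inverse (w x))"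
      "pd l (\<lambda>x. inverse (w x)) = (\<lambda>x. - inverse ((w x)\<^sup>2) * pd l w x)" for l
    by (rule C1_torus_compose[OF assms(2), where S = "{0<..}" and G = inverse and G' = "\<lambda>y. - inverse (y\<^sup>2)"];
        auto intro!: assms continuous_intros derivative_eq_intros simp: power2_eq_square)+
  show "C1_torus (\<lambda>x. v x / w x)"
    "pd l (\<lambda>x. v x / w x) = (\<lambda>x. pd l v x / w x - v x * pd l w x / (w x)\<^sup>2)"
    using C1_torus_mult[OF assms(1) i(1)] by (auto simp: divide_inverse i fun_eq_iff)
qed

lemma C1_torus_exp:
  assumes "C1_torus w"
  shows "C1_torus (\<lambda>x. exp (w x))" "pd l (\<lambda>x. exp (w x)) = (\<lambda>x. exp (w x) * pd l w x)"
  using C1_torus_compose[OF assms, where S = UNIV and G = exp and G' = exp] continuous_on_exp[OF continuous_on_id]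
  by auto

lemma C1_torus_ln:
  assumes "C1_torus w" "\<And>x. 0 < w x"
  shows "C1_torus (\<lambda>x. ln (w x))" "pd l (\<lambda>x. ln (w x)) = (\<lambda>x. pd l w x / w x)"
proof -
  have "(ln has_real_derivative inverse y) (at y)" if "y \<in> {0<..}" for y :: real
    using that by (auto intro!: derivative_eq_intros simp: field_simps)
  moreover have "continuous_on {0<..} (inverse :: real \<Rightarrow> real)" by (auto intro!: continuous_intros)
  ultimately show "C1_torus (\<lambda>x. ln (w x))" "pd l (\<lambda>x. ln (w x)) = (\<lambda>x. pd l w x / w x)"
    using C1_torus_compose[OF assms(1), where S = "{0<..}" and G = ln and G' = inverse] assms(2)
    by (simp_all add: divide_inverse mult.commute)
qed

section \<open>Integration on the torus\<close>

abbreviation torus_int :: "(real ^ 'd::finite \<Rightarrow> real) \<Rightarrow> real" where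
  "torus_int w \<equiv> integral (cbox 0 1) w"

lemma torus_integrable:
  fixes w :: "real ^ 'd::finite \<Rightarrow> real"
  shows "continuous_on UNIV w \<Longrightarrow> w integrable_on cbox 0 1"
  by (rule integrable_continuous) (erule continuous_on_subset, simp)

lemma torus_int_add:
  "continuous_on UNIV v \<Longrightarrow> continuous_on UNIV w \<Longrightarrow> torus_int (\<lambda>x. v x + w x) = torus_int v + torus_int w"
  by (intro integral_add torus_integrable)

lemma torus_int_diff:
  "continuous_on UNIV v \<Longrightarrow> continuous_on UNIV w \<Longrightarrow> torus_int (\<lambda>x. v x - w x) = torus_int v - torus_int w"
  by (intro integral_diff torus_integrable)

lemma torus_int_sum:
  "(\<And>l. l \<in> A \<Longrightarrow> continuous_on UNIV (v l)) \<Longrightarrow> finite A \<Longrightarrow>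
    torus_int (\<lambda>x. \<Sum>l\<in>A. v l x) = (\<Sum>l\<in>A. torus_int (v l))"
  by (intro integral_sum torus_integrable)

lemma torus_int_mono:
  "continuous_on UNIV v \<Longrightarrow> continuous_on UNIV w \<Longrightarrow> (\<And>x. v x \<le> w x) \<Longrightarrow> torus_int v \<le> torus_int w"
  by (intro integral_le torus_integrable)

lemma content_unit_cube [simp]: "measure lborel (cbox 0 (1 :: real ^ 'd::finite)) = 1"
  by (simp add: content_cbox_if_cart interval_eq_empty_cart)

lemma torus_int_const [simp]: "torus_int (\<lambda>x :: real ^ 'd::finite. c) = c"
  by simp

lemma torus_int_nonneg: "(\<And>x. 0 \<le> w x) \<Longrightarrow> 0 \<le> torus_int w"
  by (cases "w integrable_on cbox 0 1") (auto intro: integral_nonneg simp: not_integrable_integral)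

text \<open>Shift the cube and cut the part that leaves it; by periodicity this part may be moved back.\<close>

lemma torus_int_shift:
  fixes w :: "real ^ 'd::finite \<Rightarrow> real"
  assumes w: "periodic w" "continuous_on UNIV w" and h: "0 \<le> h" "h \<le> 1"
  shows "torus_int (\<lambda>x. w (x + h *\<^sub>R axis l 1)) = torus_int w"
proof -
  let ?e = "axis l 1 :: real ^ 'd"
  have e: "?e \<in> Basis" by (simp add: axis_in_Basis_iff)
  have int: "w integrable_on cbox a b" for a b
    by (rule integrable_continuous) (rule continuous_on_subset[OF w(2)], simp)
  define c :: "real ^ 'd" where "c = (\<chi> j. if j = l then h else 1)"
  have C: "cbox 0 1 \<inter> {x. x \<bullet> ?e \<le> h} = cbox 0 c"
    using h by (force simp: c_def mem_box_cart inner_axis' inner_axis split: if_splits)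
  have D: "cbox 0 1 \<inter> {x. h \<le> x \<bullet> ?e} = cbox (h *\<^sub>R ?e) (1 + h *\<^sub>R ?e) \<inter> {x. x \<bullet> ?e \<le> 1}"
  proof (rule set_eqI)
    fix x
    have L: "x \<in> cbox 0 1 \<inter> {x. h \<le> x \<bullet> ?e} \<longleftrightarrow> h \<le> x $ l \<and> (\<forall>i. 0 \<le> x $ i \<and> x $ i \<le> 1)"
      by (auto simp: mem_box_cart inner_axis)
    have R: "x \<in> cbox (h *\<^sub>R ?e) (1 + h *\<^sub>R ?e) \<inter> {x. x \<bullet> ?e \<le> 1}
        \<longleftrightarrow> x $ l \<le> 1 \<and> (\<forall>i. (if i = l then h else 0) \<le> x $ i \<and> x $ i \<le> 1 + (if i = l then h else 0))"
    proof -
      have "(h *\<^sub>R ?e) $ i = (if i = l then h else 0)" for i by (simp add: axis_def)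
      then show ?thesis by (auto simp: mem_box_cart inner_axis)
    qed
    show "x \<in> cbox 0 1 \<inter> {x. h \<le> x \<bullet> ?e}
        \<longleftrightarrow> x \<in> cbox (h *\<^sub>R ?e) (1 + h *\<^sub>R ?e) \<inter> {x. x \<bullet> ?e \<le> 1}"
      unfolding L R
    proof safe
      fix i assume *: "x $ l \<le> 1" "\<forall>i. (if i = l then h else 0) \<le> x $ i \<and> x $ i \<le> 1 + (if i = l then h else 0)"
      show "0 \<le> x $ i" "x $ i \<le> 1" using *(1) *(2)[rule_format, of i] h by (auto split: if_splits)
      show "h \<le> x $ l" using *(2)[rule_format, of l] by simp
    next
      fix i assume *: "h \<le> x $ l" "\<forall>i. 0 \<le> x $ i \<and> x $ i \<le> 1"
      show "(if i = l then h else 0) \<le> x $ i" "x $ i \<le> 1 + (if i = l then h else 0)"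
        using * h by (auto intro: add_increasing2)
    qed auto
  qed
  have B: "cbox (h *\<^sub>R ?e) (1 + h *\<^sub>R ?e) \<inter> {x. 1 \<le> x \<bullet> ?e} = cbox (0 + ?e) (c + ?e)"
  proof (rule set_eqI)
    fix x
    have "(h *\<^sub>R ?e) $ i = (if i = l then h else 0)" for i by (simp add: axis_def)
    then have L: "x \<in> cbox (h *\<^sub>R ?e) (1 + h *\<^sub>R ?e) \<inter> {x. 1 \<le> x \<bullet> ?e}
        \<longleftrightarrow> 1 \<le> x $ l \<and> (\<forall>i. (if i = l then h else 0) \<le> x $ i \<and> x $ i \<le> 1 + (if i = l then h else 0))"
      by (auto simp: mem_box_cart inner_axis)
    have "?e $ i = (if i = l then 1 else 0)" for i by (simp add: axis_def)
    then have R: "x \<in> cbox (0 + ?e) (c + ?e)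
        \<longleftrightarrow> (\<forall>i. (if i = l then 1 else 0) \<le> x $ i \<and> x $ i \<le> (if i = l then 1 + h else 1))"
      by (auto simp: mem_box_cart c_def)
    show "x \<in> cbox (h *\<^sub>R ?e) (1 + h *\<^sub>R ?e) \<inter> {x. 1 \<le> x \<bullet> ?e} \<longleftrightarrow> x \<in> cbox (0 + ?e) (c + ?e)"
      unfolding L R
    proof safe
      fix i assume *: "1 \<le> x $ l" "\<forall>i. (if i = l then h else 0) \<le> x $ i \<and> x $ i \<le> 1 + (if i = l then h else 0)"
      show "(if i = l then 1 else 0) \<le> x $ i" "x $ i \<le> (if i = l then 1 + h else 1)"
        using *(1) *(2)[rule_format, of i] by (auto split: if_splits)
    next
      assume *: "\<forall>i. (if i = l then 1 else 0) \<le> x $ i \<and> x $ i \<le> (if i = l then 1 + h else 1)"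
      show "1 \<le> x $ l" using *[rule_format, of l] by simp
      fix i
      show "(if i = l then h else 0) \<le> x $ i" "x $ i \<le> 1 + (if i = l then h else 0)"
        using *[rule_format, of i] h by (auto split: if_splits)
    qed
  qed
  have "torus_int (\<lambda>x. w (x + h *\<^sub>R ?e)) = integral (cbox (0 + h *\<^sub>R ?e) (1 + h *\<^sub>R ?e)) w"
    unfolding integral_shift_cbox_plus[symmetric] by (simp add: o_def add.commute)
  also have "\<dots> = integral (cbox 0 1 \<inter> {x. h \<le> x \<bullet> ?e}) w + integral (cbox (0 + ?e) (c + ?e)) w"
    using integral_split[OF int e, of "0 + h *\<^sub>R ?e" "1 + h *\<^sub>R ?e" 1] B D by simp
  also have "integral (cbox (0 + ?e) (c + ?e)) w = integral (cbox 0 c) (w \<circ> (+) ?e)"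
    by (simp only: integral_shift_cbox_plus)
  also have "w \<circ> (+) ?e = w" using w(1) by (auto simp: periodic_def fun_eq_iff add.commute)
  also have "integral (cbox 0 1 \<inter> {x. h \<le> x \<bullet> ?e}) w + integral (cbox 0 c) w = torus_int w"
    using integral_split[OF int e, of 0 1 h] C by simp
  finally show ?thesis .
qed

text \<open>The derivative of the translation invariant integral along the axis. Translations by at most one
  period suffice, which is why the derivative is taken from one side.\<close>

lemma torus_int_pd_eq_0:
  fixes w :: "real ^ 'd::finite \<Rightarrow> real"
  assumes "C1_torus w"
  shows "torus_int (pd l w) = 0"
proof -
  let ?e = "axis l 1 :: real ^ 'd"
  let ?G = "\<lambda>h. torus_int (\<lambda>x. w (x + h *\<^sub>R ?e))"
  note w = C1_torusD[OF assms]
  have "(?G has_field_derivative torus_int (\<lambda>x. pd l w (x + 0 *\<^sub>R ?e))) (at 0 within {0..1})"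
  proof (rule leibniz_rule_field_derivative)
    show "((\<lambda>h. w (x + h *\<^sub>R ?e)) has_real_derivative pd l w (x + h *\<^sub>R ?e)) (at h within {0..1})"
      for x h by (rule pd_along_line[OF w(2)])
    show "(\<lambda>x. w (x + h *\<^sub>R ?e)) integrable_on cbox 0 1" for h
      by (intro torus_integrable continuous_on_compose2[OF w(3)] continuous_intros) auto
    show "continuous_on ({0..1} \<times> cbox 0 1) (\<lambda>(h, x). pd l w (x + h *\<^sub>R ?e))"
      unfolding split_beta by (intro continuous_on_compose2[OF w(4)] continuous_intros) auto
  qed auto
  moreover have "(?G has_field_derivative 0) (at 0 within {0..1})"
  proof (rule has_field_derivative_transform_within[of "\<lambda>h. torus_int w" _ _ _ 1])
    fix h :: real assume "h \<in> {0..1}"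
    then show "torus_int w = ?G h" using torus_int_shift[OF w(1,3), of h l] by simp
  qed auto
  ultimately show ?thesis
    using vector_derivative_unique_within_closed_interval[of 0 1 0 ?G "torus_int (pd l w)" 0]
    by (simp add: has_real_derivative_iff_has_vector_derivative)
qed

lemma torus_int_by_parts:
  fixes v w :: "real ^ 'd::finite \<Rightarrow> real"
  assumes "C1_torus v" "C1_torus w"
  shows "torus_int (\<lambda>x. v x * pd l w x) = - torus_int (\<lambda>x. pd l v x * w x)"
proof -
  note * = C1_torus_mult[OF assms]
  have "0 = torus_int (\<lambda>x. pd l v x * w x + v x * pd l w x)"
    using torus_int_pd_eq_0[OF *(1)] *(2) by simp
  also have "\<dots> = torus_int (\<lambda>x. pd l v x * w x) + torus_int (\<lambda>x. v x * pd l w x)"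
    by (intro torus_int_add continuous_intros C1_torusD assms)
  finally show ?thesis by simp
qed

lemma torus_int_divergence:
  fixes \<eta> :: "real ^ 'd::finite \<Rightarrow> real" and w :: "'d \<Rightarrow> real ^ 'd \<Rightarrow> real"
  assumes \<eta>: "C1_torus \<eta>" and w: "\<And>l. C1_torus (w l)"
  shows "torus_int (\<lambda>x. \<eta> x * (\<Sum>l\<in>UNIV. pd l (w l) x)) = - torus_int (\<lambda>x. \<Sum>l\<in>UNIV. pd l \<eta> x * w l x)"
proof -
  have "torus_int (\<lambda>x. \<eta> x * (\<Sum>l\<in>UNIV. pd l (w l) x)) = (\<Sum>l\<in>UNIV. torus_int (\<lambda>x. \<eta> x * pd l (w l) x))"
    unfolding sum_distrib_left by (intro torus_int_sum continuous_on_mult C1_torusD \<eta> w) simp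
  also have "\<dots> = - (\<Sum>l\<in>UNIV. torus_int (\<lambda>x. pd l \<eta> x * w l x))"
    unfolding sum_negf[symmetric] using torus_int_by_parts[OF \<eta> w] by simp
  also have "(\<Sum>l\<in>UNIV. torus_int (\<lambda>x. pd l \<eta> x * w l x)) = torus_int (\<lambda>x. \<Sum>l\<in>UNIV. pd l \<eta> x * w l x)"
    by (rule torus_int_sum[symmetric]) (intro continuous_on_mult C1_torusD \<eta> w | simp)+
  finally show ?thesis .
qed

section \<open>Functions on the space-time cylinder\<close>

definition cont_Q :: "real \<Rightarrow> (real \<Rightarrow> real ^ 'd \<Rightarrow> 'b::topological_space) \<Rightarrow> bool" where
  "cont_Q T g \<longleftrightarrow> continuous_on ({0..T} \<times> UNIV) (\<lambda>(t, x). g t x)"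

definition cyl_int :: "real \<Rightarrow> (real \<Rightarrow> real ^ 'd::finite \<Rightarrow> real) \<Rightarrow> real" where
  "cyl_int T g = integral {0..T} (\<lambda>t. torus_int (g t))"

lemma cont_Q_const: "cont_Q T (\<lambda>t x. c)"
  unfolding cont_Q_def by simp

lemma cont_Q_time: "continuous_on {0..T} w \<Longrightarrow> cont_Q T (\<lambda>t x. w t)"
  unfolding cont_Q_def split_beta by (erule continuous_on_compose2) (auto intro: continuous_intros)

lemma cont_Q_space: "continuous_on UNIV w \<Longrightarrow> cont_Q T (\<lambda>t x. w x)"
  unfolding cont_Q_def split_beta by (erule continuous_on_compose2) (auto intro: continuous_intros)

lemma cont_Q_compose:
  assumes "continuous_on S G" "cont_Q T g" "\<And>t x. t \<in> {0..T} \<Longrightarrow> g t x \<in> S"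
  shows "cont_Q T (\<lambda>t x. G (g t x))"
  using assms(2) unfolding cont_Q_def split_beta
  by (rule continuous_on_compose2[OF assms(1)]) (use assms(3) in auto)

lemma cont_Q_add:
  fixes g h :: "real \<Rightarrow> real ^ 'd \<Rightarrow> 'b::real_normed_vector"
  shows "cont_Q T g \<Longrightarrow> cont_Q T h \<Longrightarrow> cont_Q T (\<lambda>t x. g t x + h t x)"
  unfolding cont_Q_def split_beta by (intro continuous_intros)

lemma cont_Q_diff:
  fixes g h :: "real \<Rightarrow> real ^ 'd \<Rightarrow> 'b::real_normed_vector"
  shows "cont_Q T g \<Longrightarrow> cont_Q T h \<Longrightarrow> cont_Q T (\<lambda>t x. g t x - h t x)"
  unfolding cont_Q_def split_beta by (intro continuous_intros)

lemma cont_Q_minus: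
  fixes g :: "real \<Rightarrow> real ^ 'd \<Rightarrow> 'b::real_normed_vector"
  shows "cont_Q T g \<Longrightarrow> cont_Q T (\<lambda>t x. - g t x)"
  unfolding cont_Q_def split_beta by (intro continuous_intros)

lemma cont_Q_scaleR:
  fixes h :: "real \<Rightarrow> real ^ 'd \<Rightarrow> 'b::real_normed_vector"
  shows "cont_Q T g \<Longrightarrow> cont_Q T h \<Longrightarrow> cont_Q T (\<lambda>t x. g t x *\<^sub>R h t x)"
  unfolding cont_Q_def split_beta by (intro continuous_intros)

lemma cont_Q_inner:
  fixes g h :: "real \<Rightarrow> real ^ 'd \<Rightarrow> 'b::real_inner"
  shows "cont_Q T g \<Longrightarrow> cont_Q T h \<Longrightarrow> cont_Q T (\<lambda>t x. g t x \<bullet> h t x)"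
  unfolding cont_Q_def split_beta by (intro continuous_intros)

lemma cont_Q_mult:
  fixes g h :: "real \<Rightarrow> real ^ 'd \<Rightarrow> real"
  shows "cont_Q T g \<Longrightarrow> cont_Q T h \<Longrightarrow> cont_Q T (\<lambda>t x. g t x * h t x)"
  unfolding cont_Q_def split_beta by (intro continuous_intros)

lemma cont_Q_power:
  fixes g :: "real \<Rightarrow> real ^ 'd \<Rightarrow> real"
  shows "cont_Q T g \<Longrightarrow> cont_Q T (\<lambda>t x. g t x ^ n)"
  unfolding cont_Q_def split_beta by (intro continuous_intros)

lemma cont_Q_norm:
  fixes g :: "real \<Rightarrow> real ^ 'd \<Rightarrow> 'b::real_normed_vector"
  shows "cont_Q T g \<Longrightarrow> cont_Q T (\<lambda>t x. norm (g t x))"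
  unfolding cont_Q_def split_beta by (intro continuous_intros)

lemma cont_Q_divide:
  fixes g h :: "real \<Rightarrow> real ^ 'd \<Rightarrow> real"
  shows "cont_Q T g \<Longrightarrow> cont_Q T h \<Longrightarrow> (\<And>t x. t \<in> {0..T} \<Longrightarrow> h t x \<noteq> 0) \<Longrightarrow> cont_Q T (\<lambda>t x. g t x / h t x)"
  unfolding cont_Q_def split_beta by (intro continuous_intros) auto

lemma cont_Q_sum:
  fixes g :: "'i \<Rightarrow> real \<Rightarrow> real ^ 'd \<Rightarrow> real"
  shows "(\<And>l. l \<in> A \<Longrightarrow> cont_Q T (g l)) \<Longrightarrow> cont_Q T (\<lambda>t x. \<Sum>l\<in>A. g l t x)"
  unfolding cont_Q_def split_beta by (intro continuous_on_sum)

lemma cont_Q_vec_lambda: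
  fixes g :: "'d::finite \<Rightarrow> real \<Rightarrow> real ^ 'd \<Rightarrow> real"
  shows "(\<And>l. cont_Q T (g l)) \<Longrightarrow> cont_Q T (\<lambda>t x. \<chi> l. g l t x)"
  unfolding cont_Q_def split_beta by (intro continuous_on_vec_lambda) 

lemma cont_Q_cong:
  assumes "cont_Q T g" "\<And>t x. t \<in> {0..T} \<Longrightarrow> h t x = g t x"
  shows "cont_Q T h"
  using assms(1) unfolding cont_Q_def
  by (rule continuous_on_eq) (use assms(2) in auto)

lemma cont_Q_of_modulus:
  fixes u :: "real \<Rightarrow> real ^ 'd::finite \<Rightarrow> real"
  assumes "\<And>t0 x0. t0 \<in> {0..T} \<Longrightarrow> \<exists>h. continuous_on ({0..T} \<times> UNIV) h \<and> h (t0, x0) = 0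
    \<and> (\<forall>t\<in>{0..T}. \<forall>x. \<bar>u t x - u t0 x0\<bar> \<le> h (t, x))"
  shows "cont_Q T u"
proof -
  have "continuous (at (t0, x0) within {0..T} \<times> UNIV) (\<lambda>p. u (fst p) (snd p))" if t0: "t0 \<in> {0..T}" for t0 x0
  proof -
    obtain h where h: "continuous_on ({0..T} \<times> UNIV) h" "h (t0, x0) = 0"
      "\<And>t x. t \<in> {0..T} \<Longrightarrow> \<bar>u t x - u t0 x0\<bar> \<le> h (t, x)" using assms[OF t0, of x0] by blast
    have h0: "(h \<longlongrightarrow> 0) (at (t0, x0) within {0..T} \<times> UNIV)"
      using h(1) t0 unfolding continuous_on h(2)[symmetric] by auto
    have "eventually (\<lambda>p. norm (u (fst p) (snd p) - u t0 x0) \<le> h p) (at (t0, x0) within {0..T} \<times> UNIV)"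
      using h(3) unfolding eventually_at by (intro exI[of _ 1]) auto
    from Lim_null_comparison[OF this h0]
    show ?thesis unfolding continuous_within by (simp add: LIM_zero_iff)
  qed
  then show ?thesis unfolding cont_Q_def split_beta continuous_on_eq_continuous_within by auto
qed

lemmas cont_Q_intros = cont_Q_const cont_Q_add cont_Q_diff cont_Q_minus cont_Q_scaleR cont_Q_inner
  cont_Q_mult cont_Q_power cont_Q_norm

lemma cont_Q_slice:
  assumes "cont_Q T g" "t \<in> {0..T}"
  shows "continuous_on S (g t)"
proof -
  have "continuous_on S (\<lambda>x. case (t, x) of (t, x) \<Rightarrow> g t x)"
    by (rule continuous_on_compose2[OF assms(1)[unfolded cont_Q_def]])
      (use assms(2) in \<open>auto intro: continuous_on_Pair continuous_on_const continuous_on_id\<close>)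
  then show ?thesis by simp
qed

lemma cont_Q_track:
  assumes "cont_Q T g"
  shows "continuous_on {0..T} (\<lambda>t. g t x)"
proof -
  have "continuous_on {0..T} (\<lambda>t. case (t, x) of (t, x) \<Rightarrow> g t x)"
    by (rule continuous_on_compose2[OF assms(1)[unfolded cont_Q_def]])
      (auto intro: continuous_on_Pair continuous_on_const continuous_on_id)
  then show ?thesis by simp
qed

lemma continuous_torus_int:
  fixes g :: "real \<Rightarrow> real ^ 'd::finite \<Rightarrow> real"
  assumes "cont_Q T g"
  shows "continuous_on {0..T} (\<lambda>t. torus_int (g t))"
  by (rule integral_continuous_on_param)
    (rule continuous_on_subset[OF assms[unfolded cont_Q_def]], auto)

lemma cyl_int_add:
  fixes g h :: "real \<Rightarrow> real ^ 'd::finite \<Rightarrow> real"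
  assumes "cont_Q T g" "cont_Q T h"
  shows "cyl_int T (\<lambda>t x. g t x + h t x) = cyl_int T g + cyl_int T h"
proof -
  have "cyl_int T (\<lambda>t x. g t x + h t x) = integral {0..T} (\<lambda>t. torus_int (g t) + torus_int (h t))"
    unfolding cyl_int_def by (intro integral_cong torus_int_add cont_Q_slice[OF assms(1)] cont_Q_slice[OF assms(2)])
  also have "\<dots> = cyl_int T g + cyl_int T h" unfolding cyl_int_def
    by (intro integral_add integrable_continuous_real continuous_torus_int assms)
  finally show ?thesis .
qed

lemma cyl_int_cmult: "cyl_int T (\<lambda>t x. c * g t x) = c * cyl_int T g"
  unfolding cyl_int_def by simp

lemma cyl_int_diff:
  fixes g h :: "real \<Rightarrow> real ^ 'd::finite \<Rightarrow> real"
  assumes "cont_Q T g" "cont_Q T h"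
  shows "cyl_int T (\<lambda>t x. g t x - h t x) = cyl_int T g - cyl_int T h"
  using cyl_int_add[OF assms(1), of "\<lambda>t x. - 1 * h t x"] cyl_int_cmult[of T "-1" h]
    cont_Q_minus[OF assms(2)] by simp

lemma cyl_int_mono:
  fixes g h :: "real \<Rightarrow> real ^ 'd::finite \<Rightarrow> real"
  assumes "cont_Q T g" "cont_Q T h" "\<And>t x. t \<in> {0..T} \<Longrightarrow> g t x \<le> h t x"
  shows "cyl_int T g \<le> cyl_int T h"
  unfolding cyl_int_def
  by (intro integral_le integrable_continuous_real continuous_torus_int assms
      torus_int_mono cont_Q_slice[OF assms(1)] cont_Q_slice[OF assms(2)])

lemma cyl_int_cong:
  "(\<And>t x. t \<in> {0..T} \<Longrightarrow> g t x = h t x) \<Longrightarrow> cyl_int T g = cyl_int T h"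
  unfolding cyl_int_def by (intro integral_cong) auto

lemma cyl_int_const: "0 \<le> T \<Longrightarrow> cyl_int T (\<lambda>t (x :: real ^ 'd::finite). c) = T * c"
  unfolding cyl_int_def by simp

lemma torus_int_has_derivative:
  fixes g gt :: "real \<Rightarrow> real ^ 'd::finite \<Rightarrow> real"
  assumes "\<And>t x. t \<in> {0..T} \<Longrightarrow> ((\<lambda>s. g s x) has_real_derivative gt t x) (at t within {0..T})"
    and "\<And>t. t \<in> {0..T} \<Longrightarrow> continuous_on UNIV (g t)" "cont_Q T gt" "t \<in> {0..T}"
  shows "((\<lambda>t. torus_int (g t)) has_real_derivative torus_int (gt t)) (at t within {0..T})"
proof (rule leibniz_rule_field_derivative)
  show "continuous_on ({0..T} \<times> cbox 0 1) (\<lambda>(t, x). gt t x)"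
    by (rule continuous_on_subset[OF assms(3)[unfolded cont_Q_def]]) auto
qed (use assms in \<open>auto intro: torus_integrable\<close>)

lemma has_derivative_interior:
  assumes "(g has_real_derivative D) (at t within {0..T})" "t \<in> {0<..<T}"
  shows "(g has_real_derivative D) (at t)"
  using assms at_within_interior[of t "{0..T}"] by simp

lemma FTC_interior:
  fixes g g' :: "real \<Rightarrow> real"
  assumes "0 \<le> T" "\<And>t. t \<in> {0..T} \<Longrightarrow> (g has_real_derivative g0 t) (at t within {0..T})"
    and "\<And>t. t \<in> {0<..<T} \<Longrightarrow> g0 t = g' t"
  shows "(g' has_integral g T - g 0) {0..T}"
proof (rule fundamental_theorem_of_calculus_interior[OF assms(1)])
  show "continuous_on {0..T} g" by (rule DERIV_continuous_on[OF assms(2)])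
  fix t assume t: "t \<in> {0<..<T}"
  then show "(g has_vector_derivative g' t) (at t)"
    using has_derivative_interior[OF assms(2) t] assms(3)[OF t]
    by (simp add: has_real_derivative_iff_has_vector_derivative)
qed

text \<open>Equations and inequalities between continuous functions pass from the open time interval to
  its end points.\<close>

lemma closed_interval_le:
  fixes g h :: "real \<Rightarrow> real"
  assumes "0 < T" "continuous_on {0..T} g" "continuous_on {0..T} h"
    "\<And>t. t \<in> {0<..<T} \<Longrightarrow> g t \<le> h t" "t \<in> {0..T}"
  shows "g t \<le> h t"
proof -
  have "0 \<le> h t - g t"
    by (rule continuous_ge_on_closure[of "{0<..<T}" "\<lambda>t. h t - g t"])
      (use assms in \<open>auto intro: continuous_intros\<close>)
  then show ?thesis by simp
qed

lemma closed_interval_eq: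
  fixes g h :: "real \<Rightarrow> real"
  assumes "0 < T" "continuous_on {0..T} g" "continuous_on {0..T} h"
    "\<And>t. t \<in> {0<..<T} \<Longrightarrow> g t = h t" "t \<in> {0..T}"
  shows "g t = h t"
  by (intro antisym; rule closed_interval_le[OF assms(1)]) (use assms in auto)

section \<open>Classical functions\<close>

text \<open>The time derivative is a parameter, so that it can be computed by the usual rules instead of being
  unfolded from the operator \<open>dt\<close>.\<close>

definition C12_torus :: "real \<Rightarrow> (real \<Rightarrow> real ^ 'd::finite \<Rightarrow> real) \<Rightarrow> (real \<Rightarrow> real ^ 'd \<Rightarrow> real) \<Rightarrow> bool" where
  "C12_torus T u ut \<longleftrightarrow> (\<forall>t\<in>{0..T}. C1_torus (u t) \<and> (\<forall>l. C1_torus (pd l (u t))))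
     \<and> (\<forall>t\<in>{0..T}. \<forall>x. ((\<lambda>s. u s x) has_real_derivative ut t x) (at t within {0..T}))
     \<and> cont_Q T u \<and> cont_Q T ut \<and> (\<forall>l. cont_Q T (\<lambda>t. pd l (u t)))
     \<and> (\<forall>l. cont_Q T (\<lambda>t. pd l (pd l (u t))))"

lemma C12_torusD:
  assumes "C12_torus T u ut"
  shows "t \<in> {0..T} \<Longrightarrow> C1_torus (u t)" "t \<in> {0..T} \<Longrightarrow> C1_torus (pd l (u t))"
    "t \<in> {0..T} \<Longrightarrow> ((\<lambda>s. u s x) has_real_derivative ut t x) (at t within {0..T})"
    "cont_Q T u" "cont_Q T ut" "cont_Q T (\<lambda>t. pd l (u t))" "cont_Q T (\<lambda>t. pd l (pd l (u t)))"
  using assms unfolding C12_torus_def by auto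

lemma C12_torus_grad: "C12_torus T u ut \<Longrightarrow> cont_Q T (\<lambda>t. grad (u t))"
  unfolding grad_def by (intro cont_Q_vec_lambda C12_torusD)

lemma C12_torus_lap: "C12_torus T u ut \<Longrightarrow> cont_Q T (\<lambda>t. lap (u t))"
  unfolding lap_def by (intro cont_Q_sum C12_torusD)

lemma par_C_imp_C12_torus:
  fixes u :: "real \<Rightarrow> real ^ 'd::finite \<Rightarrow> real"
  assumes "par_C a b T u" "1 \<le> a" "2 \<le> b"
  shows "C12_torus T u (dt T u)"
proof -
  have p: "\<And>t. t \<in> {0..T} \<Longrightarrow> periodic (u t)"
    and d: "\<And>j t x. j < a \<Longrightarrow> t \<in> {0..T} \<Longrightarrow> (\<lambda>s. (dt T ^^ j) u s x) differentiable (at t within {0..T})"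
    and ct: "\<And>j. j \<le> a \<Longrightarrow> continuous_on ({0..T} \<times> UNIV) (\<lambda>(t, x). (dt T ^^ j) u t x)"
    and e: "\<And>ls t l x. length ls < b \<Longrightarrow> t \<in> {0..T} \<Longrightarrow> pd_exists l (pds ls (u t)) x"
    and c: "\<And>ls. length ls \<le> b \<Longrightarrow> cont_Q T (\<lambda>t x. pds ls (u t) x)"
    using assms(1) unfolding par_C_def cont_Q_def by blast+
  have cs: "length ls \<le> b \<Longrightarrow> t \<in> {0..T} \<Longrightarrow> continuous_on UNIV (pds ls (u t))" for ls t
    using cont_Q_slice[OF c] by blast
  have C1: "C1_torus (pds ls (u t))" if "length ls < b" "t \<in> {0..T}" for ls t
    unfolding C1_torus_def
    using that e[OF that] cs[of ls t] cs[of "_ # ls" t] pds_periodic[OF p[OF that(2)]] by auto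
  have "((\<lambda>s. u s x) has_real_derivative dt T u t x) (at t within {0..T})" if "t \<in> {0..T}" for t x
  proof -
    have "(\<lambda>s. u s x) differentiable (at t within {0..T})" using d[of 0] that assms(2) by simp
    then show ?thesis
      by (simp add: vector_derivative_works has_real_derivative_iff_has_vector_derivative dt_def)
  qed
  moreover have "cont_Q T u" "cont_Q T (dt T u)"
    using ct[of 0] ct[of 1] assms(2) by (simp_all add: cont_Q_def)
  moreover have "C1_torus (u t)" "C1_torus (pd l (u t))" if "t \<in> {0..T}" for t l
    using C1[of "[]" t] C1[of "[l]" t] that assms(3) by simp_all
  moreover have "cont_Q T (\<lambda>t. pd l (u t))" "cont_Q T (\<lambda>t. pd l (pd l (u t)))" for l
    using c[of "[l]"] c[of "[l, l]"] assms(3) by simp_all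
  ultimately show ?thesis unfolding C12_torus_def by blast
qed

lemma C12_torus_add:
  fixes u v :: "real \<Rightarrow> real ^ 'd::finite \<Rightarrow> real"
  assumes u: "C12_torus T u ut" and v: "C12_torus T v vt"
  shows "C12_torus T (\<lambda>t x. u t x + v t x) (\<lambda>t x. ut t x + vt t x)"
    "t \<in> {0..T} \<Longrightarrow> lap (\<lambda>x. u t x + v t x) x = lap (u t) x + lap (v t) x"
proof -
  have 1: "pd l (\<lambda>x. u t x + v t x) = (\<lambda>x. pd l (u t) x + pd l (v t) x)" if "t \<in> {0..T}" for l t
    by (intro C1_torus_add C12_torusD(1)[OF u] C12_torusD(1)[OF v] that)
  have 2: "pd l (\<lambda>x. pd l (u t) x + pd l (v t) x) = (\<lambda>x. pd l (pd l (u t)) x + pd l (pd l (v t)) x)"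
    if "t \<in> {0..T}" for l t
    by (intro C1_torus_add C12_torusD(2)[OF u] C12_torusD(2)[OF v] that)
  have 3: "C1_torus (pd l (\<lambda>x. u t x + v t x))" if "t \<in> {0..T}" for l t
    unfolding 1[OF that] by (intro C1_torus_add C12_torusD(2)[OF u] C12_torusD(2)[OF v] that)
  have 4: "cont_Q T (\<lambda>t. pd l (\<lambda>x. u t x + v t x))" for l
    by (rule cont_Q_cong[OF cont_Q_add[OF C12_torusD(6)[OF u, of l] C12_torusD(6)[OF v, of l]]]) (simp add: 1)
  have 5: "cont_Q T (\<lambda>t. pd l (pd l (\<lambda>x. u t x + v t x)))" for l
    by (rule cont_Q_cong[OF cont_Q_add[OF C12_torusD(7)[OF u, of l] C12_torusD(7)[OF v, of l]]]) (simp add: 1 2)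
  show "C12_torus T (\<lambda>t x. u t x + v t x) (\<lambda>t x. ut t x + vt t x)"
    unfolding C12_torus_def using 3 4 5
    by (auto intro!: C1_torus_add cont_Q_add derivative_intros C12_torusD[OF u] C12_torusD[OF v])
  show "lap (\<lambda>x. u t x + v t x) x = lap (u t) x + lap (v t) x" if "t \<in> {0..T}"
    using that by (simp add: lap_def 1 2 sum.distrib)
qed

lemma C12_torus_time:
  fixes a a' :: "real \<Rightarrow> real"
  assumes "\<And>t. t \<in> {0..T} \<Longrightarrow> (a has_real_derivative a' t) (at t within {0..T})" "continuous_on {0..T} a'"
  shows "C12_torus T (\<lambda>t (x :: real ^ 'd::finite). a t) (\<lambda>t x. a' t)" "lap (\<lambda>x :: real ^ 'd::finite. c) y = 0"
proof -
  have "continuous_on {0..T} a" by (rule DERIV_continuous_on[OF assms(1)])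
  then show "C12_torus T (\<lambda>t (x :: real ^ 'd::finite). a t) (\<lambda>t x. a' t)"
    unfolding C12_torus_def using assms
    by (auto simp: C1_torus_const(2) intro!: C1_torus_const(1) cont_Q_time cont_Q_const)
  show "lap (\<lambda>x :: real ^ 'd::finite. c) y = 0" by (simp add: lap_def C1_torus_const(2))
qed

lemma C12_torus_cmult:
  fixes u :: "real \<Rightarrow> real ^ 'd::finite \<Rightarrow> real"
  assumes u: "C12_torus T u ut"
  shows "C12_torus T (\<lambda>t x. c * u t x) (\<lambda>t x. c * ut t x)"
    "t \<in> {0..T} \<Longrightarrow> lap (\<lambda>x. c * u t x) x = c * lap (u t) x"
proof -
  have 1: "pd l (\<lambda>x. c * u t x) = (\<lambda>x. c * pd l (u t) x)" if "t \<in> {0..T}" for l t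
    by (intro C1_torus_cmult C12_torusD(1)[OF u] that)
  have 2: "pd l (\<lambda>x. c * pd l (u t) x) = (\<lambda>x. c * pd l (pd l (u t)) x)"
    if "t \<in> {0..T}" for l t
    by (intro C1_torus_cmult C12_torusD(2)[OF u] that)
  have 3: "C1_torus (pd l (\<lambda>x. c * u t x))" if "t \<in> {0..T}" for l t
    unfolding 1[OF that] by (intro C1_torus_cmult C12_torusD(2)[OF u] that)
  have 4: "cont_Q T (\<lambda>t. pd l (\<lambda>x. c * u t x))" for l
    by (rule cont_Q_cong[OF cont_Q_mult[OF cont_Q_const C12_torusD(6)[OF u, of l]], of _ c]) (simp add: 1)
  have 5: "cont_Q T (\<lambda>t. pd l (pd l (\<lambda>x. c * u t x)))" for l
    by (rule cont_Q_cong[OF cont_Q_mult[OF cont_Q_const C12_torusD(7)[OF u, of l]], of _ c]) (simp add: 1 2)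
  show "C12_torus T (\<lambda>t x. c * u t x) (\<lambda>t x. c * ut t x)"
    unfolding C12_torus_def using 3 4 5
    by (auto intro!: C1_torus_cmult cont_Q_mult cont_Q_const DERIV_cmult C12_torusD[OF u])
  show "lap (\<lambda>x. c * u t x) x = c * lap (u t) x" if "t \<in> {0..T}"
    using that by (simp add: lap_def 1 2 sum_distrib_left)
qed

lemma C12_torus_reverse:
  fixes u :: "real \<Rightarrow> real ^ 'd::finite \<Rightarrow> real"
  assumes u: "C12_torus T u ut"
  shows "C12_torus T (\<lambda>t. u (T - t)) (\<lambda>t x. - ut (T - t) x)"
proof -
  have c: "cont_Q T (\<lambda>t. g (T - t))" if "cont_Q T g" for g :: "real \<Rightarrow> real ^ 'd \<Rightarrow> real"
  proof -
    have "continuous_on ({0..T} \<times> UNIV) (\<lambda>p. case (T - fst p, snd p) of (t, x) \<Rightarrow> g t x)"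
      by (rule continuous_on_compose2[OF that[unfolded cont_Q_def]]) (auto intro!: continuous_intros)
    then show ?thesis by (simp add: cont_Q_def split_beta)
  qed
  have d: "((\<lambda>s. u (T - s) x) has_real_derivative - ut (T - t) x) (at t within {0..T})"
    if "t \<in> {0..T}" for t x
  proof -
    have "((\<lambda>s. u s x) has_real_derivative ut (T - t) x) (at (T - t) within (\<lambda>s. T - s) ` {0..T})"
      using C12_torusD(3)[OF u, of "T - t" x] that by simp
    moreover have "((\<lambda>s. T - s) has_real_derivative - 1) (at t within {0..T})"
      by (auto intro!: derivative_eq_intros)
    ultimately show ?thesis using DERIV_image_chain by (fastforce simp: o_def)
  qed
  show ?thesis unfolding C12_torus_def
    using c[OF C12_torusD(4)[OF u]] cont_Q_minus[OF c[OF C12_torusD(5)[OF u]]]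
      c[OF C12_torusD(6)[OF u]] c[OF C12_torusD(7)[OF u]] d
      C12_torusD(1,2)[OF u]
    by simp
qed

section \<open>The maximum principle\<close>

lemma second_derivative_nonneg_at_minimum:
  fixes p p' :: "real \<Rightarrow> real"
  assumes p: "\<And>s. (p has_real_derivative p' s) (at s)" and D: "(p' has_real_derivative D) (at 0)"
    and min: "\<And>s. p 0 \<le> p s"
  shows "0 \<le> D"
proof (rule ccontr)
  assume "\<not> 0 \<le> D"
  then obtain d where d: "0 < d" "\<And>h. 0 < h \<Longrightarrow> h < d \<Longrightarrow> p' h < p' 0"
    using DERIV_neg_dec_right[OF D] by force
  have "p' 0 = 0" by (rule DERIV_local_min[OF p zero_less_one]) (use min in auto)
  then have "p (d / 2) < p 0"
    using d by (intro DERIV_neg_imp_decreasing_open[of 0 "d / 2" p])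
      (auto intro!: p exI[of _ "p' _"] DERIV_continuous_on DERIV_subset[OF p])
  then show False using min[of "d / 2"] by simp
qed

lemma lap_nonneg_at_minimum:
  fixes w :: "real ^ 'd::finite \<Rightarrow> real"
  assumes "C1_torus w" "\<And>l. C1_torus (pd l w)" "\<And>y. w x \<le> w y"
  shows "0 \<le> lap w x"
  unfolding lap_def
proof (rule sum_nonneg)
  fix l
  show "0 \<le> pd l (pd l w) x"
    by (rule second_derivative_nonneg_at_minimum[of "\<lambda>h. w (x + h *\<^sub>R axis l 1)"
          "\<lambda>h. pd l w (x + h *\<^sub>R axis l 1)"])
      (use pd_along_line[OF C1_torusD(2)[OF assms(1)], of x l _ UNIV]
        pd_along_line[OF C1_torusD(2)[OF assms(2)], of _ x l 0 UNIV] assms(3) in auto)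
qed

lemma forward_maximum_principle:
  fixes w :: "real \<Rightarrow> real ^ 'd::finite \<Rightarrow> real"
  assumes "0 \<le> \<nu>" and w: "C12_torus T w wt"
    and c: "\<And>t x. t \<in> {0..T} \<Longrightarrow> 0 \<le> c t x"
    and super: "\<And>t x. t \<in> {0..T} \<Longrightarrow> 0 \<le> wt t x - \<nu> * lap (w t) x + c t x * w t x"
    and init: "\<And>x. 0 \<le> w 0 x" and t: "t \<in> {0..T}"
  shows "0 \<le> w t x"
proof -
  have T: "0 \<le> T" using t by simp
  \<comment> \<open>A negative minimum of the strict supersolution \<open>w + \<epsilon> t\<close> is impossible.\<close>
  have eps: "0 \<le> w t x + \<epsilon> * t" if \<epsilon>: "0 < \<epsilon>" for \<epsilon>
  proof -
    have "cont_Q T (\<lambda>t x. w t x + \<epsilon> * t)"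
      by (intro cont_Q_add C12_torusD(4)[OF w] cont_Q_time continuous_intros)
    moreover have "periodic (\<lambda>x. w t x + \<epsilon> * t)" if "t \<in> {0..T}" for t
      using C1_torusD(1)[OF C12_torusD(1)[OF w that]] by (simp add: periodic_def)
    ultimately obtain t0 x0 where t0: "t0 \<in> {0..T}"
      and min: "\<And>t x. t \<in> {0..T} \<Longrightarrow> w t0 x0 + \<epsilon> * t0 \<le> w t x + \<epsilon> * t"
      using periodic_bounded_below[OF T, of "\<lambda>t x. w t x + \<epsilon> * t"] unfolding cont_Q_def by blast
    have "0 \<le> w t0 x0 + \<epsilon> * t0"
    proof (rule ccontr)
      assume neg: "\<not> 0 \<le> w t0 x0 + \<epsilon> * t0"
      then have "t0 \<noteq> 0" using init[of x0] by auto
      then have t0': "0 < t0" using t0 by simp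
      have lap: "0 \<le> lap (w t0) x0"
        using lap_nonneg_at_minimum[OF C12_torusD(1,2)[OF w t0], of x0] min[OF t0] by simp
      have "wt t0 x0 + \<epsilon> \<le> 0"
      proof (rule ccontr)
        assume "\<not> wt t0 x0 + \<epsilon> \<le> 0"
        moreover have "((\<lambda>s. w s x0 + \<epsilon> * s) has_real_derivative wt t0 x0 + \<epsilon>) (at t0 within {0..T})"
          by (rule derivative_eq_intros C12_torusD(3)[OF w t0] refl | simp)+
        ultimately obtain d where d: "0 < d"
          "\<And>h. 0 < h \<Longrightarrow> t0 - h \<in> {0..T} \<Longrightarrow> h < d \<Longrightarrow> w (t0 - h) x0 + \<epsilon> * (t0 - h) < w t0 x0 + \<epsilon> * t0"
          using has_real_derivative_pos_inc_left[of "\<lambda>s. w s x0 + \<epsilon> * s"] by (meson not_le)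
        define h where "h = min (d / 2) t0"
        have "0 < h" "h < d" "t0 - h \<in> {0..T}" using d(1) t0 t0' by (auto simp: h_def)
        then show False using d(2)[of h] min[of "t0 - h" x0] by force
      qed
      moreover have "w t0 x0 < 0" using neg t0' \<epsilon> mult_pos_pos[OF \<epsilon> t0'] by linarith
      then have "c t0 x0 * w t0 x0 \<le> 0" using c[OF t0, of x0] by (simp add: mult_nonneg_nonpos)
      moreover have "0 \<le> \<nu> * lap (w t0) x0" using lap assms(1) by simp
      ultimately show False using super[OF t0, of x0] \<epsilon> by linarith
    qed
    then show ?thesis using min[OF t, of x] by simp
  qed
  show ?thesis
  proof (rule ccontr)
    assume neg: "\<not> 0 \<le> w t x"
    have "0 \<le> w t x + - w t x / (2 * (t + 1)) * t"
      using neg t by (intro eps divide_pos_pos) auto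
    also have "\<dots> = w t x * ((t + 2) / (2 * (t + 1)))" using t by (simp add: field_simps)
    also have "\<dots> < 0" using neg t by (intro mult_neg_pos divide_pos_pos) auto
    finally show False by simp
  qed
qed

text \<open>The forward principle for the function run backwards in time.\<close>

lemma backward_maximum_principle:
  fixes w :: "real \<Rightarrow> real ^ 'd::finite \<Rightarrow> real"
  assumes "0 \<le> \<nu>" and w: "C12_torus T w wt"
    and c: "\<And>t x. t \<in> {0..T} \<Longrightarrow> 0 \<le> c t x"
    and super: "\<And>t x. t \<in> {0..T} \<Longrightarrow> 0 \<le> - wt t x - \<nu> * lap (w t) x + c t x * w t x"
    and final: "\<And>x. 0 \<le> w T x" and t: "t \<in> {0..T}"
  shows "0 \<le> w t x"
proof -
  have "0 \<le> w (T - (T - t)) x"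
    by (rule forward_maximum_principle[OF assms(1) C12_torus_reverse[OF w], where c = "\<lambda>t. c (T - t)"])
      (use c super final t in auto)
  then show ?thesis by simp
qed

text \<open>The backward equation of the Hopf--Cole transformed Hamilton--Jacobi equation.\<close>

definition backward_solution :: "real \<Rightarrow> real \<Rightarrow> (real \<Rightarrow> real ^ 'd::finite \<Rightarrow> real) \<Rightarrow>
    (real \<Rightarrow> real ^ 'd \<Rightarrow> real) \<Rightarrow> (real \<Rightarrow> real ^ 'd \<Rightarrow> real) \<Rightarrow> bool" where
  "backward_solution T \<nu> \<gamma> \<phi> \<phi>t \<longleftrightarrow> C12_torus T \<phi> \<phi>t
     \<and> (\<forall>t\<in>{0..T}. \<forall>x. \<phi>t t x + \<nu> * lap (\<phi> t) x = \<gamma> t x * \<phi> t x / (2 * \<nu>))"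

text \<open>Comparison with the solution that is constant in space and has the largest possible potential.\<close>

lemma backward_solution_lower_bound:
  fixes \<phi> :: "real \<Rightarrow> real ^ 'd::finite \<Rightarrow> real"
  assumes "0 < \<nu>" "backward_solution T \<nu> \<gamma> \<phi> \<phi>t"
    and \<gamma>: "\<And>t x. t \<in> {0..T} \<Longrightarrow> 0 \<le> \<gamma> t x" "\<And>t x. t \<in> {0..T} \<Longrightarrow> \<gamma> t x \<le> C0"
    and b: "0 < b" "\<And>x. b \<le> \<phi> T x" and t: "t \<in> {0..T}"
  shows "b * exp (- C0 * T / (2 * \<nu>)) \<le> \<phi> t x"
proof -
  define K where "K = C0 / (2 * \<nu>)"
  have C0: "0 \<le> C0" using \<gamma>[OF t] by (meson order_trans)
  then have K: "0 \<le> K" using assms(1) by (simp add: K_def)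
  define a where "a t = - b * exp (- K * (T - t))" for t
  have a': "(a has_real_derivative K * a t) (at t within {0..T})" for t
    unfolding a_def by (auto intro!: derivative_eq_intros)
  have \<phi>: "C12_torus T \<phi> \<phi>t" "\<And>t x. t \<in> {0..T} \<Longrightarrow> \<phi>t t x + \<nu> * lap (\<phi> t) x = \<gamma> t x * \<phi> t x / (2 * \<nu>)"
    using assms(2) unfolding backward_solution_def by auto
  have ca: "continuous_on {0..T} (\<lambda>t. K * a t)" unfolding a_def by (intro continuous_intros)
  note A = C12_torus_time[of T a "\<lambda>t. K * a t", OF a' ca]
  note w = C12_torus_add[OF \<phi>(1) A(1)]
  have "0 \<le> \<phi> t x + a t"
  proof (rule backward_maximum_principle[OF less_imp_le[OF assms(1)] w(1), where c = "\<lambda>t x. \<gamma> t x / (2 * \<nu>)"])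
    fix t x assume t: "t \<in> {0..T}"
    have "- (\<phi>t t x + K * a t) - \<nu> * lap (\<lambda>x. \<phi> t x + a t) x + \<gamma> t x / (2 * \<nu>) * (\<phi> t x + a t)
        = (K - \<gamma> t x / (2 * \<nu>)) * (- a t)"
      using \<phi>(2)[OF t, of x] w(2)[OF t, of x] A(2)[of "a t" x] by (simp add: algebra_simps add_divide_distrib)
    also have "\<dots> \<ge> 0"
      using \<gamma>(2)[OF t, of x] assms(1) b(1)
      by (intro mult_nonneg_nonneg) (auto simp: K_def a_def divide_right_mono)
    finally show "0 \<le> - (\<phi>t t x + K * a t) - \<nu> * lap (\<lambda>x. \<phi> t x + a t) x + \<gamma> t x / (2 * \<nu>) * (\<phi> t x + a t)" .
    show "0 \<le> \<gamma> t x / (2 * \<nu>)" using \<gamma>(1)[OF t, of x] assms(1) by simp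
  qed (use b t in \<open>auto simp: a_def\<close>)
  moreover have "b * exp (- C0 * T / (2 * \<nu>)) \<le> b * exp (- K * (T - t))"
  proof -
    have "K * (T - t) \<le> K * T" using K t by (intro mult_left_mono) auto
    then show ?thesis using b by (simp add: K_def)
  qed
  ultimately show ?thesis by (simp add: a_def)
qed

text \<open>The difference of two solutions solves an equation whose right-hand side is the difference of the
  potentials times the second solution; integrating its bound over time gives a barrier.\<close>

lemma backward_solution_stability:
  fixes \<phi>1 \<phi>2 :: "real \<Rightarrow> real ^ 'd::finite \<Rightarrow> real"
  assumes "0 < \<nu>" "backward_solution T \<nu> \<gamma>1 \<phi>1 \<phi>1t" "backward_solution T \<nu> \<gamma>2 \<phi>2 \<phi>2t"
    and \<gamma>: "\<And>t x. t \<in> {0..T} \<Longrightarrow> 0 \<le> \<gamma>1 t x" "\<And>t x. t \<in> {0..T} \<Longrightarrow> \<bar>\<gamma>1 t x - \<gamma>2 t x\<bar> \<le> \<eta>"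
    and B: "\<And>t x. t \<in> {0..T} \<Longrightarrow> \<bar>\<phi>2 t x\<bar> \<le> B" and "\<And>x. \<phi>1 T x = \<phi>2 T x" and t: "t \<in> {0..T}"
  shows "\<bar>\<phi>1 t x - \<phi>2 t x\<bar> \<le> T * (\<eta> * B / (2 * \<nu>))"
proof -
  define \<kappa> where "\<kappa> = \<eta> * B / (2 * \<nu>)"
  have "0 \<le> \<eta>" "0 \<le> B" using \<gamma>(2)[OF t] B[OF t] abs_ge_zero order_trans by blast+
  then have \<kappa>: "0 \<le> \<kappa>" using assms(1) by (simp add: \<kappa>_def)
  have \<phi>1: "C12_torus T \<phi>1 \<phi>1t" "\<And>t x. t \<in> {0..T} \<Longrightarrow> \<phi>1t t x + \<nu> * lap (\<phi>1 t) x = \<gamma>1 t x * \<phi>1 t x / (2 * \<nu>)"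
    using assms(2) unfolding backward_solution_def by auto
  have \<phi>2: "C12_torus T \<phi>2 \<phi>2t" "\<And>t x. t \<in> {0..T} \<Longrightarrow> \<phi>2t t x + \<nu> * lap (\<phi>2 t) x = \<gamma>2 t x * \<phi>2 t x / (2 * \<nu>)"
    using assms(3) unfolding backward_solution_def by auto
  have A: "C12_torus T (\<lambda>t x :: real ^ 'd. \<kappa> * (T - t)) (\<lambda>t x. - \<kappa>)"
    by (intro C12_torus_time) (auto intro!: derivative_eq_intros)
  have lap0: "lap (\<lambda>x :: real ^ 'd. c) y = 0" for c y by (simp add: lap_def C1_torus_const(2))
  \<comment> \<open>Both signs of the difference are dominated by the linear barrier.\<close>
  have "0 \<le> (\<sigma> * \<phi>1 t x + - \<sigma> * \<phi>2 t x) + \<kappa> * (T - t)" if \<sigma>: "\<bar>\<sigma>\<bar> = 1" for \<sigma>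
  proof -
    note a1 = C12_torus_cmult[OF \<phi>1(1), where c = \<sigma>] and a2 = C12_torus_cmult[OF \<phi>2(1), where c = "-\<sigma>"]
    note s = C12_torus_add[OF a1(1) a2(1)]
    note w = C12_torus_add[OF s(1) A]
    show ?thesis
    proof (rule backward_maximum_principle[OF less_imp_le[OF assms(1)] w(1), where c = "\<lambda>t x. \<gamma>1 t x / (2 * \<nu>)"])
      fix t x assume t: "t \<in> {0..T}"
      let ?c = "\<gamma>1 t x / (2 * \<nu>)"
      have c: "0 \<le> ?c" using \<gamma>(1)[OF t, of x] assms(1) by simp
      then show "0 \<le> \<gamma>1 t x / (2 * \<nu>)" .
      have "\<bar>(\<gamma>1 t x - \<gamma>2 t x) * \<phi>2 t x\<bar> \<le> \<eta> * B"
        unfolding abs_mult by (intro mult_mono \<gamma> B t \<open>0 \<le> \<eta>\<close> abs_ge_zero)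
      then have b: "\<bar>\<sigma> * ((\<gamma>1 t x - \<gamma>2 t x) * \<phi>2 t x) / (2 * \<nu>)\<bar> \<le> \<kappa>"
        using assms(1) \<sigma> by (simp add: \<kappa>_def abs_mult divide_right_mono)
      have n: "0 \<le> ?c * (\<kappa> * (T - t))" using c \<kappa> t by (intro mult_nonneg_nonneg) auto
      have L: "lap (\<lambda>x. (\<sigma> * \<phi>1 t x + - \<sigma> * \<phi>2 t x) + \<kappa> * (T - t)) x
          = \<sigma> * lap (\<phi>1 t) x - \<sigma> * lap (\<phi>2 t) x"
        unfolding w(2)[OF t] s(2)[OF t] a1(2)[OF t] a2(2)[OF t] lap0 by simp
      have e: "\<phi>1t t x = \<gamma>1 t x * \<phi>1 t x / (2 * \<nu>) - \<nu> * lap (\<phi>1 t) x"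
        "\<phi>2t t x = \<gamma>2 t x * \<phi>2 t x / (2 * \<nu>) - \<nu> * lap (\<phi>2 t) x"
        using \<phi>1(2)[OF t, of x] \<phi>2(2)[OF t, of x] by simp_all
      have "- ((\<sigma> * \<phi>1t t x + - \<sigma> * \<phi>2t t x) + - \<kappa>)
          - \<nu> * lap (\<lambda>x. (\<sigma> * \<phi>1 t x + - \<sigma> * \<phi>2 t x) + \<kappa> * (T - t)) x
          + ?c * ((\<sigma> * \<phi>1 t x + - \<sigma> * \<phi>2 t x) + \<kappa> * (T - t))
        = \<kappa> + ?c * (\<kappa> * (T - t)) - \<sigma> * ((\<gamma>1 t x - \<gamma>2 t x) * \<phi>2 t x) / (2 * \<nu>)"
        unfolding L e by (simp add: algebra_simps add_divide_distrib diff_divide_distrib)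
      with b n show "0 \<le> - ((\<sigma> * \<phi>1t t x + - \<sigma> * \<phi>2t t x) + - \<kappa>)
          - \<nu> * lap (\<lambda>x. (\<sigma> * \<phi>1 t x + - \<sigma> * \<phi>2 t x) + \<kappa> * (T - t)) x
          + ?c * ((\<sigma> * \<phi>1 t x + - \<sigma> * \<phi>2 t x) + \<kappa> * (T - t))"
        by linarith
    qed (use assms(7) t in auto)
  qed
  from this[of 1] this[of "-1"] have "\<bar>\<phi>1 t x - \<phi>2 t x\<bar> \<le> \<kappa> * (T - t)" by auto
  also have "\<dots> \<le> \<kappa> * T" using \<kappa> t by (intro mult_left_mono) auto
  finally show ?thesis by (simp add: \<kappa>_def mult.commute)
qed

section \<open>Relaxed Fokker--Planck states\<close>

lemma C1_torus_grad:
  fixes w :: "real ^ 'd::finite \<Rightarrow> real"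
  assumes "C1_torus w"
  shows "continuous_on S (grad w)"
  unfolding grad_def by (intro continuous_on_vec_lambda C1_torus_continuous_on assms)

lemma inner_grad:
  fixes w :: "real ^ 'd::finite \<Rightarrow> real"
  shows "grad w x \<bullet> q = (\<Sum>l\<in>UNIV. pd l w x * q $ l)"
  by (simp add: grad_def inner_vec_def)

lemma norm_grad_sq:
  fixes w :: "real ^ 'd::finite \<Rightarrow> real"
  shows "(norm (grad w x))\<^sup>2 = (\<Sum>l\<in>UNIV. (pd l w x)\<^sup>2)"
  unfolding power2_norm_eq_inner inner_grad by (simp add: grad_def power2_eq_square)

text \<open>A Fokker--Planck state. In the weak equation the diffusive flux stays on the side of the test
  function, so no second derivative of the density is required and averages of states are again states.
  The last clause is the linear form of $|Q|^2 \le 2 m e$; it makes \<open>e\<close> an upper bound for the kinetic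
  energy density.\<close>

definition fp_state :: "real \<Rightarrow> real \<Rightarrow> (real ^ 'd::finite \<Rightarrow> real) \<Rightarrow> (real \<Rightarrow> real ^ 'd \<Rightarrow> real)
    \<Rightarrow> (real \<Rightarrow> real ^ 'd \<Rightarrow> real) \<Rightarrow> (real \<Rightarrow> real ^ 'd \<Rightarrow> real ^ 'd) \<Rightarrow> (real \<Rightarrow> real ^ 'd \<Rightarrow> real) \<Rightarrow> bool" where
  "fp_state T \<nu> m0 m mt Q e \<longleftrightarrow>
     (\<forall>t\<in>{0..T}. C1_torus (m t))
   \<and> (\<forall>t\<in>{0..T}. \<forall>x. ((\<lambda>s. m s x) has_real_derivative mt t x) (at t within {0..T}))
   \<and> cont_Q T m \<and> cont_Q T mt \<and> cont_Q T Q \<and> cont_Q T e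
   \<and> (\<forall>x. m 0 x = m0 x)
   \<and> (\<forall>t\<in>{0<..<T}. \<forall>\<eta>. C1_torus \<eta> \<longrightarrow>
        torus_int (\<lambda>x. \<eta> x * mt t x) = torus_int (\<lambda>x. grad \<eta> x \<bullet> (Q t x - \<nu> *\<^sub>R grad (m t) x)))
   \<and> (\<forall>t\<in>{0..T}. \<forall>x p. 0 \<le> e t x + Q t x \<bullet> p + m t x * (norm p)\<^sup>2 / 2)"

lemma fp_stateD:
  assumes "fp_state T \<nu> m0 m mt Q e"
  shows "t \<in> {0..T} \<Longrightarrow> C1_torus (m t)"
    "t \<in> {0..T} \<Longrightarrow> ((\<lambda>s. m s x) has_real_derivative mt t x) (at t within {0..T})"
    "cont_Q T m" "cont_Q T mt" "cont_Q T Q" "cont_Q T e" "m 0 x = m0 x"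
    "t \<in> {0<..<T} \<Longrightarrow> C1_torus \<eta> \<Longrightarrow>
        torus_int (\<lambda>x. \<eta> x * mt t x) = torus_int (\<lambda>x. grad \<eta> x \<bullet> (Q t x - \<nu> *\<^sub>R grad (m t) x))"
    "t \<in> {0..T} \<Longrightarrow> 0 \<le> e t x + Q t x \<bullet> p + m t x * (norm p)\<^sup>2 / 2"
  using assms unfolding fp_state_def by blast+

lemma grad_combine:
  fixes v w :: "real ^ 'd::finite \<Rightarrow> real"
  assumes "C1_torus v" "C1_torus w"
  shows "C1_torus (\<lambda>x. a * v x + b * w x)"
    "grad (\<lambda>x. a * v x + b * w x) x = a *\<^sub>R grad v x + b *\<^sub>R grad w x"
proof -
  note 1 = C1_torus_cmult[OF assms(1), where c = a] and 2 = C1_torus_cmult[OF assms(2), where c = b]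
  show "C1_torus (\<lambda>x. a * v x + b * w x)" by (rule C1_torus_add(1)[OF 1(1) 2(1)])
  have "pd l (\<lambda>x. a * v x + b * w x) = (\<lambda>x. a * pd l v x + b * pd l w x)" for l
    using C1_torus_add(2)[OF 1(1) 2(1)] C1_torus_cmult(2)[OF assms(1)] C1_torus_cmult(2)[OF assms(2)] by simp
  then show "grad (\<lambda>x. a * v x + b * w x) x = a *\<^sub>R grad v x + b *\<^sub>R grad w x"
    by (simp add: grad_def vec_eq_iff)
qed

lemma fp_weak_combine:
  fixes m1 m2 \<eta> :: "real ^ 'd::finite \<Rightarrow> real"
  assumes 1: "torus_int (\<lambda>x. \<eta> x * d1 x) = torus_int (\<lambda>x. grad \<eta> x \<bullet> (Q1 x - \<nu> *\<^sub>R grad m1 x))"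
    and 2: "torus_int (\<lambda>x. \<eta> x * d2 x) = torus_int (\<lambda>x. grad \<eta> x \<bullet> (Q2 x - \<nu> *\<^sub>R grad m2 x))"
    and C: "C1_torus \<eta>" "C1_torus m1" "C1_torus m2" "continuous_on UNIV d1" "continuous_on UNIV d2"
      "continuous_on UNIV Q1" "continuous_on UNIV Q2"
  shows "torus_int (\<lambda>x. \<eta> x * (a * d1 x + b * d2 x))
    = torus_int (\<lambda>x. grad \<eta> x \<bullet> ((a *\<^sub>R Q1 x + b *\<^sub>R Q2 x) - \<nu> *\<^sub>R grad (\<lambda>x. a * m1 x + b * m2 x) x))"
proof -
  have "torus_int (\<lambda>x. \<eta> x * (a * d1 x + b * d2 x)) = torus_int (\<lambda>x. a * (\<eta> x * d1 x) + b * (\<eta> x * d2 x))"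
    by (simp add: algebra_simps)
  also have "\<dots> = a * torus_int (\<lambda>x. \<eta> x * d1 x) + b * torus_int (\<lambda>x. \<eta> x * d2 x)"
    by (subst torus_int_add) (auto intro!: continuous_intros C C1_torusD(3)[OF C(1)])
  also have "\<dots> = a * torus_int (\<lambda>x. grad \<eta> x \<bullet> (Q1 x - \<nu> *\<^sub>R grad m1 x))
      + b * torus_int (\<lambda>x. grad \<eta> x \<bullet> (Q2 x - \<nu> *\<^sub>R grad m2 x))" by (simp only: 1 2)
  also have "\<dots> = torus_int (\<lambda>x. a * (grad \<eta> x \<bullet> (Q1 x - \<nu> *\<^sub>R grad m1 x))
      + b * (grad \<eta> x \<bullet> (Q2 x - \<nu> *\<^sub>R grad m2 x)))"
    by (subst torus_int_add) (auto intro!: continuous_intros C C1_torus_grad)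
  finally show ?thesis
    by (simp add: grad_combine(2)[OF C(2,3)] inner_diff_right inner_add_right algebra_simps)
qed

lemma fp_state_combine:
  fixes m :: "real \<Rightarrow> real ^ 'd::finite \<Rightarrow> real"
  assumes 1: "fp_state T \<nu> m0 m1 mt1 Q1 e1" and 2: "fp_state T \<nu> m0 m2 mt2 Q2 e2"
    and \<theta>: "0 \<le> \<theta>" "\<theta> \<le> 1" and T: "0 \<le> T"
    and m: "\<And>t x. t \<in> {0..T} \<Longrightarrow> m t x = (1 - \<theta>) * m1 t x + \<theta> * m2 t x"
  shows "fp_state T \<nu> m0 m (\<lambda>t x. (1 - \<theta>) * mt1 t x + \<theta> * mt2 t x)
    (\<lambda>t x. (1 - \<theta>) *\<^sub>R Q1 t x + \<theta> *\<^sub>R Q2 t x) (\<lambda>t x. (1 - \<theta>) * e1 t x + \<theta> * e2 t x)"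
proof -
  note D1 = fp_stateD[OF 1] and D2 = fp_stateD[OF 2]
  have m': "m t = (\<lambda>x. (1 - \<theta>) * m1 t x + \<theta> * m2 t x)" if "t \<in> {0..T}" for t
    using m[OF that] by (simp add: fun_eq_iff)
  have der: "((\<lambda>s. m s x) has_real_derivative (1 - \<theta>) * mt1 t x + \<theta> * mt2 t x) (at t within {0..T})"
    if t: "t \<in> {0..T}" for t x
  proof (rule has_field_derivative_transform_within[OF _ zero_less_one t])
    show "((\<lambda>s. (1 - \<theta>) * m1 s x + \<theta> * m2 s x) has_real_derivative (1 - \<theta>) * mt1 t x + \<theta> * mt2 t x)
        (at t within {0..T})"
      by (intro DERIV_add DERIV_cmult D1(2) D2(2) t)
  qed (use m in auto)
  have adm: "0 \<le> ((1 - \<theta>) * e1 t x + \<theta> * e2 t x) + ((1 - \<theta>) *\<^sub>R Q1 t x + \<theta> *\<^sub>R Q2 t x) \<bullet> p + m t x * (norm p)\<^sup>2 / 2"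
    if t: "t \<in> {0..T}" for t x p
  proof -
    have "0 \<le> (1 - \<theta>) * (e1 t x + Q1 t x \<bullet> p + m1 t x * (norm p)\<^sup>2 / 2)
        + \<theta> * (e2 t x + Q2 t x \<bullet> p + m2 t x * (norm p)\<^sup>2 / 2)"
      using mult_nonneg_nonneg[OF _ D1(9)[OF t, of x p], of "1 - \<theta>"]
        mult_nonneg_nonneg[OF _ D2(9)[OF t, of x p], of \<theta>] \<theta> by linarith
    then show ?thesis unfolding m[OF t] by (simp add: algebra_simps inner_add_left add_divide_distrib diff_divide_distrib)
  qed
  have "m 0 x = m0 x" for x using m[of 0 x] T D1(7)[of x] D2(7)[of x] by (simp add: algebra_simps)
  moreover have "cont_Q T m"
    by (rule cont_Q_cong[OF _ m]) (intro cont_Q_intros D1 D2)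
  moreover have "C1_torus (m t)" if "t \<in> {0..T}" for t
    unfolding m'[OF that] by (intro grad_combine(1) D1(1) D2(1) that)
  moreover have "torus_int (\<lambda>x. \<eta> x * ((1 - \<theta>) * mt1 t x + \<theta> * mt2 t x))
      = torus_int (\<lambda>x. grad \<eta> x \<bullet> (((1 - \<theta>) *\<^sub>R Q1 t x + \<theta> *\<^sub>R Q2 t x) - \<nu> *\<^sub>R grad (m t) x))"
    if t: "t \<in> {0<..<T}" and \<eta>: "C1_torus \<eta>" for t \<eta>
  proof -
    have t': "t \<in> {0..T}" using t by simp
    show ?thesis unfolding m'[OF t']
      by (intro fp_weak_combine D1(8)[OF t \<eta>] D2(8)[OF t \<eta>] \<eta> D1(1)[OF t'] D2(1)[OF t']
          cont_Q_slice[OF D1(4) t'] cont_Q_slice[OF D2(4) t'] cont_Q_slice[OF D1(5) t'] cont_Q_slice[OF D2(5) t'])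
  qed
  ultimately show ?thesis unfolding fp_state_def
    using der adm by (auto intro!: cont_Q_intros D1(4-6) D2(4-6))
qed

text \<open>For a drift \<open>v\<close> the admissibility condition is a square, because
  $\frac12 m|v|^2 + m\, v \cdot p + \frac12 m |p|^2 = \frac12 m |v+p|^2$.\<close>

lemma fp_state_of_drift:
  fixes m :: "real \<Rightarrow> real ^ 'd::finite \<Rightarrow> real"
  assumes m: "C12_torus T m mt" "\<And>t x. t \<in> {0..T} \<Longrightarrow> 0 \<le> m t x" "\<And>x. m 0 x = m0 x"
    and v: "cont_Q T v" "\<And>t l. t \<in> {0..T} \<Longrightarrow> C1_torus (\<lambda>x. v t x $ l)"
    and eq: "\<And>t x. t \<in> {0<..<T} \<Longrightarrow> mt t x - \<nu> * lap (m t) x + div_x (\<lambda>y. m t y *\<^sub>R v t y) x = 0"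
  shows "fp_state T \<nu> m0 m mt (\<lambda>t x. m t x *\<^sub>R v t x) (\<lambda>t x. m t x * (norm (v t x))\<^sup>2 / 2)"
proof -
  have weak: "torus_int (\<lambda>x. \<eta> x * mt t x) = torus_int (\<lambda>x. grad \<eta> x \<bullet> (m t x *\<^sub>R v t x - \<nu> *\<^sub>R grad (m t) x))"
    if t0: "t \<in> {0<..<T}" and \<eta>: "C1_torus \<eta>" for t \<eta>
  proof -
    have t: "t \<in> {0..T}" using t0 by simp
    note mt = C12_torusD(1,2)[OF m(1) t]
    have mv: "C1_torus (\<lambda>x. m t x * v t x $ l)" for l by (intro C1_torus_mult mt v t)
    have cw: "C1_torus (\<lambda>x. \<nu> * pd l (m t) x)" for l by (intro C1_torus_cmult mt)
    have w: "C1_torus (\<lambda>x. \<nu> * pd l (m t) x - m t x * v t x $ l)"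
      "pd l (\<lambda>x. \<nu> * pd l (m t) x - m t x * v t x $ l)
        = (\<lambda>x. \<nu> * pd l (pd l (m t)) x - pd l (\<lambda>x. m t x * v t x $ l) x)" for l
      using C1_torus_diff[OF cw[of l] mv[of l]] C1_torus_cmult(2)[OF mt(2)[of l]] by simp_all
    have "mt t x = (\<Sum>l\<in>UNIV. pd l (\<lambda>x. \<nu> * pd l (m t) x - m t x * v t x $ l) x)" for x
      using eq[OF t0, of x] unfolding w(2)
      by (simp add: lap_def div_x_def sum_subtractf sum_distrib_left)
    then have "torus_int (\<lambda>x. \<eta> x * mt t x)
        = - torus_int (\<lambda>x. \<Sum>l\<in>UNIV. pd l \<eta> x * (\<nu> * pd l (m t) x - m t x * v t x $ l))"
      using torus_int_divergence[OF \<eta> w(1)] by simp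
    also have "\<dots> = torus_int (\<lambda>x. grad \<eta> x \<bullet> (m t x *\<^sub>R v t x - \<nu> *\<^sub>R grad (m t) x))"
      unfolding inner_grad integral_neg[symmetric] sum_negf[symmetric] by (simp add: grad_def algebra_simps)
    finally show ?thesis .
  qed
  have adm: "0 \<le> m t x * (norm (v t x))\<^sup>2 / 2 + m t x *\<^sub>R v t x \<bullet> p + m t x * (norm p)\<^sup>2 / 2"
    if "t \<in> {0..T}" for t x p
  proof -
    have "m t x * (norm (v t x))\<^sup>2 / 2 + m t x *\<^sub>R v t x \<bullet> p + m t x * (norm p)\<^sup>2 / 2
        = m t x * (norm (v t x + p))\<^sup>2 / 2"
      by (simp add: power2_norm_eq_inner algebra_simps inner_commute add_divide_distrib)
    also have "\<dots> \<ge> 0" using m(2)[OF that] by simp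
    finally show ?thesis .
  qed
  have "cont_Q T (\<lambda>t x. m t x * (norm (v t x))\<^sup>2 * (1 / 2))" "cont_Q T (\<lambda>t x. m t x *\<^sub>R v t x)"
    by (intro cont_Q_intros C12_torusD(4)[OF m(1)] v(1))+
  then show ?thesis unfolding fp_state_def
    using weak adm m(3) C12_torusD(1,3-5)[OF m(1)] by simp
qed

text \<open>The best response. Its drift is $2\nu\nabla\phi/\phi$, and the product rule for $\phi\psi$ shows that
  the total flux is $\nu(\psi\nabla\phi - \phi\nabla\psi)$.\<close>

lemma fp_state_of_factors:
  fixes \<phi> \<psi> :: "real \<Rightarrow> real ^ 'd::finite \<Rightarrow> real"
  assumes \<nu>: "0 < \<nu>" and \<phi>: "backward_solution T \<nu> \<gamma> \<phi> \<phi>t" "\<And>t x. t \<in> {0..T} \<Longrightarrow> 0 < \<phi> t x"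
    and \<psi>: "C12_torus T \<psi> \<psi>t" "\<And>t x. t \<in> {0..T} \<Longrightarrow> 0 \<le> \<psi> t x"
      "\<And>t x. t \<in> {0..T} \<Longrightarrow> \<psi>t t x - \<nu> * lap (\<psi> t) x = - (\<gamma> t x * \<psi> t x / (2 * \<nu>))"
    and init: "\<And>x. \<phi> 0 x * \<psi> 0 x = m0 x"
  shows "fp_state T \<nu> m0 (\<lambda>t x. \<phi> t x * \<psi> t x) (\<lambda>t x. \<phi>t t x * \<psi> t x + \<phi> t x * \<psi>t t x)
    (\<lambda>t x. (2 * \<nu> * \<psi> t x) *\<^sub>R grad (\<phi> t) x) (\<lambda>t x. 2 * \<nu>\<^sup>2 * \<psi> t x * (norm (grad (\<phi> t) x))\<^sup>2 / \<phi> t x)"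
proof -
  have \<phi>C: "C12_torus T \<phi> \<phi>t" and \<phi>eq: "\<And>t x. t \<in> {0..T} \<Longrightarrow> \<phi>t t x + \<nu> * lap (\<phi> t) x = \<gamma> t x * \<phi> t x / (2 * \<nu>)"
    using \<phi>(1) unfolding backward_solution_def by auto
  have weak: "torus_int (\<lambda>x. \<eta> x * (\<phi>t t x * \<psi> t x + \<phi> t x * \<psi>t t x))
      = torus_int (\<lambda>x. grad \<eta> x \<bullet> ((2 * \<nu> * \<psi> t x) *\<^sub>R grad (\<phi> t) x - \<nu> *\<^sub>R grad (\<lambda>x. \<phi> t x * \<psi> t x) x))"
    if t0: "t \<in> {0<..<T}" and \<eta>: "C1_torus \<eta>" for t \<eta>
  proof -
    have t: "t \<in> {0..T}" using t0 by simp
    note p = C12_torusD(1,2)[OF \<phi>C t] and q = C12_torusD(1,2)[OF \<psi>(1) t]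
    have w: "C1_torus (\<lambda>x. \<phi> t x * pd l (\<psi> t) x - \<psi> t x * pd l (\<phi> t) x)"
      "pd l (\<lambda>x. \<phi> t x * pd l (\<psi> t) x - \<psi> t x * pd l (\<phi> t) x)
        = (\<lambda>x. \<phi> t x * pd l (pd l (\<psi> t)) x - \<psi> t x * pd l (pd l (\<phi> t)) x)" for l
      using C1_torus_diff[OF C1_torus_mult(1)[OF p(1) q(2)] C1_torus_mult(1)[OF q(1) p(2)], of l l]
        C1_torus_mult(2)[OF p(1) q(2)[of l]] C1_torus_mult(2)[OF q(1) p(2)[of l]] by (simp_all add: algebra_simps)
    note w' = C1_torus_cmult[OF w(1), where c = \<nu>]
    \<comment> \<open>The zeroth order terms cancel in the product rule.\<close>
    have e: "\<phi>t t x = \<gamma> t x * \<phi> t x / (2 * \<nu>) - \<nu> * lap (\<phi> t) x"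
      "\<psi>t t x = \<nu> * lap (\<psi> t) x - \<gamma> t x * \<psi> t x / (2 * \<nu>)" for x
      using \<phi>eq[OF t, of x] \<psi>(3)[OF t, of x] by simp_all
    have "\<phi>t t x * \<psi> t x + \<phi> t x * \<psi>t t x = \<nu> * (\<phi> t x * lap (\<psi> t) x - \<psi> t x * lap (\<phi> t) x)" for x
      unfolding e by (simp add: algebra_simps)
    then have pt: "\<phi>t t x * \<psi> t x + \<phi> t x * \<psi>t t x
        = (\<Sum>l\<in>UNIV. pd l (\<lambda>x. \<nu> * (\<phi> t x * pd l (\<psi> t) x - \<psi> t x * pd l (\<phi> t) x)) x)" for x
      unfolding w'(2) w(2) by (simp add: lap_def sum_distrib_left sum_subtractf right_diff_distrib)
    have "torus_int (\<lambda>x. \<eta> x * (\<phi>t t x * \<psi> t x + \<phi> t x * \<psi>t t x))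
        = - torus_int (\<lambda>x. \<Sum>l\<in>UNIV. pd l \<eta> x * (\<nu> * (\<phi> t x * pd l (\<psi> t) x - \<psi> t x * pd l (\<phi> t) x)))"
      unfolding pt by (rule torus_int_divergence[OF \<eta> w'(1)])
    also have "\<dots> = torus_int (\<lambda>x. grad \<eta> x \<bullet> ((2 * \<nu> * \<psi> t x) *\<^sub>R grad (\<phi> t) x - \<nu> *\<^sub>R grad (\<lambda>x. \<phi> t x * \<psi> t x) x))"
      unfolding inner_grad integral_neg[symmetric] sum_negf[symmetric]
      by (simp add: grad_def C1_torus_mult(2)[OF p(1) q(1)] algebra_simps)
    finally show ?thesis .
  qed
  have adm: "0 \<le> 2 * \<nu>\<^sup>2 * \<psi> t x * (norm (grad (\<phi> t) x))\<^sup>2 / \<phi> t x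
      + (2 * \<nu> * \<psi> t x) *\<^sub>R grad (\<phi> t) x \<bullet> p + (\<phi> t x * \<psi> t x) * (norm p)\<^sup>2 / 2"
    if t: "t \<in> {0..T}" for t x p
  proof -
    have pos: "0 < \<phi> t x" using \<phi>(2)[OF t] .
    have "2 * \<nu>\<^sup>2 * \<psi> t x * (norm (grad (\<phi> t) x))\<^sup>2 / \<phi> t x
        + (2 * \<nu> * \<psi> t x) *\<^sub>R grad (\<phi> t) x \<bullet> p + (\<phi> t x * \<psi> t x) * (norm p)\<^sup>2 / 2
        = \<psi> t x / (2 * \<phi> t x) * (norm ((2 * \<nu>) *\<^sub>R grad (\<phi> t) x + \<phi> t x *\<^sub>R p))\<^sup>2"
    proof -
      have "(norm ((2 * \<nu>) *\<^sub>R grad (\<phi> t) x + \<phi> t x *\<^sub>R p))\<^sup>2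
          = 4 * \<nu>\<^sup>2 * (norm (grad (\<phi> t) x))\<^sup>2 + 4 * \<nu> * \<phi> t x * (grad (\<phi> t) x \<bullet> p) + (\<phi> t x)\<^sup>2 * (norm p)\<^sup>2"
        unfolding power2_norm_eq_inner by (simp add: inner_add_left inner_add_right inner_commute power2_eq_square)
      then show ?thesis using pos by (simp add: field_simps power2_eq_square)
    qed
    also have "\<dots> \<ge> 0" using pos \<psi>(2)[OF t, of x] by simp
    finally show ?thesis .
  qed
  have c: "cont_Q T (\<lambda>t x. 2 * \<nu>\<^sup>2 * \<psi> t x * (norm (grad (\<phi> t) x))\<^sup>2 / \<phi> t x)"
    by (intro cont_Q_divide cont_Q_intros C12_torusD[OF \<phi>C] C12_torusD[OF \<psi>(1)] C12_torus_grad[OF \<phi>C])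
      (use \<phi>(2) in \<open>auto simp: less_le\<close>)
  have d: "((\<lambda>s. \<phi> s x * \<psi> s x) has_real_derivative \<phi>t t x * \<psi> t x + \<phi> t x * \<psi>t t x) (at t within {0..T})"
    if "t \<in> {0..T}" for t x
    using DERIV_mult[OF C12_torusD(3)[OF \<phi>C that] C12_torusD(3)[OF \<psi>(1) that]] by (simp add: mult.commute)
  show ?thesis unfolding fp_state_def
    using weak adm init c d
    by (auto intro!: C1_torus_mult C12_torusD(1,4,5)[OF \<phi>C] C12_torusD(1,4,5)[OF \<psi>(1)] cont_Q_intros C12_torus_grad[OF \<phi>C])
qed

text \<open>The gradient of the value function $u = -2\nu\log\phi$.\<close>

definition hc_drift :: "real \<Rightarrow> (real \<Rightarrow> real ^ 'd::finite \<Rightarrow> real) \<Rightarrow> real \<Rightarrow> real ^ 'd \<Rightarrow> real ^ 'd" where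
  "hc_drift \<nu> \<phi> t x = (- 2 * \<nu> / \<phi> t x) *\<^sub>R grad (\<phi> t) x"

lemma cont_Q_hc_drift:
  assumes "C12_torus T \<phi> \<phi>t" "\<And>t x. t \<in> {0..T} \<Longrightarrow> 0 < \<phi> t x"
  shows "cont_Q T (hc_drift \<nu> \<phi>)"
  unfolding hc_drift_def
  by (intro cont_Q_intros cont_Q_divide C12_torusD[OF assms(1)] C12_torus_grad[OF assms(1)])
    (use assms(2) in \<open>auto simp: less_le\<close>)

text \<open>Duality between states and the Hamilton--Jacobi equation, written for $u = -2\nu\log\phi$: the time
  derivative of $\int u\, m$ is computed with \<open>u\<close> as test function in the weak equation, and the
  equation for \<open>u\<close> eliminates its second derivatives.\<close>

lemma fp_duality:
  fixes \<phi> :: "real \<Rightarrow> real ^ 'd::finite \<Rightarrow> real"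
  assumes T: "0 < T" and \<nu>: "0 < \<nu>" and S: "fp_state T \<nu> m0 m mt Q e"
    and \<phi>: "backward_solution T \<nu> \<gamma> \<phi> \<phi>t" "\<And>t x. t \<in> {0..T} \<Longrightarrow> 0 < \<phi> t x" and \<gamma>: "cont_Q T \<gamma>"
  shows "cyl_int T (\<lambda>t x. e t x + \<gamma> t x * m t x) + torus_int (\<lambda>x. - 2 * \<nu> * ln (\<phi> T x) * m T x)
      - torus_int (\<lambda>x. - 2 * \<nu> * ln (\<phi> 0 x) * m0 x)
    = cyl_int T (\<lambda>t x. e t x + Q t x \<bullet> hc_drift \<nu> \<phi> t x + m t x * (norm (hc_drift \<nu> \<phi> t x))\<^sup>2 / 2)"
proof -
  note D = fp_stateD[OF S]
  have \<phi>C: "C12_torus T \<phi> \<phi>t" and \<phi>eq: "\<And>t x. t \<in> {0..T} \<Longrightarrow> \<phi>t t x + \<nu> * lap (\<phi> t) x = \<gamma> t x * \<phi> t x / (2 * \<nu>)"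
    using \<phi>(1) unfolding backward_solution_def by auto
  have ne: "\<phi> t x \<noteq> 0" if "t \<in> {0..T}" for t x using \<phi>(2)[OF that, of x] by simp
  let ?p = "hc_drift \<nu> \<phi>"
  let ?u = "\<lambda>t x. - 2 * \<nu> * ln (\<phi> t x)"
  let ?ut = "\<lambda>t x. - 2 * \<nu> * (\<phi>t t x / \<phi> t x)"
  let ?R = "\<lambda>t x. Q t x \<bullet> ?p t x + m t x * (norm (?p t x))\<^sup>2 / 2 - \<gamma> t x * m t x"
  have cp: "cont_Q T ?p" by (rule cont_Q_hc_drift[OF \<phi>C \<phi>(2)])
  have cu: "cont_Q T (\<lambda>t x. ln (\<phi> t x))"
    by (rule cont_Q_compose[of "{0<..}" ln, OF _ C12_torusD(4)[OF \<phi>C]])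
      (use \<phi>(2) in \<open>auto intro!: continuous_intros\<close>)
  have cut: "cont_Q T (\<lambda>t x. \<phi>t t x / \<phi> t x)"
    by (intro cont_Q_divide C12_torusD[OF \<phi>C] ne)
  have cR: "cont_Q T ?R" unfolding divide_inverse by (intro cont_Q_intros D cp \<gamma>)
  have der: "((\<lambda>t. torus_int (\<lambda>x. ?u t x * m t x)) has_real_derivative
      torus_int (\<lambda>x. ?ut t x * m t x + ?u t x * mt t x)) (at t within {0..T})" if t: "t \<in> {0..T}" for t
  proof (rule torus_int_has_derivative[OF _ _ _ t])
    fix t x assume t: "t \<in> {0..T}"
    have "((\<lambda>s. ?u s x) has_real_derivative ?ut t x) (at t within {0..T})"
      using C12_torusD(3)[OF \<phi>C t, of x] \<phi>(2)[OF t, of x]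
      by (auto intro!: derivative_eq_intros)
    from DERIV_mult[OF this D(2)[OF t, of x]]
    show "((\<lambda>s. ?u s x * m s x) has_real_derivative ?ut t x * m t x + ?u t x * mt t x) (at t within {0..T})"
      by (simp add: algebra_simps)
    show "continuous_on UNIV (\<lambda>x. ?u t x * m t x)"
      by (intro continuous_on_mult continuous_on_const cont_Q_slice[OF cu t] cont_Q_slice[OF D(3) t])
  next
    show "cont_Q T (\<lambda>t x. ?ut t x * m t x + ?u t x * mt t x)" by (intro cont_Q_intros D cu cut)
  qed
  have interior: "torus_int (\<lambda>x. ?ut t x * m t x + ?u t x * mt t x) = torus_int (?R t)" if t0: "t \<in> {0<..<T}" for t
  proof -
    have t: "t \<in> {0..T}" using t0 by simp
    note f = C12_torusD(1,2)[OF \<phi>C t] and fp = \<phi>(2)[OF t]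
    have u: "C1_torus (?u t)" "grad (?u t) x = ?p t x" for x
      using C1_torus_cmult[OF C1_torus_ln(1)[OF f(1) fp], where c = "-2 * \<nu>"] C1_torus_ln(2)[OF f(1) fp]
      by (simp_all add: grad_def hc_drift_def vec_eq_iff)
    have q: "C1_torus (\<lambda>x. ?p t x $ l)"
      "pd l (\<lambda>x. ?p t x $ l) = (\<lambda>x. - 2 * \<nu> * (pd l (pd l (\<phi> t)) x / \<phi> t x - (pd l (\<phi> t) x)\<^sup>2 / (\<phi> t x)\<^sup>2))" for l
    proof -
      have "(\<lambda>x. ?p t x $ l) = (\<lambda>x. - 2 * \<nu> * (pd l (\<phi> t) x / \<phi> t x))"
        by (simp add: hc_drift_def grad_def)
      then show "C1_torus (\<lambda>x. ?p t x $ l)"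
        "pd l (\<lambda>x. ?p t x $ l) = (\<lambda>x. - 2 * \<nu> * (pd l (pd l (\<phi> t)) x / \<phi> t x - (pd l (\<phi> t) x)\<^sup>2 / (\<phi> t x)\<^sup>2))"
        using C1_torus_cmult[OF C1_torus_divide(1)[OF f(2) f(1) fp], where c = "-2 * \<nu>"]
          C1_torus_divide(2)[OF f(2) f(1) fp, of l l] by (simp_all add: power2_eq_square)
    qed
    have "torus_int (\<lambda>x. ?u t x * mt t x) = torus_int (\<lambda>x. ?p t x \<bullet> (Q t x - \<nu> *\<^sub>R grad (m t) x))"
      using D(8)[OF t0 u(1)] u(2) by simp
    also have "\<dots> = torus_int (\<lambda>x. Q t x \<bullet> ?p t x) - \<nu> * torus_int (\<lambda>x. \<Sum>l\<in>UNIV. ?p t x $ l * pd l (m t) x)"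
    proof -
      have "torus_int (\<lambda>x. ?p t x \<bullet> (Q t x - \<nu> *\<^sub>R grad (m t) x))
          = torus_int (\<lambda>x. Q t x \<bullet> ?p t x - \<nu> * (\<Sum>l\<in>UNIV. ?p t x $ l * pd l (m t) x))"
        by (simp add: inner_diff_right inner_commute[of "?p t _"] inner_grad mult.commute)
      also have "\<dots> = torus_int (\<lambda>x. Q t x \<bullet> ?p t x) - torus_int (\<lambda>x. \<nu> * (\<Sum>l\<in>UNIV. ?p t x $ l * pd l (m t) x))"
        by (intro torus_int_diff continuous_on_inner continuous_on_mult continuous_on_const continuous_on_sum
            cont_Q_slice[OF cp t] cont_Q_slice[OF D(5) t] C1_torusD(3)[OF q(1)] C1_torusD(4)[OF D(1)[OF t]])
      finally show ?thesis by simp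
    qed
    also have "torus_int (\<lambda>x. \<Sum>l\<in>UNIV. ?p t x $ l * pd l (m t) x)
        = - torus_int (\<lambda>x. m t x * (\<Sum>l\<in>UNIV. pd l (\<lambda>x. ?p t x $ l) x))"
      using torus_int_divergence[OF D(1)[OF t] q(1)] by (simp add: mult.commute)
    finally have umt: "torus_int (\<lambda>x. ?u t x * mt t x) = torus_int (\<lambda>x. Q t x \<bullet> ?p t x)
        + torus_int (\<lambda>x. \<nu> * (m t x * (\<Sum>l\<in>UNIV. pd l (\<lambda>x. ?p t x $ l) x)))" by simp
    have c1: "continuous_on UNIV (\<lambda>x. \<nu> * (m t x * (\<Sum>l\<in>UNIV. pd l (\<lambda>x. ?p t x $ l) x)))"
      by (intro continuous_on_sum continuous_on_mult continuous_on_const C1_torusD(4)[OF q(1)] C1_torusD(3)[OF D(1)[OF t]])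
    have c2: "continuous_on UNIV (\<lambda>x. ?ut t x * m t x)"
      by (intro continuous_on_mult continuous_on_const cont_Q_slice[OF cut t] cont_Q_slice[OF D(3) t])
    have c3: "continuous_on UNIV (\<lambda>x. ?u t x * mt t x)"
      by (intro continuous_on_mult continuous_on_const cont_Q_slice[OF cu t] cont_Q_slice[OF D(4) t])
    have c4: "continuous_on UNIV (\<lambda>x. Q t x \<bullet> ?p t x)"
      by (intro continuous_on_inner cont_Q_slice[OF cp t] cont_Q_slice[OF D(5) t])
    have "torus_int (\<lambda>x. ?ut t x * m t x + ?u t x * mt t x)
        = torus_int (\<lambda>x. ?ut t x * m t x + Q t x \<bullet> ?p t x + \<nu> * (m t x * (\<Sum>l\<in>UNIV. pd l (\<lambda>x. ?p t x $ l) x)))"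
      using torus_int_add[OF c2 c3] umt torus_int_add[OF continuous_on_add[OF c2 c4] c1] torus_int_add[OF c2 c4] by linarith
    also have "\<dots> = torus_int (?R t)"
    proof (rule arg_cong[where f = torus_int], rule ext)
      fix x
      have F: "0 < \<phi> t x" by (rule fp)
      have S: "(\<Sum>l\<in>UNIV. pd l (\<lambda>x. ?p t x $ l) x)
          = - 2 * \<nu> * (lap (\<phi> t) x / \<phi> t x - (norm (grad (\<phi> t) x))\<^sup>2 / (\<phi> t x)\<^sup>2)"
        unfolding q(2) lap_def norm_grad_sq sum_divide_distrib sum_subtractf[symmetric] sum_distrib_left ..
      have N: "(norm (?p t x))\<^sup>2 = 4 * \<nu>\<^sup>2 * (norm (grad (\<phi> t) x))\<^sup>2 / (\<phi> t x)\<^sup>2"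
        by (simp add: hc_drift_def power_mult_distrib power_divide power2_abs)
      have E: "\<phi>t t x = \<gamma> t x * \<phi> t x / (2 * \<nu>) - \<nu> * lap (\<phi> t) x" using \<phi>eq[OF t, of x] by simp
      show "?ut t x * m t x + Q t x \<bullet> ?p t x + \<nu> * (m t x * (\<Sum>l\<in>UNIV. pd l (\<lambda>x. ?p t x $ l) x)) = ?R t x"
        unfolding S N E using F \<nu> by (simp add: field_simps power2_eq_square)
    qed
    finally show ?thesis .
  qed
  have "((\<lambda>t. torus_int (?R t)) has_integral torus_int (\<lambda>x. ?u T x * m T x) - torus_int (\<lambda>x. ?u 0 x * m 0 x)) {0..T}"
    by (rule FTC_interior[OF less_imp_le[OF T] der]) (use interior in auto)
  then have "cyl_int T ?R = torus_int (\<lambda>x. ?u T x * m T x) - torus_int (\<lambda>x. ?u 0 x * m0 x)"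
    unfolding cyl_int_def D(7) by (rule integral_unique)
  moreover have "cyl_int T (\<lambda>t x. (e t x + \<gamma> t x * m t x) + ?R t x) = cyl_int T (\<lambda>t x. e t x + \<gamma> t x * m t x) + cyl_int T ?R"
    by (intro cyl_int_add cR) (intro cont_Q_intros D \<gamma>)
  ultimately show ?thesis by (simp add: algebra_simps)
qed

text \<open>Strong convexity of the admissibility condition: near its minimiser it grows at least like the
  square of the deviation, with a constant that is uniform as long as the density is bounded.\<close>

lemma admissible_imp_deviation_bound:
  fixes q :: "'a::real_inner"
  assumes adm: "\<And>p'. 0 \<le> e + Q \<bullet> p' + m * (norm p')\<^sup>2 / 2" and m: "m \<le> B" and B: "0 < B"
  shows "(norm (Q + m *\<^sub>R p))\<^sup>2 \<le> 2 * B * (e + Q \<bullet> p + m * (norm p)\<^sup>2 / 2)"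
proof -
  define q where "q = Q + m *\<^sub>R p"
  define d where "d = e + Q \<bullet> p + m * (norm p)\<^sup>2 / 2"
  define h where "h = - (1 / B) *\<^sub>R q"
  \<comment> \<open>Second order expansion of the admissibility condition at \<open>p\<close>, with the best increment.\<close>
  have "e + Q \<bullet> (p + h) + m * (norm (p + h))\<^sup>2 / 2 = d + q \<bullet> h + m * (norm h)\<^sup>2 / 2"
    by (simp add: d_def q_def power2_norm_eq_inner inner_add_left inner_add_right inner_commute algebra_simps add_divide_distrib)
  then have "0 \<le> d + q \<bullet> h + m * (norm h)\<^sup>2 / 2" using adm[of "p + h"] by simp
  also have "\<dots> \<le> d + q \<bullet> h + B * (norm h)\<^sup>2 / 2" using m by (simp add: mult_right_mono divide_right_mono)
  also have "\<dots> = d - (norm q)\<^sup>2 / (2 * B)"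
  proof -
    have "q \<bullet> h = - (norm q)\<^sup>2 / B" by (simp add: h_def power2_norm_eq_inner)
    moreover have "(norm h)\<^sup>2 = (norm q)\<^sup>2 / B\<^sup>2" using B by (simp add: h_def power_divide)
    ultimately show ?thesis using B by (simp add: field_simps power2_eq_square)
  qed
  finally have "(norm q)\<^sup>2 \<le> 2 * B * d" using B by (simp add: field_simps)
  then show ?thesis unfolding q_def d_def .
qed

text \<open>The difference of the densities is used as test function in the difference of the weak equations.
  The deviation of the momentum splits into a part bounded by the duality integrand and a part
  proportional to the difference of the densities; Gronwall's inequality absorbs the latter.\<close>

lemma fp_energy_estimate:
  fixes m mbar :: "real \<Rightarrow> real ^ 'd::finite \<Rightarrow> real"
  assumes T: "0 < T" and \<nu>: "0 < \<nu>"
    and S: "fp_state T \<nu> m0 m mt Q e" and S': "fp_state T \<nu> m0 mbar mbart (\<lambda>t x. mbar t x *\<^sub>R (- p t x)) ebar"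
    and p: "cont_Q T p" "\<And>t x. t \<in> {0..T} \<Longrightarrow> norm (p t x) \<le> V"
    and B: "0 < B" "\<And>t x. t \<in> {0..T} \<Longrightarrow> m t x \<le> B" and t: "t \<in> {0..T}"
  shows "torus_int (\<lambda>x. (m t x - mbar t x)\<^sup>2)
    \<le> 2 * B / \<nu> * exp (V\<^sup>2 / \<nu> * T) * cyl_int T (\<lambda>t x. e t x + Q t x \<bullet> p t x + m t x * (norm (p t x))\<^sup>2 / 2)"
proof -
  note D = fp_stateD[OF S] and D' = fp_stateD[OF S']
  let ?z = "\<lambda>t x. m t x - mbar t x" and ?zt = "\<lambda>t x. mt t x - mbart t x"
  let ?d = "\<lambda>t x. e t x + Q t x \<bullet> p t x + m t x * (norm (p t x))\<^sup>2 / 2"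
  let ?y = "\<lambda>t. torus_int (\<lambda>x. (?z t x)\<^sup>2)"
  define K where "K = V\<^sup>2 / \<nu>"
  define c where "c = 2 * B / \<nu>"
  have K: "0 \<le> K" and c: "0 \<le> c" using \<nu> B by (auto simp: K_def c_def)
  have d0: "0 \<le> ?d t x" if "t \<in> {0..T}" for t x by (rule D(9)[OF that])
  have cd: "cont_Q T ?d" unfolding divide_inverse by (intro cont_Q_intros D p)
  have cz: "cont_Q T ?z" by (intro cont_Q_intros D D')
  define Dt where "Dt t = torus_int (?d t)" for t
  have D0: "0 \<le> Dt t" if "t \<in> {0..T}" for t
    unfolding Dt_def using d0[OF that] by (intro torus_int_nonneg)
  have cD: "continuous_on {0..T} Dt" unfolding Dt_def by (rule continuous_torus_int[OF cd])
  have der: "(?y has_real_derivative torus_int (\<lambda>x. 2 * (?z t x * ?zt t x))) (at t within {0..T})"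
    if t: "t \<in> {0..T}" for t
  proof (rule torus_int_has_derivative[OF _ _ _ t])
    fix t x assume t: "t \<in> {0..T}"
    show "((\<lambda>s. (?z s x)\<^sup>2) has_real_derivative 2 * (?z t x * ?zt t x)) (at t within {0..T})"
      by (rule derivative_eq_intros D(2)[OF t] D'(2)[OF t] refl | simp)+
    show "continuous_on UNIV (\<lambda>x. (?z t x)\<^sup>2)" by (intro continuous_intros cont_Q_slice[OF cz t])
  next
    show "cont_Q T (\<lambda>t x. 2 * (?z t x * ?zt t x))" by (intro cont_Q_intros D D')
  qed
  have ineq: "torus_int (\<lambda>x. 2 * (?z t x * ?zt t x)) \<le> c * Dt t + K * ?y t" if t0: "t \<in> {0<..<T}" for t
  proof -
    have t: "t \<in> {0..T}" using t0 by simp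
    let ?gz = "grad (?z t)"
    have z: "C1_torus (?z t)" by (intro C1_torus_diff D(1) D'(1) t)
    have cq: "continuous_on UNIV (mt t)" "continuous_on UNIV (mbart t)" "continuous_on UNIV (Q t)"
      "continuous_on UNIV (p t)" "continuous_on UNIV (mbar t)" "continuous_on UNIV (m t)"
      by (intro cont_Q_slice[OF D(4) t] cont_Q_slice[OF D'(4) t] cont_Q_slice[OF D(5) t]
          cont_Q_slice[OF p(1) t] cont_Q_slice[OF D(3) t] cont_Q_slice[OF D'(3) t])+
    have "torus_int (\<lambda>x. ?z t x * (1 * mt t x + (-1) * mbart t x))
      = torus_int (\<lambda>x. ?gz x \<bullet> ((1 *\<^sub>R Q t x + (-1) *\<^sub>R (mbar t x *\<^sub>R (- p t x)))
          - \<nu> *\<^sub>R grad (\<lambda>x. 1 * m t x + (-1) * mbar t x) x))"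
      by (intro fp_weak_combine D(8)[OF t0 z] D'(8)[OF t0 z] z D(1) D'(1) t cq continuous_intros)
    then have w: "torus_int (\<lambda>x. ?z t x * ?zt t x)
        = torus_int (\<lambda>x. ?gz x \<bullet> ((Q t x + mbar t x *\<^sub>R p t x) - \<nu> *\<^sub>R ?gz x))" by simp
    have "torus_int (\<lambda>x. 2 * (?z t x * ?zt t x))
        = torus_int (\<lambda>x. 2 * (?gz x \<bullet> ((Q t x + mbar t x *\<^sub>R p t x) - \<nu> *\<^sub>R ?gz x)))"
      using w by simp
    also have "\<dots> \<le> torus_int (\<lambda>x. c * ?d t x + K * (?z t x)\<^sup>2)"
    proof (rule torus_int_mono)
      show "continuous_on UNIV (\<lambda>x. 2 * (?gz x \<bullet> ((Q t x + mbar t x *\<^sub>R p t x) - \<nu> *\<^sub>R ?gz x)))"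
        by (intro continuous_intros C1_torus_grad z cq)
      show "continuous_on UNIV (\<lambda>x. c * ?d t x + K * (?z t x)\<^sup>2)"
        by (intro continuous_on_add[of _ "\<lambda>x. c * ?d t x"] continuous_on_mult[of _ "\<lambda>x. c"] continuous_on_const
            cont_Q_slice[OF cd t] continuous_intros cont_Q_slice[OF cz t])
      fix x
      let ?q = "Q t x + m t x *\<^sub>R p t x"
      let ?w = "Q t x + mbar t x *\<^sub>R p t x"
      have q: "(norm ?q)\<^sup>2 \<le> 2 * B * ?d t x"
        by (rule admissible_imp_deviation_bound[OF D(9)[OF t] B(2)[OF t] B(1)])
      have w: "?w = ?q - ?z t x *\<^sub>R p t x" by (simp add: algebra_simps)
      have "norm ?w \<le> norm ?q + \<bar>?z t x\<bar> * V"
        using norm_triangle_ineq4[of ?q "?z t x *\<^sub>R p t x"] mult_left_mono[OF p(2)[OF t, of x] abs_ge_zero[of "?z t x"]]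
        unfolding w norm_scaleR by linarith
      then have "(norm ?w)\<^sup>2 \<le> (norm ?q + \<bar>?z t x\<bar> * V)\<^sup>2" by (rule power_mono) simp
      also have "\<dots> \<le> 2 * (norm ?q)\<^sup>2 + 2 * (\<bar>?z t x\<bar> * V)\<^sup>2"
        using sum_squares_bound[of "norm ?q" "\<bar>?z t x\<bar> * V"] by (simp add: power2_sum)
      also have "\<dots> \<le> 2 * (2 * B * ?d t x) + 2 * V\<^sup>2 * (?z t x)\<^sup>2"
        using q by (simp add: power_mult_distrib mult.commute)
      finally have w2: "(norm ?w)\<^sup>2 \<le> 2 * (2 * B * ?d t x) + 2 * V\<^sup>2 * (?z t x)\<^sup>2" .
      \<comment> \<open>Young's inequality; the diffusion absorbs the gradient of the difference.\<close>
      have "0 \<le> (norm (?w - (2 * \<nu>) *\<^sub>R ?gz x))\<^sup>2" by simp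
      also have "\<dots> = (norm ?w)\<^sup>2 - 2 * \<nu> * (2 * (?gz x \<bullet> (?w - \<nu> *\<^sub>R ?gz x)))"
        by (simp only: power2_norm_eq_inner) (simp add: inner_diff_left inner_diff_right inner_add_left inner_add_right inner_commute algebra_simps)
      finally have "2 * \<nu> * (2 * (?gz x \<bullet> (?w - \<nu> *\<^sub>R ?gz x))) \<le> 2 * (2 * B * ?d t x) + 2 * V\<^sup>2 * (?z t x)\<^sup>2"
        using w2 by simp
      then have "2 * (?gz x \<bullet> (?w - \<nu> *\<^sub>R ?gz x)) \<le> (2 * (2 * B * ?d t x) + 2 * V\<^sup>2 * (?z t x)\<^sup>2) / (2 * \<nu>)"
        using \<nu> by (simp add: pos_le_divide_eq mult.commute)
      also have "\<dots> = c * ?d t x + K * (?z t x)\<^sup>2" using \<nu> by (simp add: c_def K_def field_simps)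
      finally show "2 * (?gz x \<bullet> (?w - \<nu> *\<^sub>R ?gz x)) \<le> c * ?d t x + K * (?z t x)\<^sup>2" .
    qed
    also have "\<dots> = torus_int (\<lambda>x. c * ?d t x) + torus_int (\<lambda>x. K * (?z t x)\<^sup>2)"
      by (rule torus_int_add) (intro continuous_on_mult[of _ "\<lambda>x. c"] continuous_on_const
            cont_Q_slice[OF cd t] continuous_intros cont_Q_slice[OF cz t])+
    also have "\<dots> = c * Dt t + K * ?y t" by (simp add: Dt_def)
    finally show ?thesis .
  qed
  define Y where "Y t = ?y t * exp (- K * t) - c * integral {0..t} Dt" for t
  have dY: "(Y has_real_derivative (torus_int (\<lambda>x. 2 * (?z t x * ?zt t x)) - K * ?y t) * exp (- K * t) - c * Dt t) (at t within {0..T})"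
    if t: "t \<in> {0..T}" for t
    unfolding Y_def
    by (rule derivative_eq_intros der[OF t] integral_has_real_derivative[OF cD t] refl | simp add: algebra_simps)+
  have "Y t \<le> Y 0"
  proof (rule DERIV_nonpos_imp_decreasing_open[of 0 t Y])
    show "0 \<le> t" using t by simp
    show "continuous_on {0..t} Y"
      by (rule continuous_on_subset[OF DERIV_continuous_on[OF dY]]) (use t in auto)
    fix s assume "0 < s" "s < t"
    then have s: "s \<in> {0<..<T}" "s \<in> {0..T}" using t by auto
    have "(torus_int (\<lambda>x. 2 * (?z s x * ?zt s x)) - K * ?y s) * exp (- K * s) \<le> c * Dt s * exp (- K * s)"
      using ineq[OF s(1)] by (intro mult_right_mono) auto
    also have "\<dots> \<le> c * Dt s * 1" using c K s D0[OF s(2)] by (intro mult_left_mono) auto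
    finally show "\<exists>y. (Y has_real_derivative y) (at s) \<and> y \<le> 0"
      using has_derivative_interior[OF dY[OF s(2)] s(1)] by fastforce
  qed
  also have "Y 0 = 0" by (simp add: Y_def D(7) D'(7))
  finally have "?y t * exp (- K * t) \<le> c * integral {0..t} Dt" by (simp add: Y_def)
  then have "?y t \<le> c * integral {0..t} Dt * exp (K * t)"
    by (simp add: exp_minus field_simps)
  also have "\<dots> \<le> c * integral {0..T} Dt * exp (K * T)"
  proof (rule mult_mono)
    have "integral {0..t} Dt \<le> integral {0..T} Dt"
      using t D0 by (intro integral_subset_le integrable_continuous_real continuous_on_subset[OF cD]) auto
    then show "c * integral {0..t} Dt \<le> c * integral {0..T} Dt" by (rule mult_left_mono[OF _ c])
    show "0 \<le> c * integral {0..T} Dt"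
      using D0 c by (intro mult_nonneg_nonneg integral_nonneg integrable_continuous_real cD) auto
  qed (use t K in \<open>auto intro: mult_left_mono\<close>)
  finally show ?thesis by (simp add: c_def K_def Dt_def[abs_def] cyl_int_def mult_ac)
qed

section \<open>The coupling and its potential\<close>

text \<open>The segment between two points is replaced by a path parallel to the axes, because only partial
  derivatives are at hand; this costs a factor equal to the dimension.\<close>

lemma pd_bound_imp_lipschitz:
  fixes w :: "real ^ 'd::finite \<Rightarrow> real"
  assumes w: "\<And>l x. pd_exists l w x" and B: "\<And>l x. \<bar>pd l w x\<bar> \<le> B"
  shows "(real CARD('d) * B)-lipschitz_on UNIV w"
proof (rule lipschitz_onI)
  have B0: "0 \<le> B" using B[of undefined undefined] abs_ge_zero order_trans by blast
  then show "0 \<le> real CARD('d) * B" by simp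
  have one: "\<bar>w (x + c *\<^sub>R axis l 1) - w x\<bar> \<le> B * \<bar>c\<bar>" for x c l
    using field_differentiable_bound[of UNIV "\<lambda>h. w (x + h *\<^sub>R axis l 1)"
        "\<lambda>h. pd l w (x + h *\<^sub>R axis l 1)" B c 0] pd_along_line[OF w, of x l] B by simp
  have part: "\<bar>w (x + (\<Sum>l\<in>S. c l *\<^sub>R axis l 1)) - w x\<bar> \<le> (\<Sum>l\<in>S. B * \<bar>c l\<bar>)" if "finite S" for S x c
    using that
  proof (induction S)
    case (insert l S)
    have "x + (\<Sum>l\<in>insert l S. c l *\<^sub>R axis l 1) = (x + (\<Sum>l\<in>S. c l *\<^sub>R axis l 1)) + c l *\<^sub>R axis l 1"
      using insert by (simp add: algebra_simps)
    then have "\<bar>w (x + (\<Sum>l\<in>insert l S. c l *\<^sub>R axis l 1)) - w (x + (\<Sum>l\<in>S. c l *\<^sub>R axis l 1))\<bar> \<le> B * \<bar>c l\<bar>"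
      using one[of "x + (\<Sum>l\<in>S. c l *\<^sub>R axis l 1)" "c l" l] by (simp only:)
    then have "\<bar>w (x + (\<Sum>l\<in>insert l S. c l *\<^sub>R axis l 1)) - w x\<bar> \<le> B * \<bar>c l\<bar> + (\<Sum>l\<in>S. B * \<bar>c l\<bar>)"
      using insert.IH by linarith
    then show ?case using insert by simp
  qed simp
  fix x y :: "real ^ 'd"
  have "x = y + (\<Sum>l\<in>UNIV. (x $ l - y $ l) *\<^sub>R axis l 1)"
    by (simp add: vec_eq_iff axis_def if_distrib cong: if_cong)
  then have "\<bar>w x - w y\<bar> \<le> (\<Sum>l\<in>UNIV. B * \<bar>x $ l - y $ l\<bar>)" using part[of UNIV y "\<lambda>l. x $ l - y $ l"] by simp
  also have "\<dots> \<le> (\<Sum>l\<in>(UNIV :: 'd set). B * norm (x - y))"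
    using component_le_norm_cart[of "x - y"] B0 by (intro sum_mono mult_left_mono) auto
  finally show "dist (w x) (w y) \<le> real CARD('d) * B * dist x y" by (simp add: dist_norm mult_ac)
qed

lemma C12_torus_lipschitz:
  fixes u :: "real \<Rightarrow> real ^ 'd::finite \<Rightarrow> real"
  assumes "C12_torus T u ut"
  obtains R where "0 < R" "\<And>t. t \<in> {0..T} \<Longrightarrow> R-lipschitz_on UNIV (u t)"
proof -
  have "\<exists>B>0. \<forall>t\<in>{0..T}. \<forall>x. \<bar>pd l (u t) x\<bar> \<le> B" for l
    using periodic_bounded[of T "\<lambda>t. pd l (u t)"] C1_torusD(1)[OF C12_torusD(2)[OF assms]] C12_torusD(6)[OF assms, of l]
    unfolding cont_Q_def by metis
  then obtain B where B: "\<And>l. 0 < B l" "\<And>l t x. t \<in> {0..T} \<Longrightarrow> \<bar>pd l (u t) x\<bar> \<le> B l" by metis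
  define M where "M = (\<Sum>l\<in>UNIV. B l)"
  have "B l \<le> M" for l unfolding M_def by (intro member_le_sum) (auto simp: less_imp_le[OF B(1)])
  then have "\<bar>pd l (u t) x\<bar> \<le> M" if "t \<in> {0..T}" for l t x using B(2)[OF that] order_trans by blast
  then have "(real CARD('d) * M)-lipschitz_on UNIV (u t)" if "t \<in> {0..T}" for t
    using pd_bound_imp_lipschitz[of "u t" M] C1_torusD(2)[OF C12_torusD(1)[OF assms that]] that by blast
  moreover have "0 < M" unfolding M_def using B(1) by (intro sum_pos) auto
  ultimately show ?thesis using that[of "real CARD('d) * M"] by simp
qed

text \<open>Densities for which the coupling is jointly continuous: the assumption on the regularity of the
  coupling in space only concerns Lipschitz densities, with a constant that depends on theirs.\<close>

definition density_path :: "real \<Rightarrow> (real \<Rightarrow> real ^ 'd::finite \<Rightarrow> real) \<Rightarrow> bool" where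
  "density_path T m \<longleftrightarrow> cont_Q T m \<and> (\<forall>t\<in>{0..T}. m t \<in> D0) \<and> (\<exists>R>0. \<forall>t\<in>{0..T}. R-lipschitz_on UNIV (m t))"

lemma lipschitz_combine:
  fixes v w :: "real ^ 'd \<Rightarrow> real"
  assumes "R-lipschitz_on UNIV v" "S-lipschitz_on UNIV w"
  shows "(\<bar>a\<bar> * R + \<bar>b\<bar> * S)-lipschitz_on UNIV (\<lambda>x. a * v x + b * w x)"
proof (rule lipschitz_onI)
  show "0 \<le> \<bar>a\<bar> * R + \<bar>b\<bar> * S" using assms lipschitz_on_nonneg by (intro add_nonneg_nonneg mult_nonneg_nonneg) auto
  fix x y
  have "\<bar>a * (v x - v y) + b * (w x - w y)\<bar> \<le> \<bar>a\<bar> * \<bar>v x - v y\<bar> + \<bar>b\<bar> * \<bar>w x - w y\<bar>"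
    by (metis abs_mult abs_triangle_ineq)
  also have "\<dots> \<le> \<bar>a\<bar> * (R * dist x y) + \<bar>b\<bar> * (S * dist x y)"
    using lipschitz_onD[OF assms(1), of x y] lipschitz_onD[OF assms(2), of x y]
    by (intro add_mono mult_left_mono) (auto simp: dist_real_def)
  finally show "dist (a * v x + b * w x) (a * v y + b * w y) \<le> (\<bar>a\<bar> * R + \<bar>b\<bar> * S) * dist x y"
    by (simp add: dist_real_def algebra_simps)
qed

lemma D0_combine:
  assumes "m1 \<in> D0" "m2 \<in> D0" "0 \<le> a" "0 \<le> b"
  shows "(\<lambda>x. a * m1 x + b * m2 x) \<in> D0"
  using assms unfolding D0_def periodic_def by (auto intro!: continuous_intros)

lemma density_path_combine:
  assumes "density_path T m1" "density_path T m2" "0 \<le> a" "0 \<le> b"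
    and m: "\<And>t x. t \<in> {0..T} \<Longrightarrow> m t x = a * m1 t x + b * m2 t x"
  shows "density_path T m"
proof -
  obtain R1 R2 where R: "0 < R1" "\<And>t. t \<in> {0..T} \<Longrightarrow> R1-lipschitz_on UNIV (m1 t)"
    "0 < R2" "\<And>t. t \<in> {0..T} \<Longrightarrow> R2-lipschitz_on UNIV (m2 t)"
    using assms(1,2) unfolding density_path_def by auto
  have m': "m t = (\<lambda>x. a * m1 t x + b * m2 t x)" if "t \<in> {0..T}" for t using m[OF that] by (simp add: fun_eq_iff)
  have "(\<bar>a\<bar> * R1 + \<bar>b\<bar> * R2 + 1)-lipschitz_on UNIV (m t)" if "t \<in> {0..T}" for t
    unfolding m'[OF that] by (rule lipschitz_on_mono[OF lipschitz_combine[OF R(2)[OF that] R(4)[OF that]]]) auto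
  moreover have "0 < \<bar>a\<bar> * R1 + \<bar>b\<bar> * R2 + 1" using R(1,3) by (simp add: add_nonneg_pos)
  moreover have "cont_Q T m"
    by (rule cont_Q_cong[OF _ m]) (use assms(1,2) in \<open>auto simp: density_path_def intro!: cont_Q_intros\<close>)
  moreover have "m t \<in> D0" if "t \<in> {0..T}" for t
    unfolding m'[OF that] using assms that by (intro D0_combine) (auto simp: density_path_def)
  ultimately show ?thesis unfolding density_path_def by blast
qed

lemma C12_torus_density_path:
  assumes "C12_torus T m mt" "\<And>t x. t \<in> {0..T} \<Longrightarrow> 0 \<le> m t x"
  shows "density_path T m"
proof -
  obtain R where "0 < R" "\<And>t. t \<in> {0..T} \<Longrightarrow> R-lipschitz_on UNIV (m t)" by (rule C12_torus_lipschitz[OF assms(1)]) blast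
  then show ?thesis unfolding density_path_def D0_def
    using C12_torusD(4)[OF assms(1)] C1_torusD(1,3)[OF C12_torusD(1)[OF assms(1)]] assms(2) by auto
qed

lemma cont_Q_uniform:
  fixes u :: "real \<Rightarrow> real ^ 'd::finite \<Rightarrow> real"
  assumes "cont_Q T u" "\<And>t. t \<in> {0..T} \<Longrightarrow> periodic (u t)" "0 < \<eta>"
  obtains \<delta> where "0 < \<delta>" "\<And>s t x. s \<in> {0..T} \<Longrightarrow> t \<in> {0..T} \<Longrightarrow> \<bar>s - t\<bar> < \<delta> \<Longrightarrow> \<bar>u s x - u t x\<bar> < \<eta>"
proof -
  have "continuous_on ({0..T} \<times> cbox 0 1) (\<lambda>(t, x). u t x)"
    using assms(1) unfolding cont_Q_def by (rule continuous_on_subset) auto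
  then have "uniformly_continuous_on ({0..T} \<times> cbox (0 :: real ^ 'd) 1) (\<lambda>(t, x). u t x)"
    by (intro compact_uniformly_continuous compact_Times) auto
  then obtain \<delta> where \<delta>: "0 < \<delta>" "\<And>p q. p \<in> {0..T} \<times> cbox 0 1 \<Longrightarrow> q \<in> {0..T} \<times> cbox 0 1 \<Longrightarrow> dist q p < \<delta>
      \<Longrightarrow> dist (case q of (t, x) \<Rightarrow> u t x) (case p of (t, x) \<Rightarrow> u t x) < \<eta>"
    by (rule uniformly_continuous_onE[OF _ assms(3)]) blast
  show thesis
  proof (rule that[OF \<delta>(1)])
    fix s t x assume st: "s \<in> {0..T}" "t \<in> {0..T}" "\<bar>s - t\<bar> < \<delta>"
    obtain y where y: "y \<in> cbox 0 1" "\<And>w :: real ^ 'd \<Rightarrow> real. periodic w \<Longrightarrow> w x = w y"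
      using unit_cube_representative[of x] by blast
    show "\<bar>u s x - u t x\<bar> < \<eta>"
      using \<delta>(2)[of "(t, y)" "(s, y)"] st y(1) y(2)[OF assms(2)] by (simp add: dist_Pair_Pair dist_real_def)
  qed
qed

text \<open>The assumptions on the coupling with their constants and the potential made explicit.\<close>

locale potential_coupling =
  fixes T :: real and f :: "'d::finite coupling" and \<alpha>\<^sub>0 C0 C1 Lf :: real
    and F :: "real \<Rightarrow> (real ^ 'd \<Rightarrow> real) \<Rightarrow> real"
  assumes T: "0 < T" and \<alpha>: "0 < \<alpha>\<^sub>0" and Lf: "0 < Lf"
    and f_bound: "\<And>t x m. t \<in> {0..T} \<Longrightarrow> m \<in> D0 \<union> grid_densities \<Longrightarrow> 0 \<le> f t x m \<and> f t x m \<le> C0"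
    and f_time: "\<And>t s x m. t \<in> {0..T} \<Longrightarrow> s \<in> {0..T} \<Longrightarrow> m \<in> D0 \<union> grid_densities
      \<Longrightarrow> \<bar>f t x m - f s x m\<bar> \<le> C1 * \<bar>t - s\<bar> powr \<alpha>\<^sub>0"
    and f_density: "\<And>t x m1 m2. t \<in> {0..T} \<Longrightarrow> m1 \<in> D0 \<union> grid_densities \<Longrightarrow> m2 \<in> D0 \<union> grid_densities
      \<Longrightarrow> \<bar>f t x m2 - f t x m1\<bar> \<le> Lf * \<bar>m2 x - m1 x\<bar>"
    and f_space: "\<And>R. 0 < R \<Longrightarrow> \<exists>C. \<forall>t\<in>{0..T}. \<forall>m\<in>D0. R-lipschitz_on UNIV m \<longrightarrow> C-lipschitz_on UNIV (\<lambda>x. f t x m)"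
    and f_monotone: "f_M T f"
    and F_continuous: "\<And>t m \<epsilon>. t \<in> {0..T} \<Longrightarrow> m \<in> D0 \<Longrightarrow> 0 < \<epsilon> \<Longrightarrow> \<exists>\<eta>>0. \<forall>t'\<in>{0..T}. \<forall>m'\<in>D0.
        \<bar>t' - t\<bar> < \<eta> \<longrightarrow> (\<forall>x. \<bar>m' x - m x\<bar> < \<eta>) \<longrightarrow> \<bar>F t' m' - F t m\<bar> < \<epsilon>"
    and F_potential: "\<And>t m1 m2. t \<in> {0..T} \<Longrightarrow> m1 \<in> D0 \<Longrightarrow> m2 \<in> D0 \<Longrightarrow>
        F t m2 - F t m1 = integral {0..1} (\<lambda>s. integral (cbox 0 1) (\<lambda>x.
          f t x (\<lambda>y. s * m2 y + (1 - s) * m1 y) * (m2 x - m1 x)))"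
begin

lemma cont_Q_coupling:
  assumes "density_path T m"
  shows "cont_Q T (\<lambda>t x. f t x (m t))"
proof -
  obtain R where R: "0 < R" "\<And>t. t \<in> {0..T} \<Longrightarrow> R-lipschitz_on UNIV (m t)"
    and m: "cont_Q T m" "\<And>t. t \<in> {0..T} \<Longrightarrow> m t \<in> D0"
    using assms unfolding density_path_def by auto
  obtain C where C: "\<And>t. t \<in> {0..T} \<Longrightarrow> C-lipschitz_on UNIV (\<lambda>x. f t x (m t))"
    using f_space[OF R(1)] R(2) m(2) by blast
  show ?thesis
  proof (rule cont_Q_of_modulus)
    fix t0 x0 assume t0: "t0 \<in> {0..T}"
    define h where "h p = C1 * \<bar>fst p - t0\<bar> powr \<alpha>\<^sub>0
      + Lf * (\<bar>m (fst p) (snd p) - m t0 x0\<bar> + \<bar>m t0 (snd p) - m t0 x0\<bar>) + C * dist (snd p) x0" for p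
    have "continuous_on ({0..T} \<times> UNIV) (\<lambda>p. m t0 (snd p))"
      by (intro continuous_on_compose2[OF cont_Q_slice[OF m(1) t0, of UNIV]] continuous_intros) auto
    then have "continuous_on ({0..T} \<times> UNIV) h"
      unfolding h_def using m(1)[unfolded cont_Q_def split_beta] \<alpha>
      by (intro continuous_intros continuous_on_powr') auto
    moreover have "h (t0, x0) = 0" using \<alpha> by (simp add: h_def)
    moreover have "\<bar>f t x (m t) - f t0 x0 (m t0)\<bar> \<le> h (t, x)" if t: "t \<in> {0..T}" for t x
    proof -
      have "\<bar>f t x (m t) - f t0 x (m t)\<bar> \<le> C1 * \<bar>t - t0\<bar> powr \<alpha>\<^sub>0" using f_time t t0 m(2) by blast
      moreover have "\<bar>f t0 x (m t) - f t0 x (m t0)\<bar> \<le> Lf * \<bar>m t x - m t0 x\<bar>" using f_density t t0 m(2) by blast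
      moreover have "Lf * \<bar>m t x - m t0 x\<bar> \<le> Lf * (\<bar>m t x - m t0 x0\<bar> + \<bar>m t0 x - m t0 x0\<bar>)"
        using Lf by (intro mult_left_mono) auto
      moreover have "\<bar>f t0 x (m t0) - f t0 x0 (m t0)\<bar> \<le> C * dist x x0"
        using lipschitz_onD[OF C[OF t0], of x x0] by (simp add: dist_real_def)
      ultimately show ?thesis unfolding h_def fst_conv snd_conv by linarith
    qed
    ultimately show "\<exists>h. continuous_on ({0..T} \<times> UNIV) h \<and> h (t0, x0) = 0
        \<and> (\<forall>t\<in>{0..T}. \<forall>x. \<bar>f t x (m t) - f t0 x0 (m t0)\<bar> \<le> h (t, x))" by blast
  qed
qed

lemma coupling_continuous:
  assumes "t \<in> {0..T}" "m \<in> D0" "R-lipschitz_on UNIV m"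
  shows "continuous_on S (\<lambda>x. f t x m)"
proof -
  have "0 \<le> R" by (rule lipschitz_on_nonneg[OF assms(3)])
  then have "(R + 1)-lipschitz_on UNIV m" by (intro lipschitz_on_mono[OF assms(3)]) auto
  then obtain C where "C-lipschitz_on UNIV (\<lambda>x. f t x m)"
    using f_space[of "R + 1"] \<open>0 \<le> R\<close> assms by force
  then show ?thesis using lipschitz_on_continuous_on continuous_on_subset by blast
qed

text \<open>Monotonicity of the coupling makes its potential convex, the pointwise Lipschitz bound makes it
  smooth; both are read off along the segment from one density to the other.\<close>

lemma potential_bounds:
  assumes t: "t \<in> {0..T}" and m: "m1 \<in> D0" "m2 \<in> D0" "R1-lipschitz_on UNIV m1" "R2-lipschitz_on UNIV m2"
  shows "torus_int (\<lambda>x. f t x m1 * (m2 x - m1 x)) \<le> F t m2 - F t m1"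
    "F t m2 - F t m1 \<le> torus_int (\<lambda>x. f t x m1 * (m2 x - m1 x)) + Lf * torus_int (\<lambda>x. (m2 x - m1 x)\<^sup>2)"
proof -
  define ms where "ms s = (\<lambda>y. s * m2 y + (1 - s) * m1 y)" for s
  define G where "G s = torus_int (\<lambda>x. f t x (ms s) * (m2 x - m1 x))" for s
  define N where "N = torus_int (\<lambda>x. (m2 x - m1 x)\<^sup>2)"
  have cm: "continuous_on UNIV m1" "continuous_on UNIV m2" using m by (auto simp: D0_def)
  have ms: "ms s \<in> D0" if "s \<in> {0..1}" for s using that unfolding ms_def by (intro D0_combine m) auto
  have cf: "continuous_on UNIV (\<lambda>x. f t x (ms s))" if "s \<in> {0..1}" for s
    by (rule coupling_continuous[OF t ms[OF that]]) (unfold ms_def, rule lipschitz_combine[OF m(4,3)])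
  have N: "0 \<le> N" unfolding N_def by (rule torus_int_nonneg) simp
  have ms_diff: "ms s x - ms s' x = (s - s') * (m2 x - m1 x)" for s s' x by (simp add: ms_def algebra_simps)
  have lip: "G s - G s' \<le> Lf * \<bar>s - s'\<bar> * N" if "s \<in> {0..1}" "s' \<in> {0..1}" for s s'
  proof -
    have "G s - G s' = torus_int (\<lambda>x. f t x (ms s) * (m2 x - m1 x) - f t x (ms s') * (m2 x - m1 x))"
      unfolding G_def by (intro torus_int_diff[symmetric] continuous_intros cf that cm)
    also have "\<dots> \<le> torus_int (\<lambda>x. (Lf * \<bar>s - s'\<bar>) * (m2 x - m1 x)\<^sup>2)"
    proof (rule torus_int_mono)
      fix x
      have "\<bar>f t x (ms s) - f t x (ms s')\<bar> \<le> Lf * \<bar>ms s x - ms s' x\<bar>"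
        using f_density t ms that by blast
      then have "\<bar>f t x (ms s) - f t x (ms s')\<bar> \<le> Lf * (\<bar>s - s'\<bar> * \<bar>m2 x - m1 x\<bar>)"
        unfolding ms_diff abs_mult .
      then have "\<bar>f t x (ms s) - f t x (ms s')\<bar> * \<bar>m2 x - m1 x\<bar> \<le> Lf * (\<bar>s - s'\<bar> * \<bar>m2 x - m1 x\<bar>) * \<bar>m2 x - m1 x\<bar>"
        by (rule mult_right_mono) simp
      also have "\<dots> = Lf * \<bar>s - s'\<bar> * (m2 x - m1 x)\<^sup>2" by (simp add: power2_eq_square mult.assoc)
      finally have "\<bar>(f t x (ms s) - f t x (ms s')) * (m2 x - m1 x)\<bar> \<le> Lf * \<bar>s - s'\<bar> * (m2 x - m1 x)\<^sup>2"
        by (simp add: abs_mult)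
      then show "f t x (ms s) * (m2 x - m1 x) - f t x (ms s') * (m2 x - m1 x) \<le> Lf * \<bar>s - s'\<bar> * (m2 x - m1 x)\<^sup>2"
        by (simp add: algebra_simps)
    qed (intro continuous_intros cf that cm)+
    finally show ?thesis by (simp add: N_def)
  qed
  have ms0: "ms 0 = m1" by (simp add: ms_def)
  have low: "G 0 \<le> G s" if s: "s \<in> {0..1}" for s
  proof (cases "s = 0")
    case False
    have "0 \<le> integral (cbox 0 1) (\<lambda>x. (f t x (ms s) - f t x m1) * (ms s x - m1 x))"
      using f_monotone t ms[OF s] m(1) unfolding f_M_def by blast
    also have "\<dots> = torus_int (\<lambda>x. s * (f t x (ms s) * (m2 x - m1 x) - f t x (ms 0) * (m2 x - m1 x)))"
    proof (rule arg_cong[where f = torus_int], rule ext)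
      fix x
      have "ms s x - m1 x = s * (m2 x - m1 x)" using ms_diff[of s x 0] by (simp add: ms0)
      then show "(f t x (ms s) - f t x m1) * (ms s x - m1 x) = s * (f t x (ms s) * (m2 x - m1 x) - f t x (ms 0) * (m2 x - m1 x))"
        by (simp only: ms0) (simp add: algebra_simps)
    qed
    also have "\<dots> = s * (G s - G 0)"
      unfolding G_def by (subst torus_int_diff[symmetric]) (intro continuous_intros cf s cm | simp)+
    finally show ?thesis using s False by (simp add: zero_le_mult_iff)
  qed simp
  have cG: "continuous_on {0..1} G"
  proof (rule lipschitz_on_continuous_on, rule lipschitz_onI)
    show "0 \<le> Lf * N" using Lf N by simp
    fix s s' :: real assume "s \<in> {0..1}" "s' \<in> {0..1}"
    then show "dist (G s) (G s') \<le> Lf * N * dist s s'"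
      using lip[of s s'] lip[of s' s] by (simp add: dist_real_def abs_if mult_ac split: if_splits)
  qed
  have F: "F t m2 - F t m1 = integral {0..1} G"
    unfolding F_potential[OF t m(1,2)] G_def ms_def ..
  have "integral {0..1 :: real} (\<lambda>s. G 0) \<le> integral {0..1} G"
  proof (rule integral_le)
    show "G integrable_on {0..1}" by (intro integrable_continuous_real cG)
  qed (use low in auto)
  then show "torus_int (\<lambda>x. f t x m1 * (m2 x - m1 x)) \<le> F t m2 - F t m1"
    by (simp add: F G_def ms0)
  have "integral {0..1} G \<le> integral {0..1 :: real} (\<lambda>s. G 0 + Lf * N)"
  proof (intro integral_le integrable_continuous_real cG)
    fix s :: real assume s: "s \<in> {0..1}"
    have "Lf * s * N \<le> Lf * 1 * N" using s Lf N by (intro mult_right_mono mult_left_mono) auto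
    then show "G s \<le> G 0 + Lf * N" using lip[OF s, of 0] s by simp
  qed auto
  then show "F t m2 - F t m1 \<le> torus_int (\<lambda>x. f t x m1 * (m2 x - m1 x)) + Lf * torus_int (\<lambda>x. (m2 x - m1 x)\<^sup>2)"
    by (simp add: F G_def ms0 N_def)
qed

lemma continuous_potential:
  assumes "density_path T m"
  shows "continuous_on {0..T} (\<lambda>t. F t (m t))"
  unfolding continuous_on_iff
proof (intro ballI allI impI)
  fix t and \<epsilon> :: real assume t: "t \<in> {0..T}" and \<epsilon>: "0 < \<epsilon>"
  have m: "cont_Q T m" "\<And>t. t \<in> {0..T} \<Longrightarrow> m t \<in> D0" using assms by (auto simp: density_path_def)
  obtain \<eta> where \<eta>: "0 < \<eta>" "\<And>t' m'. t' \<in> {0..T} \<Longrightarrow> m' \<in> D0 \<Longrightarrow> \<bar>t' - t\<bar> < \<eta> \<Longrightarrow> (\<forall>x. \<bar>m' x - m t x\<bar> < \<eta>)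
      \<Longrightarrow> \<bar>F t' m' - F t (m t)\<bar> < \<epsilon>"
    using F_continuous[OF t m(2)[OF t] \<epsilon>] by blast
  obtain \<delta> where \<delta>: "0 < \<delta>" "\<And>s x. s \<in> {0..T} \<Longrightarrow> \<bar>s - t\<bar> < \<delta> \<Longrightarrow> \<bar>m s x - m t x\<bar> < \<eta>"
    using cont_Q_uniform[OF m(1) _ \<eta>(1)] m(2) t unfolding D0_def by (metis (no_types, lifting) mem_Collect_eq)
  show "\<exists>d>0. \<forall>t'\<in>{0..T}. dist t' t < d \<longrightarrow> dist (F t' (m t')) (F t (m t)) < \<epsilon>"
    using \<delta> \<eta> m(2) by (intro exI[of _ "min \<delta> \<eta>"]) (auto simp: dist_real_def)
qed

lemma potential_cylinder_bounds:
  assumes m: "density_path T m1" "density_path T m2"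
  shows "cyl_int T (\<lambda>t x. f t x (m1 t) * (m2 t x - m1 t x))
      \<le> integral {0..T} (\<lambda>t. F t (m2 t)) - integral {0..T} (\<lambda>t. F t (m1 t))"
    "integral {0..T} (\<lambda>t. F t (m2 t)) - integral {0..T} (\<lambda>t. F t (m1 t))
      \<le> cyl_int T (\<lambda>t x. f t x (m1 t) * (m2 t x - m1 t x)) + Lf * cyl_int T (\<lambda>t x. (m2 t x - m1 t x)\<^sup>2)"
proof -
  obtain R1 R2 where R: "\<And>t. t \<in> {0..T} \<Longrightarrow> R1-lipschitz_on UNIV (m1 t)" "\<And>t. t \<in> {0..T} \<Longrightarrow> R2-lipschitz_on UNIV (m2 t)"
    and c: "cont_Q T m1" "cont_Q T m2" and D: "\<And>t. t \<in> {0..T} \<Longrightarrow> m1 t \<in> D0" "\<And>t. t \<in> {0..T} \<Longrightarrow> m2 t \<in> D0"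
    using m unfolding density_path_def by blast
  note P = potential_bounds[OF _ D R]
  have c1: "cont_Q T (\<lambda>t x. f t x (m1 t) * (m2 t x - m1 t x))" by (intro cont_Q_intros cont_Q_coupling m c)
  have c2: "cont_Q T (\<lambda>t x. (m2 t x - m1 t x)\<^sup>2)" by (intro cont_Q_intros c)
  have d: "integral {0..T} (\<lambda>t. F t (m2 t) - F t (m1 t)) = integral {0..T} (\<lambda>t. F t (m2 t)) - integral {0..T} (\<lambda>t. F t (m1 t))"
    by (intro integral_diff integrable_continuous_real continuous_potential m)
  have "cyl_int T (\<lambda>t x. f t x (m1 t) * (m2 t x - m1 t x)) \<le> integral {0..T} (\<lambda>t. F t (m2 t) - F t (m1 t))"
    unfolding cyl_int_def
    by (intro integral_le integrable_continuous_real continuous_torus_int c1 continuous_on_diff continuous_potential m P(1))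
  then show "cyl_int T (\<lambda>t x. f t x (m1 t) * (m2 t x - m1 t x))
      \<le> integral {0..T} (\<lambda>t. F t (m2 t)) - integral {0..T} (\<lambda>t. F t (m1 t))" by (simp add: d)
  have "integral {0..T} (\<lambda>t. F t (m2 t) - F t (m1 t))
      \<le> integral {0..T} (\<lambda>t. torus_int (\<lambda>x. f t x (m1 t) * (m2 t x - m1 t x)) + Lf * torus_int (\<lambda>x. (m2 t x - m1 t x)\<^sup>2))"
    by (intro integral_le integrable_continuous_real continuous_on_add continuous_on_mult continuous_on_const
        continuous_torus_int c1 c2 continuous_on_diff continuous_potential m P(2))
  also have "\<dots> = cyl_int T (\<lambda>t x. f t x (m1 t) * (m2 t x - m1 t x)) + integral {0..T} (\<lambda>t. Lf * torus_int (\<lambda>x. (m2 t x - m1 t x)\<^sup>2))"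
    unfolding cyl_int_def
    by (intro integral_add integrable_continuous_real continuous_on_mult continuous_on_const continuous_torus_int c1 c2)
  finally show "integral {0..T} (\<lambda>t. F t (m2 t)) - integral {0..T} (\<lambda>t. F t (m1 t))
      \<le> cyl_int T (\<lambda>t x. f t x (m1 t) * (m2 t x - m1 t x)) + Lf * cyl_int T (\<lambda>t x. (m2 t x - m1 t x)\<^sup>2)"
    by (simp add: d cyl_int_def)
qed

section \<open>Descent of the energy\<close>

definition energy :: "(real ^ 'd \<Rightarrow> real) \<Rightarrow> (real \<Rightarrow> real ^ 'd \<Rightarrow> real) \<Rightarrow> (real \<Rightarrow> real ^ 'd \<Rightarrow> real) \<Rightarrow> real" where
  "energy g m e = cyl_int T e + integral {0..T} (\<lambda>t. F t (m t)) + torus_int (\<lambda>x. g x * m T x)"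

definition linear_cost :: "(real \<Rightarrow> real ^ 'd \<Rightarrow> real) \<Rightarrow> (real ^ 'd \<Rightarrow> real) \<Rightarrow> (real \<Rightarrow> real ^ 'd \<Rightarrow> real) \<Rightarrow> (real \<Rightarrow> real ^ 'd \<Rightarrow> real) \<Rightarrow> real" where
  "linear_cost \<gamma> g m e = cyl_int T (\<lambda>t x. e t x + \<gamma> t x * m t x) + torus_int (\<lambda>x. g x * m T x)"

text \<open>The energy lies above its linearisation, because the potential is convex.\<close>

lemma linear_cost_le_energy:
  assumes "density_path T m1" "density_path T m2" "cont_Q T e1" "cont_Q T e2"
  shows "linear_cost (\<lambda>t x. f t x (m1 t)) g m2 e2 - linear_cost (\<lambda>t x. f t x (m1 t)) g m1 e1
    \<le> energy g m2 e2 - energy g m1 e1"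
proof -
  have c: "cont_Q T m1" "cont_Q T m2" "cont_Q T (\<lambda>t x. f t x (m1 t))"
    using assms cont_Q_coupling by (auto simp: density_path_def)
  have "cyl_int T (\<lambda>t x. f t x (m1 t) * (m2 t x - m1 t x))
      = cyl_int T (\<lambda>t x. f t x (m1 t) * m2 t x) - cyl_int T (\<lambda>t x. f t x (m1 t) * m1 t x)"
    unfolding right_diff_distrib by (intro cyl_int_diff cont_Q_intros c)
  moreover have "cyl_int T (\<lambda>t x. e2 t x + f t x (m1 t) * m2 t x) = cyl_int T e2 + cyl_int T (\<lambda>t x. f t x (m1 t) * m2 t x)"
    by (intro cyl_int_add cont_Q_intros c assms)
  moreover have "cyl_int T (\<lambda>t x. e1 t x + f t x (m1 t) * m1 t x) = cyl_int T e1 + cyl_int T (\<lambda>t x. f t x (m1 t) * m1 t x)"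
    by (intro cyl_int_add cont_Q_intros c assms)
  ultimately show ?thesis using potential_cylinder_bounds(1)[OF assms(1,2)]
    unfolding linear_cost_def energy_def by simp
qed

text \<open>The linearised cost of a state is a constant that does not depend on the state plus a nonnegative
  term, which is zero for the best response.\<close>

lemma linear_cost_duality:
  assumes \<nu>: "0 < \<nu>" and S: "fp_state T \<nu> m0 m mt Q e"
    and \<phi>: "backward_solution T \<nu> \<gamma> \<phi> \<phi>t" "\<And>t x. t \<in> {0..T} \<Longrightarrow> 0 < \<phi> t x" "\<And>x. \<phi> T x = exp (- g x / (2 * \<nu>))"
    and \<gamma>: "cont_Q T \<gamma>"
  shows "linear_cost \<gamma> g m e = torus_int (\<lambda>x. - 2 * \<nu> * ln (\<phi> 0 x) * m0 x)
    + cyl_int T (\<lambda>t x. e t x + Q t x \<bullet> hc_drift \<nu> \<phi> t x + m t x * (norm (hc_drift \<nu> \<phi> t x))\<^sup>2 / 2)"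
  using fp_duality[OF T \<nu> S \<phi>(1,2) \<gamma>] \<nu> unfolding linear_cost_def by (simp add: \<phi>(3))

lemma cyl_int_nonneg: "(\<And>t x. t \<in> {0..T} \<Longrightarrow> 0 \<le> g t x) \<Longrightarrow> 0 \<le> cyl_int T g"
  unfolding cyl_int_def
  by (cases "(\<lambda>t. torus_int (g t)) integrable_on {0..T}")
    (auto simp: not_integrable_integral intro!: Henstock_Kurzweil_Integration.integral_nonneg torus_int_nonneg)

text \<open>One conditional gradient step: by convexity the linearised gain is at least the current gap, and the
  second order error is quadratic in the step size.\<close>

lemma energy_descent:
  assumes \<nu>: "0 < \<nu>" and dp: "density_path T m" "density_path T m1" "density_path T mbar"
    and S: "cont_Q T e" "fp_state T \<nu> m0 m1 m1t Q1 e1" "fp_state T \<nu> m0 mbar mbart Qbar ebar"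
    and \<phi>: "backward_solution T \<nu> (\<lambda>t x. f t x (m t)) \<phi> \<phi>t" "\<And>t x. t \<in> {0..T} \<Longrightarrow> 0 < \<phi> t x" "\<And>x. \<phi> T x = exp (- g x / (2 * \<nu>))"
    and opt: "\<And>t x. t \<in> {0..T} \<Longrightarrow> e1 t x + Q1 t x \<bullet> hc_drift \<nu> \<phi> t x + m1 t x * (norm (hc_drift \<nu> \<phi> t x))\<^sup>2 / 2 = 0"
    and \<theta>: "0 \<le> \<theta>" "\<theta> \<le> 1" and g: "continuous_on UNIV g"
    and m': "\<And>t x. t \<in> {0..T} \<Longrightarrow> m' t x = (1 - \<theta>) * m t x + \<theta> * m1 t x"
    and K: "\<And>t x. t \<in> {0..T} \<Longrightarrow> \<bar>m1 t x - m t x\<bar> \<le> K"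
  shows "energy g m' (\<lambda>t x. (1 - \<theta>) * e t x + \<theta> * e1 t x) - energy g mbar ebar
    \<le> (1 - \<theta>) * (energy g m e - energy g mbar ebar) + Lf * T * K\<^sup>2 * \<theta>\<^sup>2"
proof -
  let ?\<gamma> = "\<lambda>t x. f t x (m t)" and ?e' = "\<lambda>t x. (1 - \<theta>) * e t x + \<theta> * e1 t x"
  have c: "cont_Q T m" "cont_Q T m1" "cont_Q T ?\<gamma>" "cont_Q T e1"
    using dp cont_Q_coupling fp_stateD(6)[OF S(2)] by (auto simp: density_path_def)
  have dp': "density_path T m'" by (rule density_path_combine[OF dp(1,2) _ _ m']) (use \<theta> in auto)
  have T0: "T \<in> {0..T}" using T by simp
  have md: "m' t x - m t x = \<theta> * (m1 t x - m t x)" if "t \<in> {0..T}" for t x using m'[OF that] by (simp add: algebra_simps)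
  \<comment> \<open>The best response minimises the linearised cost among all states.\<close>
  have "linear_cost ?\<gamma> g m1 e1 \<le> linear_cost ?\<gamma> g mbar ebar"
  proof -
    have "cyl_int T (\<lambda>t x. e1 t x + Q1 t x \<bullet> hc_drift \<nu> \<phi> t x + m1 t x * (norm (hc_drift \<nu> \<phi> t x))\<^sup>2 / 2) = cyl_int T (\<lambda>t (x :: real ^ 'd). 0)"
      by (rule cyl_int_cong) (rule opt)
    also have "\<dots> = 0" by (simp add: cyl_int_def)
    also have "\<dots> \<le> cyl_int T (\<lambda>t x. ebar t x + Qbar t x \<bullet> hc_drift \<nu> \<phi> t x + mbar t x * (norm (hc_drift \<nu> \<phi> t x))\<^sup>2 / 2)"
      by (rule cyl_int_nonneg) (rule fp_stateD(9)[OF S(3)])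
    finally show ?thesis
      using linear_cost_duality[OF \<nu> S(2) \<phi> c(3)] linear_cost_duality[OF \<nu> S(3) \<phi> c(3)] by simp
  qed
  then have A: "linear_cost ?\<gamma> g m1 e1 - linear_cost ?\<gamma> g m e \<le> energy g mbar ebar - energy g m e"
    using linear_cost_le_energy[OF dp(1,3) S(1) fp_stateD(6)[OF S(3)], of g] by simp
  have e': "cyl_int T ?e' - cyl_int T e = \<theta> * (cyl_int T e1 - cyl_int T e)"
  proof -
    have "cyl_int T ?e' = cyl_int T (\<lambda>t x. (1 - \<theta>) * e t x) + cyl_int T (\<lambda>t x. \<theta> * e1 t x)"
      by (intro cyl_int_add cont_Q_intros S c)
    then show ?thesis unfolding cyl_int_cmult by (simp add: algebra_simps)
  qed
  have \<gamma>: "cyl_int T (\<lambda>t x. ?\<gamma> t x * (m' t x - m t x))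
      = \<theta> * (cyl_int T (\<lambda>t x. ?\<gamma> t x * m1 t x) - cyl_int T (\<lambda>t x. ?\<gamma> t x * m t x))"
  proof -
    have "cyl_int T (\<lambda>t x. ?\<gamma> t x * (m' t x - m t x)) = cyl_int T (\<lambda>t x. \<theta> * (?\<gamma> t x * m1 t x - ?\<gamma> t x * m t x))"
      by (rule cyl_int_cong) (simp add: md algebra_simps)
    also have "\<dots> = \<theta> * cyl_int T (\<lambda>t x. ?\<gamma> t x * m1 t x - ?\<gamma> t x * m t x)" by (rule cyl_int_cmult)
    also have "cyl_int T (\<lambda>t x. ?\<gamma> t x * m1 t x - ?\<gamma> t x * m t x) = cyl_int T (\<lambda>t x. ?\<gamma> t x * m1 t x) - cyl_int T (\<lambda>t x. ?\<gamma> t x * m t x)"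
      by (intro cyl_int_diff cont_Q_intros c)
    finally show ?thesis .
  qed
  have sq: "cyl_int T (\<lambda>t x. (m' t x - m t x)\<^sup>2) \<le> T * (\<theta>\<^sup>2 * K\<^sup>2)"
  proof -
    have "cyl_int T (\<lambda>t x. (m' t x - m t x)\<^sup>2) \<le> cyl_int T (\<lambda>t (x :: real ^ 'd). \<theta>\<^sup>2 * K\<^sup>2)"
    proof (rule cyl_int_mono)
      show "cont_Q T (\<lambda>t x. (m' t x - m t x)\<^sup>2)" using dp' c by (intro cont_Q_intros) (auto simp: density_path_def)
      fix t x assume t: "t \<in> {0..T}"
      have "(m1 t x - m t x)\<^sup>2 \<le> K\<^sup>2" using K[OF t, of x] by (metis abs_ge_zero power2_abs power_mono)
      then show "(m' t x - m t x)\<^sup>2 \<le> \<theta>\<^sup>2 * K\<^sup>2" by (simp add: md[OF t] power_mult_distrib mult_left_mono)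
    qed (rule cont_Q_const)
    then show ?thesis using T by (simp add: cyl_int_const)
  qed
  have gT: "torus_int (\<lambda>x. g x * m' T x) - torus_int (\<lambda>x. g x * m T x)
      = \<theta> * (torus_int (\<lambda>x. g x * m1 T x) - torus_int (\<lambda>x. g x * m T x))"
  proof -
    have "torus_int (\<lambda>x. g x * m' T x) = torus_int (\<lambda>x. (1 - \<theta>) * (g x * m T x) + \<theta> * (g x * m1 T x))"
      by (simp only: m'[OF T0]) (simp add: algebra_simps)
    also have "\<dots> = torus_int (\<lambda>x. (1 - \<theta>) * (g x * m T x)) + torus_int (\<lambda>x. \<theta> * (g x * m1 T x))"
      by (intro torus_int_add continuous_on_mult continuous_on_const g cont_Q_slice[OF c(1) T0] cont_Q_slice[OF c(2) T0])
    also have "\<dots> = (1 - \<theta>) * torus_int (\<lambda>x. g x * m T x) + \<theta> * torus_int (\<lambda>x. g x * m1 T x)"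
      by (simp only: integral_mult_right)
    finally show ?thesis by (simp add: algebra_simps)
  qed
  have lc: "linear_cost ?\<gamma> g m1 e1 = cyl_int T e1 + cyl_int T (\<lambda>t x. ?\<gamma> t x * m1 t x) + torus_int (\<lambda>x. g x * m1 T x)"
    "linear_cost ?\<gamma> g m e = cyl_int T e + cyl_int T (\<lambda>t x. ?\<gamma> t x * m t x) + torus_int (\<lambda>x. g x * m T x)"
    unfolding linear_cost_def by (subst cyl_int_add; (intro cont_Q_intros c S)?; simp)+
  have "energy g m' ?e' - energy g m e \<le> \<theta> * (linear_cost ?\<gamma> g m1 e1 - linear_cost ?\<gamma> g m e) + Lf * (T * (\<theta>\<^sup>2 * K\<^sup>2))"
  proof -
    have "Lf * cyl_int T (\<lambda>t x. (m' t x - m t x)\<^sup>2) \<le> Lf * (T * (\<theta>\<^sup>2 * K\<^sup>2))" using sq Lf by (intro mult_left_mono) auto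
    then have "energy g m' ?e' - energy g m e \<le> (cyl_int T ?e' - cyl_int T e) + cyl_int T (\<lambda>t x. ?\<gamma> t x * (m' t x - m t x))
        + Lf * (T * (\<theta>\<^sup>2 * K\<^sup>2)) + (torus_int (\<lambda>x. g x * m' T x) - torus_int (\<lambda>x. g x * m T x))"
      using potential_cylinder_bounds(2)[OF dp(1) dp'] unfolding energy_def by simp
    then show ?thesis unfolding e' \<gamma> gT lc by (simp add: algebra_simps)
  qed
  also have "\<dots> \<le> \<theta> * (energy g mbar ebar - energy g m e) + Lf * (T * (\<theta>\<^sup>2 * K\<^sup>2))"
    using A \<theta> by (intro add_right_mono mult_left_mono) auto
  finally show ?thesis by (simp add: algebra_simps)
qed

text \<open>At the solution of the system the duality is used a second time: the gap dominates the duality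
  integrand of an arbitrary state.\<close>

lemma energy_gap_lower_bound:
  assumes \<nu>: "0 < \<nu>" and dp: "density_path T m" "density_path T mbar"
    and S: "fp_state T \<nu> m0 m mt Q e" "fp_state T \<nu> m0 mbar mbart Qbar ebar"
    and \<phi>: "backward_solution T \<nu> (\<lambda>t x. f t x (mbar t)) \<phi> \<phi>t" "\<And>t x. t \<in> {0..T} \<Longrightarrow> 0 < \<phi> t x" "\<And>x. \<phi> T x = exp (- g x / (2 * \<nu>))"
    and opt: "\<And>t x. t \<in> {0..T} \<Longrightarrow> ebar t x + Qbar t x \<bullet> hc_drift \<nu> \<phi> t x + mbar t x * (norm (hc_drift \<nu> \<phi> t x))\<^sup>2 / 2 = 0"
  shows "cyl_int T (\<lambda>t x. e t x + Q t x \<bullet> hc_drift \<nu> \<phi> t x + m t x * (norm (hc_drift \<nu> \<phi> t x))\<^sup>2 / 2)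
    \<le> energy g m e - energy g mbar ebar"
proof -
  have "cyl_int T (\<lambda>t x. ebar t x + Qbar t x \<bullet> hc_drift \<nu> \<phi> t x + mbar t x * (norm (hc_drift \<nu> \<phi> t x))\<^sup>2 / 2) = cyl_int T (\<lambda>t (x :: real ^ 'd). 0)"
    by (rule cyl_int_cong) (rule opt)
  also have "\<dots> = 0" by (simp add: cyl_int_def)
  finally show ?thesis
    using linear_cost_le_energy[OF dp(2,1) fp_stateD(6)[OF S(2)] fp_stateD(6)[OF S(1)], of g]
      linear_cost_duality[OF \<nu> S(1) \<phi> cont_Q_coupling[OF dp(2)]] linear_cost_duality[OF \<nu> S(2) \<phi> cont_Q_coupling[OF dp(2)]]
    by simp
qed

end

text \<open>For $k_2 = 1$ the recursion only yields $\log k / k$; the smaller exponent $1/2$ makes the induction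
  close for every admissible step size without a case distinction, since
  $(1 - 1/x) x^{-1/2} + x^{-3/2}/2 \le (x+1)^{-1/2}$.\<close>

lemma step_size_recursion:
  fixes \<epsilon> :: "nat \<Rightarrow> real"
  assumes k: "1 \<le> k2" "k2 \<le> k1" and C: "0 \<le> C" and nn: "\<And>k. 0 \<le> \<epsilon> k"
    and rec: "\<And>k. \<epsilon> (Suc k) \<le> (1 - k2 / (real k + k1)) * \<epsilon> k + C * (k2 / (real k + k1))\<^sup>2"
  obtains B where "0 < B" "\<And>k. \<epsilon> k \<le> B / sqrt (real k + k1)"
proof
  define B where "B = max 1 (max (\<epsilon> 0 * sqrt k1) (2 * C * k2\<^sup>2))"
  show "0 < B" by (simp add: B_def)
  show "\<epsilon> k \<le> B / sqrt (real k + k1)" for k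
  proof (induction k)
    case 0
    have "\<epsilon> 0 * sqrt k1 \<le> B" by (simp add: B_def)
    then show ?case using k by (simp add: pos_le_divide_eq)
  next
    case (Suc k)
    define x where "x = real k + k1"
    have x: "1 \<le> x" using k by (simp add: x_def)
    have "(1 - k2 / x) * \<epsilon> k \<le> (1 - 1 / x) * \<epsilon> k"
      using x k nn by (intro mult_right_mono) (auto simp: divide_right_mono)
    also have "\<dots> \<le> (1 - 1 / x) * (B / sqrt x)" using Suc x by (intro mult_left_mono) (auto simp: x_def)
    finally have 1: "(1 - k2 / x) * \<epsilon> k \<le> (1 - 1 / x) * (B / sqrt x)" .
    have "C * (k2 / x)\<^sup>2 = (2 * C * k2\<^sup>2) * (1 / (2 * x * x))" using x by (simp add: field_simps power2_eq_square)
    also have "\<dots> \<le> B * (1 / (2 * x * x))" using x by (intro mult_right_mono) (auto simp: B_def)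
    also have "\<dots> \<le> B * (1 / (2 * x * sqrt x))"
    proof (rule mult_left_mono)
      have "sqrt x \<le> x" using x by (simp add: real_le_lsqrt power2_eq_square sqrt_le_D real_sqrt_le_iff'
            order_trans[OF real_sqrt_le_mono[of x "x * x"]] mult_le_cancel_left1)
      then show "1 / (2 * x * x) \<le> 1 / (2 * x * sqrt x)" using x by (intro divide_left_mono mult_left_mono) auto
    qed (simp add: B_def)
    finally have 2: "C * (k2 / x)\<^sup>2 \<le> B / sqrt x * (1 / (2 * x))" by (simp add: mult_ac)
    have "1 - 1 / (2 * x) \<le> sqrt (x / (x + 1))"
    proof (rule real_le_rsqrt)
      have "(1 - 1 / (2 * x))\<^sup>2 = 1 - 1 / x + 1 / (4 * x * x)" using x by (simp add: power2_eq_square field_simps)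
      also have "\<dots> \<le> x / (x + 1)" using x by (simp add: field_simps power2_eq_square) 
      finally show "(1 - 1 / (2 * x))\<^sup>2 \<le> x / (x + 1)" .
    qed
    then have 3: "(1 - 1 / (2 * x)) * (1 / sqrt x) \<le> 1 / sqrt (x + 1)"
      using x by (simp add: real_sqrt_divide field_simps)
    have "\<epsilon> (Suc k) \<le> (1 - k2 / x) * \<epsilon> k + C * (k2 / x)\<^sup>2" using rec[of k] by (simp add: x_def)
    also have "\<dots> \<le> (1 - 1 / x) * (B / sqrt x) + B / sqrt x * (1 / (2 * x))" using 1 2 by linarith
    also have "\<dots> = B * ((1 - 1 / (2 * x)) * (1 / sqrt x))" by (simp add: algebra_simps)
    also have "\<dots> \<le> B * (1 / sqrt (x + 1))" by (rule mult_left_mono[OF 3]) (simp add: B_def)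
    finally show ?case by (simp add: x_def add_ac)
  qed
qed

section \<open>From the mean square to the maximum\<close>

text \<open>A Lipschitz function that is large at a point is at least half as large on a cube whose side is
  proportional to the value. The Lipschitz constant is enlarged by the bound of the function so that
  this cube has side at most one half.\<close>

lemma lipschitz_max_le_mean_square:
  fixes w :: "real ^ 'd::finite \<Rightarrow> real"
  assumes lip: "R-lipschitz_on UNIV w" and R: "0 < R" and A: "\<And>x. \<bar>w x\<bar> \<le> A"
    and x: "x \<in> cbox 0 1"
  shows "\<bar>w x\<bar> ^ (CARD('d) + 2) \<le> 4 * (2 * (R + A) * real CARD('d)) ^ CARD('d) * torus_int (\<lambda>x. (w x)\<^sup>2)"
proof (cases "w x = 0")
  case True
  have "0 \<le> A" using A[of x] by simp
  then show ?thesis using True R by (simp add: torus_int_nonneg)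
next
  case False
  define d where "d = real CARD('d)"
  define a where "a = \<bar>w x\<bar>"
  define L where "L = R + A"
  define \<rho> where "\<rho> = a / (2 * L * d)"
  have d: "1 \<le> d" by (simp add: d_def Suc_le_eq)
  have a: "0 < a" "a \<le> A" using False A by (auto simp: a_def)
  have L: "0 < L" "a \<le> L" using a R by (auto simp: L_def)
  have "a * 1 \<le> L * d" using a d L by (intro mult_mono) auto
  then have \<rho>: "0 < \<rho>" "\<rho> \<le> 1 / 2" using a d L by (auto simp: \<rho>_def field_simps)
  \<comment> \<open>A cube of side \<open>\<rho>\<close> that contains \<open>x\<close> and fits into the unit cube.\<close>
  define lo :: "real ^ 'd" where "lo = (\<chi> l. if x $ l \<le> 1 / 2 then x $ l else x $ l - \<rho>)"
  define hi :: "real ^ 'd" where "hi = (\<chi> l. lo $ l + \<rho>)"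
  have x01: "0 \<le> x $ l" "x $ l \<le> 1" for l using x by (auto simp: mem_box_cart)
  have sub: "cbox lo hi \<subseteq> cbox 0 1"
  proof
    fix y assume y: "y \<in> cbox lo hi"
    have "0 \<le> y $ l \<and> y $ l \<le> 1" for l
      using y[unfolded mem_box_cart, rule_format, of l] x01[of l] \<rho> by (auto simp: lo_def hi_def split: if_splits)
    then show "y \<in> cbox 0 1" by (simp add: mem_box_cart)
  qed
  have near: "a / 2 \<le> \<bar>w y\<bar>" if y: "y \<in> cbox lo hi" for y
  proof -
    have "\<bar>(y - x) $ l\<bar> \<le> \<rho>" for l
      using y[unfolded mem_box_cart, rule_format, of l] by (auto simp: lo_def hi_def abs_if split: if_splits)
    then have "norm (y - x) \<le> (\<Sum>l\<in>(UNIV :: 'd set). \<rho>)"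
      by (intro order_trans[OF norm_le_l1_cart] sum_mono)
    then have "R * dist y x \<le> L * (d * \<rho>)"
      using R A[of x] \<rho> d L a by (intro mult_mono) (auto simp: dist_norm d_def L_def)
    also have "\<dots> = a / 2" using L d by (simp add: \<rho>_def)
    finally have "\<bar>w y - w x\<bar> \<le> a / 2" using lipschitz_onD[OF lip, of y x] by (simp add: dist_real_def)
    then show ?thesis using abs_triangle_ineq2[of "w x" "w y"] abs_minus_commute[of "w x" "w y"]
      unfolding a_def by linarith
  qed
  have cw: "continuous_on S (\<lambda>x. (w x)\<^sup>2)" for S
    by (intro continuous_intros continuous_on_subset[OF lipschitz_on_continuous_on[OF lip]]) simp
  have "(a / 2)\<^sup>2 * \<rho> ^ CARD('d) = integral (cbox lo hi) (\<lambda>y. (a / 2)\<^sup>2)"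
  proof -
    have "cbox lo hi \<noteq> {}" using \<rho> by (simp add: interval_ne_empty_cart hi_def)
    then have "measure lborel (cbox lo hi) = \<rho> ^ CARD('d)"
      by (simp add: content_cbox_cart hi_def)
    then show ?thesis by simp
  qed
  also have "\<dots> \<le> integral (cbox lo hi) (\<lambda>y. (w y)\<^sup>2)"
  proof (rule integral_le)
    fix y assume "y \<in> cbox lo hi"
    then have "(a / 2)\<^sup>2 \<le> \<bar>w y\<bar>\<^sup>2" using near a by (intro power_mono) auto
    then show "(a / 2)\<^sup>2 \<le> (w y)\<^sup>2" by simp
  qed (auto intro!: integrable_continuous cw)
  also have "\<dots> \<le> torus_int (\<lambda>y. (w y)\<^sup>2)"
    by (rule integral_subset_le[OF sub]) (auto intro!: integrable_continuous cw)
  finally have "(a / 2)\<^sup>2 * (a / (2 * L * d)) ^ CARD('d) \<le> torus_int (\<lambda>y. (w y)\<^sup>2)" by (simp add: \<rho>_def)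
  then have "a\<^sup>2 * a ^ CARD('d) / (4 * (2 * L * d) ^ CARD('d)) \<le> torus_int (\<lambda>y. (w y)\<^sup>2)"
    by (simp add: power_divide)
  then have "a\<^sup>2 * a ^ CARD('d) \<le> torus_int (\<lambda>y. (w y)\<^sup>2) * (4 * (2 * L * d) ^ CARD('d))"
    using L d by (subst (asm) pos_divide_le_eq) auto
  moreover have "a\<^sup>2 * a ^ CARD('d) = a ^ (CARD('d) + 2)" by (simp add: power2_eq_square)
  ultimately show ?thesis unfolding a_def[symmetric] L_def d_def by (simp only: mult_ac)
qed

section \<open>Grid functions\<close>

lemma finite_grid: "finite (grid Nx :: (int ^ 'd::finite) set)"
proof (rule finite_subset)
  show "grid Nx \<subseteq> (\<lambda>g. \<chi> l. g l) ` (UNIV \<rightarrow>\<^sub>E {0..<int Nx} :: ('d \<Rightarrow> int) set)"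
  proof
    fix i :: "int ^ 'd" assume "i \<in> grid Nx"
    then have "(\<lambda>l. i $ l) \<in> UNIV \<rightarrow>\<^sub>E {0..<int Nx}" by (auto simp: grid_def)
    then show "i \<in> (\<lambda>g. \<chi> l. g l) ` (UNIV \<rightarrow>\<^sub>E {0..<int Nx})"
      by (intro image_eqI[where x = "\<lambda>l. i $ l"]) (simp_all only: vec_nth_inverse)
  qed
  show "finite ((\<lambda>g. \<chi> l. g l) ` (UNIV \<rightarrow>\<^sub>E {0..<int Nx} :: ('d \<Rightarrow> int) set) :: (int ^ 'd) set)"
    by (intro finite_imageI finite_PiE) auto
qed

lemma grid_nonempty: "0 < Nx \<Longrightarrow> grid Nx \<noteq> {}"
  unfolding grid_def by (auto intro!: exI[of _ 0])

lemma shift_in_grid: "0 < Nx \<Longrightarrow> i \<in> grid Nx \<Longrightarrow> shift Nx l c i \<in> grid Nx"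
  by (auto simp: grid_def shift_def)

lemma grid_t_in: "0 < T \<Longrightarrow> n \<le> Nt \<Longrightarrow> 0 < Nt \<Longrightarrow> grid_t T Nt n \<in> {0..T}"
  by (auto simp: grid_t_def field_simps)

lemma grid_x_shift:
  fixes w :: "real ^ 'd::finite \<Rightarrow> 'b"
  assumes "periodic w" "0 < Nx"
  shows "w (grid_x Nx (shift Nx l c i)) = w (grid_x Nx i + (real_of_int c / real Nx) *\<^sub>R axis l 1)"
proof -
  define q where "q = (i $ l + c) div int Nx"
  have "(i $ l + c) mod int Nx = i $ l + c - int Nx * q"
    by (simp add: q_def minus_mult_div_eq_mod)
  then have "shift Nx l c i = (\<chi> j. if j = l then i $ j + c - int Nx * q else i $ j)"
    unfolding shift_def vec_eq_iff by simp
  then have "grid_x Nx (shift Nx l c i) = (grid_x Nx i + (real_of_int c / real Nx) *\<^sub>R axis l 1)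
      + of_int (- q) *\<^sub>R axis l 1"
    using assms(2) by (auto simp: vec_eq_iff grid_x_def axis_def field_simps)
  then show ?thesis by (simp only: periodic_axis_int[OF assms(1)])
qed

lemma piecewise_const_grid:
  assumes "0 < Nx" "i \<in> grid Nx"
  shows "piecewise_const Nx M (grid_x Nx i) = M i"
proof -
  have "\<lfloor>real Nx * (real_of_int (i $ l) * (1 / real Nx)) + 1 / 2\<rfloor> mod int Nx = i $ l" for l
  proof -
    have "real Nx * (real_of_int (i $ l) * (1 / real Nx)) + 1 / 2 = real_of_int (i $ l) + 1 / 2" using assms(1) by simp
    moreover have "\<lfloor>real_of_int (i $ l) + 1 / 2\<rfloor> = i $ l" by linarith
    ultimately show ?thesis using assms(2) by (simp add: grid_def)
  qed
  then show ?thesis unfolding piecewise_const_def grid_x_def by simp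
qed

text \<open>Under the stability condition an explicit diffusion step is an average, which gives the discrete
  maximum principle.\<close>

lemma diffusion_step_lower:
  fixes X :: "nat \<Rightarrow> int ^ 'd::finite \<Rightarrow> real"
  assumes "0 < Nx" "0 \<le> \<mu>" and cfl: "2 * real CARD('d) * (\<mu> / (1 / real Nx)\<^sup>2) \<le> 1"
    and X: "\<And>j. j \<in> grid Nx \<Longrightarrow> b \<le> X n j" and i: "i \<in> grid Nx"
  shows "b \<le> X n i + \<mu> * D2 Nx X n i"
proof -
  define \<kappa> where "\<kappa> = \<mu> / (1 / real Nx)\<^sup>2"
  have \<kappa>: "0 \<le> \<kappa>" using assms by (simp add: \<kappa>_def)
  have "\<mu> * D2 Nx X n i = (\<Sum>l\<in>UNIV. \<kappa> * (X n (shift Nx l 1 i) + X n (shift Nx l (-1) i) - 2 * X n i))"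
    unfolding D2_def \<kappa>_def sum_distrib_left by (intro sum.cong) (auto simp: field_simps)
  also have "\<dots> \<ge> (\<Sum>l\<in>(UNIV :: 'd set). \<kappa> * (2 * b - 2 * X n i))"
    using X[OF shift_in_grid[OF assms(1) i]] \<kappa>
    by (intro sum_mono mult_left_mono) (smt (verit))+
  also have "(\<Sum>l\<in>(UNIV :: 'd set). \<kappa> * (2 * b - 2 * X n i)) = 2 * real CARD('d) * \<kappa> * (b - X n i)" by (simp add: algebra_simps)
  finally have "\<mu> * D2 Nx X n i \<ge> 2 * real CARD('d) * \<kappa> * (b - X n i)" .
  moreover have "(1 - 2 * real CARD('d) * \<kappa>) * (X n i - b) \<ge> 0"
    using cfl X[OF i] by (intro mult_nonneg_nonneg) (auto simp: \<kappa>_def)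
  ultimately show ?thesis by (simp add: algebra_simps)
qed

lemma D2_minus: "D2 Nx (\<lambda>n i. - X n i) n i = - D2 Nx X n i"
  unfolding D2_def sum_negf[symmetric] minus_divide_left by (intro sum.cong) simp_all

lemma D2_diff: "D2 Nx (\<lambda>n i. X n i - Y n i) n i = D2 Nx X n i - D2 Nx Y n i"
  unfolding D2_def sum_subtractf[symmetric] by (intro sum.cong) (auto simp: diff_divide_distrib[symmetric])

lemma diffusion_step_abs:
  fixes X :: "nat \<Rightarrow> int ^ 'd::finite \<Rightarrow> real"
  assumes "0 < Nx" "0 \<le> \<mu>" and cfl: "2 * real CARD('d) * (\<mu> / (1 / real Nx)\<^sup>2) \<le> 1"
    and X: "\<And>j. j \<in> grid Nx \<Longrightarrow> \<bar>X n j\<bar> \<le> b" and i: "i \<in> grid Nx"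
  shows "\<bar>X n i + \<mu> * D2 Nx X n i\<bar> \<le> b"
proof -
  have "- b \<le> X n i + \<mu> * D2 Nx X n i"
    by (rule diffusion_step_lower[OF assms(1-3) _ i]) (use X in force)
  moreover have "- b \<le> - X n i + \<mu> * D2 Nx (\<lambda>n i. - X n i) n i"
    by (rule diffusion_step_lower[OF assms(1-3) _ i, of "- b" "\<lambda>n i. - X n i"]) (use X in force)
  ultimately show ?thesis by (simp add: D2_minus)
qed

text \<open>The zeroth order term is implicit and has a favourable sign, so that no factor accumulates: every
  step adds at most its own defect.\<close>

lemma scheme_stability:
  fixes X c :: "nat \<Rightarrow> int ^ 'd::finite \<Rightarrow> real"
  assumes "0 < Nx" "0 \<le> \<tau>" "0 \<le> \<nu>" and cfl: "2 * real CARD('d) * (\<tau> * \<nu> / (1 / real Nx)\<^sup>2) \<le> 1"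
    and c: "\<And>n i. n < N \<Longrightarrow> i \<in> grid Nx \<Longrightarrow> 0 \<le> c n i"
    and step: "\<And>n i. n < N \<Longrightarrow> i \<in> grid Nx \<Longrightarrow>
      \<bar>X (Suc n) i * (1 + \<tau> * c n i) - (X n i + \<tau> * \<nu> * D2 Nx X n i)\<bar> \<le> \<tau> * \<rho>"
    and init: "\<And>i. i \<in> grid Nx \<Longrightarrow> \<bar>X 0 i\<bar> \<le> b"
    and "n \<le> N" "i \<in> grid Nx"
  shows "\<bar>X n i\<bar> \<le> b + real n * \<tau> * \<rho>"
  using assms(8,9)
proof (induction n arbitrary: i)
  case 0
  then show ?case using init by simp
next
  case (Suc n)
  have "\<bar>X n i + \<tau> * \<nu> * D2 Nx X n i\<bar> \<le> b + real n * \<tau> * \<rho>"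
    by (rule diffusion_step_abs[OF assms(1) _ cfl]) (use Suc assms(2,3) in auto)
  then have "\<bar>X (Suc n) i * (1 + \<tau> * c n i)\<bar> \<le> b + real n * \<tau> * \<rho> + \<tau> * \<rho>"
    using step[of n i] Suc.prems by linarith
  moreover have "\<bar>X (Suc n) i\<bar> * 1 \<le> \<bar>X (Suc n) i\<bar> * \<bar>1 + \<tau> * c n i\<bar>"
    using c[of n i] Suc.prems assms(2) by (intro mult_left_mono) auto
  ultimately have "\<bar>X (Suc n) i\<bar> \<le> b + real n * \<tau> * \<rho> + \<tau> * \<rho>" unfolding abs_mult by linarith
  then show ?case by (simp add: algebra_simps)
qed

text \<open>Each implicit step divides by at most $1 + \tau K \le e^{\tau K}$.\<close>

lemma scheme_lower_bound:
  fixes X c :: "nat \<Rightarrow> int ^ 'd::finite \<Rightarrow> real"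
  assumes "0 < Nx" "0 \<le> \<tau>" "0 \<le> \<nu>" and cfl: "2 * real CARD('d) * (\<tau> * \<nu> / (1 / real Nx)\<^sup>2) \<le> 1"
    and c: "\<And>n i. n < N \<Longrightarrow> i \<in> grid Nx \<Longrightarrow> 0 \<le> c n i \<and> c n i \<le> K"
    and step: "\<And>n i. n < N \<Longrightarrow> i \<in> grid Nx \<Longrightarrow>
      X (Suc n) i * (1 + \<tau> * c n i) = X n i + \<tau> * \<nu> * D2 Nx X n i"
    and init: "\<And>i. i \<in> grid Nx \<Longrightarrow> b \<le> X 0 i" and b: "0 \<le> b"
    and "n \<le> N" "i \<in> grid Nx"
  shows "b * exp (- K * (real n * \<tau>)) \<le> X n i"
  using assms(9,10)
proof (induction n arbitrary: i)
  case 0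
  then show ?case using init by simp
next
  case (Suc n)
  have cn: "0 \<le> c n i" "c n i \<le> K" using c[of n i] Suc.prems by auto
  have "b * exp (- K * (real n * \<tau>)) \<le> X n i + \<tau> * \<nu> * D2 Nx X n i"
    by (rule diffusion_step_lower[OF assms(1) _ cfl]) (use Suc assms(2,3) in auto)
  then have s: "b * exp (- K * (real n * \<tau>)) \<le> X (Suc n) i * (1 + \<tau> * c n i)"
    using step[of n i] Suc.prems by simp
  have p: "0 < 1 + \<tau> * c n i" using cn assms(2) by (intro add_pos_nonneg) auto
  have "1 + \<tau> * c n i \<le> 1 + \<tau> * K" using cn assms(2) by (simp add: mult_left_mono)
  also have "\<dots> \<le> exp (K * \<tau>)" using exp_ge_add_one_self[of "K * \<tau>"] by (simp add: mult.commute)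
  finally have e: "1 + \<tau> * c n i \<le> exp (K * \<tau>)" .
  have "b * exp (- K * (real (Suc n) * \<tau>)) * (1 + \<tau> * c n i) \<le> b * exp (- K * (real (Suc n) * \<tau>)) * exp (K * \<tau>)"
    using e b by (intro mult_left_mono) auto
  also have "\<dots> = b * exp (- K * (real n * \<tau>))"
    by (simp add: mult.assoc exp_add[symmetric] algebra_simps)
  finally show ?case using s p by (meson mult_right_le_imp_le order_trans)
qed

section \<open>Consistency of the difference quotients\<close>

lemma dt_cong:
  assumes "\<And>s. s \<in> {0..T} \<Longrightarrow> u s x = v s y" "t \<in> {0..T}"
  shows "dt T u t x = dt T v t y"
proof -
  have "((\<lambda>s. u s x) has_vector_derivative D) (at t within {0..T})
      \<longleftrightarrow> ((\<lambda>s. v s y) has_vector_derivative D) (at t within {0..T})" for D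
    using assms has_vector_derivative_transform[OF assms(2), of "\<lambda>s. u s x" "\<lambda>s. v s y" D]
      has_vector_derivative_transform[OF assms(2), of "\<lambda>s. v s y" "\<lambda>s. u s x" D] by auto
  then show ?thesis unfolding dt_def vector_derivative_def by simp
qed

lemma dt_iter_periodic:
  assumes "\<And>t. t \<in> {0..T} \<Longrightarrow> periodic (u t)" "t \<in> {0..T}"
  shows "periodic ((dt T ^^ j) u t)"
  using assms(2)
proof (induction j arbitrary: t)
  case 0
  then show ?case using assms(1) by simp
next
  case (Suc j)
  show ?case unfolding periodic_def
  proof (intro allI)
    fix x l
    show "(dt T ^^ Suc j) u t (x + axis l 1) = (dt T ^^ Suc j) u t x"
      using Suc unfolding periodic_def by (auto intro!: dt_cong)
  qed
qed

text \<open>The norm is a sum of suprema. Each of them has to be shown finite before it bounds anything, since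
  the supremum of an unbounded set is an arbitrary value; periodicity and continuity provide this. As
  the terms are nonnegative, each is bounded by the sum.\<close>

lemma par_norm_bounds:
  fixes u :: "real \<Rightarrow> real ^ 'd::finite \<Rightarrow> real"
  assumes T: "0 \<le> T" and u: "par_C a b T u" "par_norm a b T u \<le> C" and t: "t \<in> {0..T}"
  shows "j \<le> a \<Longrightarrow> \<bar>(dt T ^^ j) u t x\<bar> \<le> C" "length ls \<le> b \<Longrightarrow> \<bar>pds ls (u t) x\<bar> \<le> C"
proof -
  define S where "S v = (SUP (t, x)\<in>{0..T} \<times> UNIV. \<bar>v t x\<bar>)" for v :: "real \<Rightarrow> real ^ 'd \<Rightarrow> real"
  have le: "\<bar>v t x\<bar> \<le> S v" "0 \<le> S v"
    if v: "\<And>t. t \<in> {0..T} \<Longrightarrow> periodic (v t)" "continuous_on ({0..T} \<times> UNIV) (\<lambda>(t, x). v t x)" and t: "t \<in> {0..T}"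
    for v t x
  proof -
    obtain B where "\<And>t x. t \<in> {0..T} \<Longrightarrow> \<bar>v t x\<bar> \<le> B" by (rule periodic_bounded[of T v, OF v(1) v(2)]) blast+
    then have "bdd_above ((\<lambda>(t, x). \<bar>v t x\<bar>) ` ({0..T} \<times> UNIV))" by (intro bdd_aboveI2[of _ _ B]) auto
    then have "(case (t, x) of (t, x) \<Rightarrow> \<bar>v t x\<bar>) \<le> S v" unfolding S_def using t by (intro cSUP_upper) auto
    then show "\<bar>v t x\<bar> \<le> S v" by simp
    then show "0 \<le> S v" using abs_ge_zero order_trans by blast
  qed
  have per: "\<And>t. t \<in> {0..T} \<Longrightarrow> periodic (u t)"
    and ct: "\<And>j. j \<le> a \<Longrightarrow> continuous_on ({0..T} \<times> UNIV) (\<lambda>(t, x). (dt T ^^ j) u t x)"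
    and cx: "\<And>ls. length ls \<le> b \<Longrightarrow> continuous_on ({0..T} \<times> UNIV) (\<lambda>(t, x). pds ls (u t) x)"
    using u(1) unfolding par_C_def by blast+
  have 1: "\<bar>(dt T ^^ j) u t x\<bar> \<le> S ((dt T ^^ j) u)" "0 \<le> S ((dt T ^^ j) u)" if "j \<le> a" "t \<in> {0..T}" for j t x
    using le[OF dt_iter_periodic[OF per] ct[OF that(1)] that(2)] by auto
  have 2: "\<bar>pds ls (u t) x\<bar> \<le> S (\<lambda>t. pds ls (u t))" "0 \<le> S (\<lambda>t. pds ls (u t))" if "length ls \<le> b" "t \<in> {0..T}" for ls t x
    using le[OF pds_periodic[OF per] cx[OF that(1)] that(2)] by auto
  let ?L = "{ls :: 'd list. 1 \<le> length ls \<and> length ls \<le> b}"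
  have fin: "finite ?L" by (rule finite_subset[OF _ finite_lists_length_le[of UNIV b]]) auto
  have s: "(\<Sum>j\<le>a. S ((dt T ^^ j) u)) + (\<Sum>ls\<in>?L. S (\<lambda>t. pds ls (u t))) \<le> C"
    using u(2) unfolding par_norm_def S_def by simp
  have n1: "0 \<le> (\<Sum>j\<le>a. S ((dt T ^^ j) u))" using 1(2) t by (intro sum_nonneg) auto
  have n2: "0 \<le> (\<Sum>ls\<in>?L. S (\<lambda>t. pds ls (u t)))" using 2(2) t by (intro sum_nonneg) auto
  have j: "\<bar>(dt T ^^ j) u t x\<bar> \<le> C" if "j \<le> a" for j
  proof -
    have "S ((dt T ^^ j) u) \<le> (\<Sum>j\<le>a. S ((dt T ^^ j) u))" using that 1(2) t by (intro member_le_sum) auto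
    then show ?thesis using 1(1)[OF that t, of x] s n2 by linarith
  qed
  then show "j \<le> a \<Longrightarrow> \<bar>(dt T ^^ j) u t x\<bar> \<le> C" .
  assume ls: "length ls \<le> b"
  show "\<bar>pds ls (u t) x\<bar> \<le> C"
  proof (cases ls)
    case Nil
    then show ?thesis using j[of 0] by simp
  next
    case (Cons l ks)
    then have "ls \<in> ?L" using ls by simp
    then have "S (\<lambda>t. pds ls (u t)) \<le> (\<Sum>ls\<in>?L. S (\<lambda>t. pds ls (u t)))"
      using 2(2) t fin by (intro member_le_sum) auto
    then show ?thesis using 2(1)[OF ls t, of x] s n1 by linarith
  qed
qed

text \<open>The odd order terms of the Taylor expansions at \<open>h\<close> and \<open>- h\<close> cancel.\<close>

lemma symmetric_difference_error:
  fixes q :: "nat \<Rightarrow> real \<Rightarrow> real"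
  assumes q: "\<And>m s. m < 4 \<Longrightarrow> (q m has_real_derivative q (Suc m) s) (at s)" and C: "\<And>s. \<bar>q 4 s\<bar> \<le> C"
    and h: "0 < h"
  shows "\<bar>(q 0 h - 2 * q 0 0 + q 0 (- h)) / h\<^sup>2 - q 2 0\<bar> \<le> C * h\<^sup>2"
proof -
  have D: "\<forall>m t. m < 4 \<and> \<bar>t\<bar> \<le> \<bar>y\<bar> \<longrightarrow> (q m has_real_derivative q (Suc m) t) (at t)" for y
    using q by blast
  obtain t1 where t1: "q 0 h = (\<Sum>m<4. q m 0 / fact m * h ^ m) + q 4 t1 / fact 4 * h ^ 4"
    using Maclaurin_bi_le[OF refl D[of h]] by blast
  obtain t2 where t2: "q 0 (- h) = (\<Sum>m<4. q m 0 / fact m * (- h) ^ m) + q 4 t2 / fact 4 * (- h) ^ 4"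
    using Maclaurin_bi_le[OF refl D[of "- h"]] by blast
  have "q 0 h - 2 * q 0 0 + q 0 (- h) - q 2 0 * h\<^sup>2 = (q 4 t1 + q 4 t2) / 24 * h ^ 4"
    unfolding t1 t2 by (simp add: eval_nat_numeral field_simps)
  then have e: "(q 0 h - 2 * q 0 0 + q 0 (- h)) / h\<^sup>2 - q 2 0 = (q 4 t1 + q 4 t2) / 24 * h\<^sup>2"
    using h by (simp add: field_simps eval_nat_numeral)
  have "\<bar>(q 4 t1 + q 4 t2) / 24\<bar> \<le> C"
  proof -
    have "\<bar>(x + y) / 24\<bar> \<le> C" if "\<bar>x\<bar> \<le> C" "\<bar>y\<bar> \<le> C" for x y :: real
      using that by (simp add: abs_le_iff field_simps)
    then show ?thesis using C by blast
  qed
  then have "\<bar>(q 4 t1 + q 4 t2) / 24\<bar> * h\<^sup>2 \<le> C * h\<^sup>2" by (rule mult_right_mono) simp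
  then show ?thesis unfolding e abs_mult by simp
qed

lemma D2_consistency:
  fixes w :: "real ^ 'd::finite \<Rightarrow> real"
  assumes "0 < Nx" and w: "periodic w" "\<And>ls l x. length ls < 4 \<Longrightarrow> pd_exists l (pds ls w) x"
    and C: "\<And>ls x. length ls \<le> 4 \<Longrightarrow> \<bar>pds ls w x\<bar> \<le> C" and W: "\<And>i. W n i = w (grid_x Nx i)"
  shows "\<bar>D2 Nx W n i - lap w (grid_x Nx i)\<bar> \<le> real CARD('d) * C * (1 / real Nx)\<^sup>2"
proof -
  let ?h = "1 / real Nx"
  let ?x = "grid_x Nx i"
  have one: "\<bar>(w (?x + ?h *\<^sub>R axis l 1) - 2 * w ?x + w (?x + (- ?h) *\<^sub>R axis l 1)) / ?h\<^sup>2 - pd l (pd l w) ?x\<bar> \<le> C * ?h\<^sup>2" for l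
  proof -
    define q where "q m s = pds (replicate m l) w (?x + s *\<^sub>R axis l 1)" for m s
    have q: "(q m has_real_derivative q (Suc m) s) (at s)" if "m < 4" for m s
    proof -
      have "pd_exists l (pds (replicate m l) w) y" for y using w(2) that by (metis length_replicate)
      from pd_along_line[OF this, where x = ?x and s = s and S = UNIV] show ?thesis unfolding q_def by simp
    qed
    have "\<bar>(q 0 ?h - 2 * q 0 0 + q 0 (- ?h)) / ?h\<^sup>2 - q 2 0\<bar> \<le> C * ?h\<^sup>2"
    proof (rule symmetric_difference_error[where q = q])
      show "\<bar>q 4 s\<bar> \<le> C" for s unfolding q_def by (rule C) simp
    qed (use q assms(1) in auto)
    then show ?thesis by (simp add: q_def eval_nat_numeral)
  qed
  have "D2 Nx W n i - lap w ?x
      = (\<Sum>l\<in>UNIV. (w (?x + ?h *\<^sub>R axis l 1) - 2 * w ?x + w (?x + (- ?h) *\<^sub>R axis l 1)) / ?h\<^sup>2 - pd l (pd l w) ?x)"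
    unfolding D2_def lap_def sum_subtractf W using grid_x_shift[OF w(1) assms(1), of _ 1 i] grid_x_shift[OF w(1) assms(1), of _ "-1" i]
    by simp
  also have "\<bar>\<dots>\<bar> \<le> (\<Sum>l\<in>(UNIV :: 'd set). C * ?h\<^sup>2)"
    by (rule order_trans[OF sum_abs sum_mono]) (rule one)
  finally show ?thesis by simp
qed

lemma difference_quotient_error:
  fixes u ut :: "real \<Rightarrow> real"
  assumes u: "\<And>t. t \<in> {0..T} \<Longrightarrow> (u has_real_derivative ut t) (at t within {0..T})"
    and lip: "\<And>s t. s \<in> {0..T} \<Longrightarrow> t \<in> {0..T} \<Longrightarrow> \<bar>ut s - ut t\<bar> \<le> C * \<bar>s - t\<bar>"
    and st: "s \<in> {0..T}" "t \<in> {0..T}" "s < t" and r: "r = s \<or> r = t" and C: "0 \<le> C"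
  shows "\<bar>(u t - u s) / (t - s) - ut r\<bar> \<le> C * (t - s)"
proof -
  have r': "r \<in> {0..T}" using r st by auto
  have "norm ((u t - ut r * t) - (u s - ut r * s)) \<le> (C * (t - s)) * norm (t - s)"
  proof (rule field_differentiable_bound[of "{s..t}" "\<lambda>\<tau>. u \<tau> - ut r * \<tau>" "\<lambda>\<tau>. ut \<tau> - ut r"])
    fix \<tau> assume \<tau>: "\<tau> \<in> {s..t}"
    then have \<tau>': "\<tau> \<in> {0..T}" using st by auto
    have "(u has_real_derivative ut \<tau>) (at \<tau> within {s..t})"
      by (rule DERIV_subset[OF u[OF \<tau>']]) (use st in auto)
    then show "((\<lambda>\<tau>. u \<tau> - ut r * \<tau>) has_real_derivative ut \<tau> - ut r) (at \<tau> within {s..t})"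
      by (auto intro!: derivative_eq_intros)
    have "C * \<bar>\<tau> - r\<bar> \<le> C * (t - s)" using \<tau> r C by (intro mult_left_mono) auto
    then show "norm (ut \<tau> - ut r) \<le> C * (t - s)" using lip[OF \<tau>' r'] by simp
  qed (use st in auto)
  moreover have "(u t - ut r * t) - (u s - ut r * s) = (t - s) * ((u t - u s) / (t - s) - ut r)"
    using st by (simp add: field_simps)
  ultimately have "(t - s) * \<bar>(u t - u s) / (t - s) - ut r\<bar> \<le> (t - s) * (C * (t - s))"
    using st by (simp add: abs_mult mult.commute)
  then show ?thesis using st by (simp add: mult_le_cancel_left_pos)
qed

lemma grid_t_Suc: "grid_t T Nt (Suc n) = grid_t T Nt n + T / real Nt"
  by (simp add: grid_t_def algebra_simps add_divide_distrib)

definition smooth_bound :: "real \<Rightarrow> real \<Rightarrow> (real \<Rightarrow> real ^ 'd::finite \<Rightarrow> real) \<Rightarrow> bool" where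
  "smooth_bound C T u \<longleftrightarrow> par_C 2 4 T u \<and> par_norm 2 4 T u \<le> C"

lemma smooth_bound_C12: "smooth_bound C T u \<Longrightarrow> C12_torus T u (dt T u)"
  unfolding smooth_bound_def by (auto intro: par_C_imp_C12_torus)

lemma smooth_bound_abs:
  assumes "smooth_bound C T u" "0 \<le> T" "t \<in> {0..T}"
  shows "\<bar>u t x\<bar> \<le> C" "\<bar>dt T u t x\<bar> \<le> C" "\<bar>pd l (u t) x\<bar> \<le> C"
  using par_norm_bounds(1)[of T 2 4 u C t 0 x] par_norm_bounds(1)[of T 2 4 u C t 1 x] par_norm_bounds(2)[of T 2 4 u C t "[l]" x]
    assms unfolding smooth_bound_def by simp_all

lemma smooth_bound_time_step:
  fixes u :: "real \<Rightarrow> real ^ 'd::finite \<Rightarrow> real"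
  assumes u: "smooth_bound C T u" and T: "0 < T" and N: "n < Nt"
  shows "r = n \<or> r = Suc n \<Longrightarrow> \<bar>(u (grid_t T Nt (Suc n)) x - u (grid_t T Nt n) x) / (T / real Nt) - dt T u (grid_t T Nt r) x\<bar> \<le> C * (T / real Nt)"
    "\<bar>u (grid_t T Nt (Suc n)) x - u (grid_t T Nt n) x\<bar> \<le> C * (T / real Nt)"
proof -
  let ?s = "grid_t T Nt n" and ?t = "grid_t T Nt (Suc n)"
  have st: "?s \<in> {0..T}" "?t \<in> {0..T}" "?s < ?t" "?t - ?s = T / real Nt"
    using T N grid_t_in[OF T, of n Nt] grid_t_in[OF T, of "Suc n" Nt] by (auto simp: grid_t_Suc)
  note C12 = smooth_bound_C12[OF u]
  have C: "0 \<le> C" using smooth_bound_abs(1)[OF u less_imp_le[OF T] st(1)] abs_ge_zero order_trans by blast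
  have d2: "((\<lambda>s. dt T u s x) has_real_derivative (dt T ^^ 2) u t x) (at t within {0..T})" if "t \<in> {0..T}" for t
  proof -
    have "\<forall>j<2. \<forall>t\<in>{0..T}. \<forall>x. (\<lambda>s. (dt T ^^ j) u s x) differentiable (at t within {0..T})"
      using u unfolding smooth_bound_def par_C_def by blast
    from this[rule_format, of 1 t x] that have "(\<lambda>s. dt T u s x) differentiable (at t within {0..T})" by simp
    then show ?thesis
      by (simp add: eval_nat_numeral vector_derivative_works has_real_derivative_iff_has_vector_derivative dt_def[of T "dt T u"])
  qed
  have lip: "\<bar>dt T u s x - dt T u t x\<bar> \<le> C * \<bar>s - t\<bar>" if "s \<in> {0..T}" "t \<in> {0..T}" for s t
    using field_differentiable_bound[of "{0..T}" "\<lambda>s. dt T u s x" "\<lambda>s. (dt T ^^ 2) u s x" C s t] d2 that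
      par_norm_bounds(1)[OF less_imp_le[OF T], of 2 4 u C _ 2 x] u unfolding smooth_bound_def by simp
  show "\<bar>(u ?t x - u ?s x) / (T / real Nt) - dt T u (grid_t T Nt r) x\<bar> \<le> C * (T / real Nt)" if "r = n \<or> r = Suc n"
    using difference_quotient_error[OF C12_torusD(3)[OF C12] lip st(1-3), of "grid_t T Nt r"] C that st(4) by auto
  have "\<bar>u ?t x - u ?s x\<bar> \<le> C * \<bar>?t - ?s\<bar>"
    using field_differentiable_bound[of "{0..T}" "\<lambda>s. u s x" "\<lambda>s. dt T u s x" C ?t ?s] C12_torusD(3)[OF C12, of _ x]
      smooth_bound_abs(2)[OF u less_imp_le[OF T]] st(1,2) by simp
  then show "\<bar>u ?t x - u ?s x\<bar> \<le> C * (T / real Nt)" using st T by simp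
qed

lemma smooth_bound_D2:
  fixes u :: "real \<Rightarrow> real ^ 'd::finite \<Rightarrow> real"
  assumes u: "smooth_bound C T u" and T: "0 < T" and N: "n \<le> Nt" "0 < Nt" "0 < Nx" 
  shows "\<bar>D2 Nx (\<lambda>n i. u (grid_t T Nt n) (grid_x Nx i)) n i - lap (u (grid_t T Nt n)) (grid_x Nx i)\<bar>
    \<le> real CARD('d) * C * (1 / real Nx)\<^sup>2"
proof (rule D2_consistency[OF N(3)])
  have t: "grid_t T Nt n \<in> {0..T}" by (rule grid_t_in[OF T N(1,2)])
  show "periodic (u (grid_t T Nt n))" using u t unfolding smooth_bound_def par_C_def by blast
  show "pd_exists l (pds ls (u (grid_t T Nt n))) x" if "length ls < 4" for ls l x
    using u t that unfolding smooth_bound_def par_C_def by blast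
  show "\<bar>pds ls (u (grid_t T Nt n)) x\<bar> \<le> C" if "length ls \<le> 4" for ls x
    using par_norm_bounds(2)[OF less_imp_le[OF T] _ _ t that] u unfolding smooth_bound_def by blast
qed simp

section \<open>Error of one discrete iteration\<close>

lemma backward_step_explicit:
  fixes \<tau> :: real
  assumes "0 < \<tau>" "(a - b) / \<tau> + \<nu> * D = G * b / (2 * \<nu>)"
  shows "b * (1 + \<tau> * (G / (2 * \<nu>))) = a + \<tau> * \<nu> * D"
proof -
  have "a - b = \<tau> * (G * b / (2 * \<nu>) - \<nu> * D)" using assms by (simp add: field_simps)
  then show ?thesis by (simp add: algebra_simps)
qed

text \<open>Both schemes are covered by one error estimate for a grid function \<open>Y\<close> and the values \<open>y\<close> of an exact
  solution, with \<open>yt\<close> and \<open>yl\<close> its time derivative and Laplacian. The defect consists of the two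
  consistency errors, the shift of the zeroth order term by one time step and the error of the
  potential.\<close>

lemma scheme_error:
  fixes Y y yt yl G c :: "nat \<Rightarrow> int ^ 'd::finite \<Rightarrow> real"
  assumes "0 < Nx" and \<tau>: "0 < \<tau>" "real N * \<tau> \<le> T" and \<nu>: "0 \<le> \<nu>" and cfl: "2 * real CARD('d) * (\<tau> * \<nu> / (1 / real Nx)\<^sup>2) \<le> 1"
    and scheme: "\<And>n i. n < N \<Longrightarrow> i \<in> grid Nx \<Longrightarrow> Y (Suc n) i * (1 + \<tau> * G n i) = Y n i + \<tau> * \<nu> * D2 Nx Y n i"
    and eq: "\<And>n i. n < N \<Longrightarrow> i \<in> grid Nx \<Longrightarrow> yt n i - \<nu> * yl n i = - (c n i * y n i)"
    and time: "\<And>n i. n < N \<Longrightarrow> i \<in> grid Nx \<Longrightarrow> \<bar>(y (Suc n) i - y n i) / \<tau> - yt n i\<bar> \<le> C * \<tau>"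
      "\<And>n i. n < N \<Longrightarrow> i \<in> grid Nx \<Longrightarrow> \<bar>y (Suc n) i - y n i\<bar> \<le> C * \<tau>"
    and space: "\<And>n i. n < N \<Longrightarrow> i \<in> grid Nx \<Longrightarrow> \<bar>D2 Nx y n i - yl n i\<bar> \<le> real CARD('d) * C * (1 / real Nx)\<^sup>2"
    and C: "\<And>n i. n \<le> N \<Longrightarrow> i \<in> grid Nx \<Longrightarrow> \<bar>y n i\<bar> \<le> C" and K: "\<And>n i. n \<le> N \<Longrightarrow> i \<in> grid Nx \<Longrightarrow> \<bar>c n i\<bar> \<le> K"
    and G: "\<And>n i. n \<le> N \<Longrightarrow> i \<in> grid Nx \<Longrightarrow> 0 \<le> G n i" "\<And>n i. n \<le> N \<Longrightarrow> i \<in> grid Nx \<Longrightarrow> \<bar>G n i - c n i\<bar> \<le> \<eta>"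
    and init: "\<And>i. i \<in> grid Nx \<Longrightarrow> \<bar>Y 0 i - y 0 i\<bar> \<le> b" and n: "n \<le> N" "i \<in> grid Nx"
  shows "\<bar>Y n i - y n i\<bar> \<le> b + T * (\<eta> * C + (C + \<nu> * real CARD('d) * C + K * C) * (\<tau> + (1 / real Nx)\<^sup>2))"
proof -
  define H where "H = \<tau> + (1 / real Nx)\<^sup>2"
  define \<rho> where "\<rho> = \<eta> * C + (C + \<nu> * real CARD('d) * C + K * C) * H"
  define X where "X n i = Y n i - y n i" for n i
  have pos: "0 \<le> C" "0 \<le> K" "0 \<le> \<eta>" using C[OF n] K[OF n] G(2)[OF n] abs_ge_zero order_trans by blast+
  have "\<bar>X n i\<bar> \<le> b + real n * \<tau> * \<rho>"
  proof (rule scheme_stability[where X = X and c = G, OF assms(1) less_imp_le[OF \<tau>(1)] \<nu> cfl _ _ _ n])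
    show "\<bar>X 0 i\<bar> \<le> b" if "i \<in> grid Nx" for i using init[OF that] by (simp add: X_def)
    show "0 \<le> G n i" if "n < N" "i \<in> grid Nx" for n i using G(1) that by simp
    fix n and i :: "int ^ 'd" assume n: "n < N" "i \<in> grid Nx"
    define K1 where "K1 = (y (Suc n) i - y n i) / \<tau> - yt n i"
    define K2 where "K2 = \<nu> * (D2 Nx y n i - yl n i)"
    define K3 where "K3 = c n i * (y (Suc n) i - y n i)"
    define K4 where "K4 = (G n i - c n i) * y (Suc n) i"
    define dq where "dq = (y (Suc n) i - y n i) / \<tau>"
    have e1: "\<tau> * dq = y (Suc n) i - y n i" using \<tau> by (simp add: dq_def)
    have k1: "K1 = dq - yt n i" by (simp add: K1_def dq_def)
    have "K1 - K2 + K3 + K4 = dq - \<nu> * D2 Nx y n i + G n i * y (Suc n) i - ((yt n i - \<nu> * yl n i) + c n i * y n i)"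
      by (simp add: k1 K2_def K3_def K4_def algebra_simps)
    then have KR: "K1 - K2 + K3 + K4 = dq - \<nu> * D2 Nx y n i + G n i * y (Suc n) i" unfolding eq[OF n] by simp
    have KT: "\<tau> * (K1 - K2 + K3 + K4) = y (Suc n) i * (1 + \<tau> * G n i) - (y n i + \<tau> * \<nu> * D2 Nx y n i)"
      unfolding KR using e1 by (simp add: algebra_simps)
    have D2X: "D2 Nx X n i = D2 Nx Y n i - D2 Nx y n i" unfolding X_def[abs_def] by (rule D2_diff)
    have X: "X (Suc n) i * (1 + \<tau> * G n i) - (X n i + \<tau> * \<nu> * D2 Nx X n i) = - (\<tau> * (K1 - K2 + K3 + K4))"
      unfolding KT D2X using scheme[OF n] by (simp add: X_def algebra_simps)
    have "\<bar>K1\<bar> \<le> C * \<tau>" using time(1)[OF n] by (simp add: K1_def)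
    moreover have "\<bar>K2\<bar> \<le> \<nu> * (real CARD('d) * C * (1 / real Nx)\<^sup>2)"
      using space[OF n] \<nu> unfolding K2_def abs_mult by (simp add: mult_left_mono)
    moreover have "\<bar>K3\<bar> \<le> K * (C * \<tau>)"
      unfolding K3_def abs_mult using K[of n i] time(2)[OF n] n pos by (intro mult_mono) auto
    moreover have "\<bar>K4\<bar> \<le> \<eta> * C"
      unfolding K4_def abs_mult using G(2)[of n i] C[of "Suc n" i] n pos by (intro mult_mono) auto
    ultimately have "\<bar>K1 - K2 + K3 + K4\<bar> \<le> C * \<tau> + \<nu> * (real CARD('d) * C * (1 / real Nx)\<^sup>2) + K * (C * \<tau>) + \<eta> * C"
      by linarith
    also have "\<dots> \<le> C * H + \<nu> * (real CARD('d) * C * H) + K * (C * H) + \<eta> * C"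
      using pos \<nu> \<tau> by (intro add_mono mult_left_mono order_refl) (auto simp: H_def)
    also have "\<dots> = \<rho>" by (simp add: \<rho>_def algebra_simps)
    finally have "\<bar>\<tau> * (K1 - K2 + K3 + K4)\<bar> \<le> \<tau> * \<rho>" using \<tau> by (simp add: abs_mult mult_left_mono)
    then show "\<bar>X (Suc n) i * (1 + \<tau> * G n i) - (X n i + \<tau> * \<nu> * D2 Nx X n i)\<bar> \<le> \<tau> * \<rho>"
      unfolding X by simp
  qed
  also have "\<dots> \<le> b + T * \<rho>"
  proof (intro add_left_mono mult_right_mono)
    have "real n * \<tau> \<le> real N * \<tau>" using \<tau> n by (intro mult_right_mono) auto
    then show "real n * \<tau> \<le> T" using \<tau>(2) by linarith
    show "0 \<le> \<rho>" using pos \<nu> \<tau> by (simp add: \<rho>_def H_def)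
  qed
  finally show ?thesis by (simp add: \<rho>_def H_def X_def)
qed

text \<open>The backward scheme is a forward scheme in the reversed index, with the sign of the time derivative
  changed.\<close>

lemma backward_scheme_error:
  fixes \<phi> :: "real \<Rightarrow> real ^ 'd::finite \<Rightarrow> real"
  assumes T: "0 < T" and \<nu>: "0 < \<nu>" and N: "0 < Nt" "0 < Nx"
    and cfl: "2 * real CARD('d) * (T / real Nt * \<nu> / (1 / real Nx)\<^sup>2) \<le> 1"
    and \<Phi>: "\<And>n i. n < Nt \<Longrightarrow> i \<in> grid Nx \<Longrightarrow>
        (\<Phi> (Suc n) i - \<Phi> n i) / (T / real Nt) + \<nu> * D2 Nx \<Phi> (Suc n) i = \<Gamma> (Suc n) i * \<Phi> n i / (2 * \<nu>)"
      "\<And>i. i \<in> grid Nx \<Longrightarrow> \<Phi> Nt i = \<phi> T (grid_x Nx i)"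
    and \<phi>: "backward_solution T \<nu> \<gamma> \<phi> (dt T \<phi>)" "smooth_bound C T \<phi>"
    and \<gamma>: "\<And>t x. t \<in> {0..T} \<Longrightarrow> \<bar>\<gamma> t x\<bar> \<le> C0"
    and \<Gamma>: "\<And>n i. n \<le> Nt \<Longrightarrow> i \<in> grid Nx \<Longrightarrow> 0 \<le> \<Gamma> n i"
      "\<And>n i. n \<le> Nt \<Longrightarrow> i \<in> grid Nx \<Longrightarrow> \<bar>\<Gamma> n i - \<gamma> (grid_t T Nt n) (grid_x Nx i)\<bar> \<le> \<eta>"
    and n: "n \<le> Nt" "i \<in> grid Nx"
  shows "\<bar>\<Phi> n i - \<phi> (grid_t T Nt n) (grid_x Nx i)\<bar>
    \<le> T * (\<eta> * C / (2 * \<nu>) + (C + \<nu> * real CARD('d) * C + C0 * C / (2 * \<nu>)) * (T / real Nt + (1 / real Nx)\<^sup>2))"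
proof -
  let ?\<tau> = "T / real Nt" and ?t = "\<lambda>n. grid_t T Nt n" and ?x = "grid_x Nx :: int ^ 'd \<Rightarrow> real ^ 'd"
  have tin: "n \<le> Nt \<Longrightarrow> grid_t T Nt n \<in> {0..T}" for n using grid_t_in[OF T _ N(1)] by blast
  have "\<bar>\<Phi> (Nt - (Nt - n)) i - \<phi> (?t (Nt - (Nt - n))) (?x i)\<bar> \<le> 0 + T * (\<eta> / (2 * \<nu>) * C
      + (C + \<nu> * real CARD('d) * C + C0 / (2 * \<nu>) * C) * (?\<tau> + (1 / real Nx)\<^sup>2))"
  proof (rule scheme_error[where Y = "\<lambda>m. \<Phi> (Nt - m)" and y = "\<lambda>m i. \<phi> (?t (Nt - m)) (?x i)" and N = Nt
        and yt = "\<lambda>m i. - dt T \<phi> (?t (Nt - m)) (?x i)" and yl = "\<lambda>m i. lap (\<phi> (?t (Nt - m))) (?x i)"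
        and G = "\<lambda>m i. \<Gamma> (Nt - m) i / (2 * \<nu>)" and c = "\<lambda>m i. \<gamma> (?t (Nt - m)) (?x i) / (2 * \<nu>)", OF N(2) _ _ less_imp_le[OF \<nu>] cfl])
    fix m and i :: "int ^ 'd" assume m: "m < Nt" and i: "i \<in> grid Nx"
    define n where "n = Nt - Suc m"
    have n: "n < Nt" "Nt - m = Suc n" "Nt - Suc m = n" using m by (auto simp: n_def)
    have t: "?t (Suc n) \<in> {0..T}" using tin n by auto
    have D2: "D2 Nx (\<lambda>m i. X (Nt - m) i) m i = D2 Nx X (Suc n) i" for X by (simp add: D2_def n(2))
    show "\<Phi> (Nt - Suc m) i * (1 + ?\<tau> * (\<Gamma> (Nt - m) i / (2 * \<nu>))) = \<Phi> (Nt - m) i + ?\<tau> * \<nu> * D2 Nx (\<lambda>m. \<Phi> (Nt - m)) m i"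
      unfolding D2 n(2,3) by (rule backward_step_explicit[OF _ \<Phi>(1)[OF n(1) i]]) (use T N in simp)
    show "- dt T \<phi> (?t (Nt - m)) (?x i) - \<nu> * lap (\<phi> (?t (Nt - m))) (?x i) = - (\<gamma> (?t (Nt - m)) (?x i) / (2 * \<nu>) * \<phi> (?t (Nt - m)) (?x i))"
    proof -
      have "dt T \<phi> (?t (Suc n)) (?x i) + \<nu> * lap (\<phi> (?t (Suc n))) (?x i) = \<gamma> (?t (Suc n)) (?x i) * \<phi> (?t (Suc n)) (?x i) / (2 * \<nu>)"
        using \<phi>(1) t unfolding backward_solution_def by blast
      then show ?thesis unfolding n(2) times_divide_eq_left by linarith
    qed
    note st = smooth_bound_time_step[OF \<phi>(2) T n(1), where x = "?x i"]
    show "\<bar>\<phi> (?t (Nt - Suc m)) (?x i) - \<phi> (?t (Nt - m)) (?x i)\<bar> \<le> C * ?\<tau>"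
      using st(2) unfolding n(2,3) by (simp add: abs_minus_commute)
    have "(a - b) / q - - d = - ((b - a) / q - d)" for a b q d :: real
      by (simp add: diff_divide_distrib)
    from this[of "\<phi> (?t n) (?x i)" "\<phi> (?t (Suc n)) (?x i)" ?\<tau> "dt T \<phi> (?t (Suc n)) (?x i)"] show "\<bar>(\<phi> (?t (Nt - Suc m)) (?x i) - \<phi> (?t (Nt - m)) (?x i)) / ?\<tau> - - dt T \<phi> (?t (Nt - m)) (?x i)\<bar> \<le> C * ?\<tau>"
      using st(1)[of "Suc n"] unfolding n(2,3) by (simp only: abs_minus_cancel simp_thms)
    show "\<bar>D2 Nx (\<lambda>m i. \<phi> (?t (Nt - m)) (?x i)) m i - lap (\<phi> (?t (Nt - m))) (?x i)\<bar> \<le> real CARD('d) * C * (1 / real Nx)\<^sup>2"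
      using smooth_bound_D2[OF \<phi>(2) T _ N, of "Suc n" i] n(1) D2[of "\<lambda>n i. \<phi> (?t n) (?x i)"] unfolding n(2) by simp
  next
    fix m and i :: "int ^ 'd" assume m: "m \<le> Nt" and i: "i \<in> grid Nx"
    have t: "?t (Nt - m) \<in> {0..T}" using tin by simp
    show "\<bar>\<phi> (?t (Nt - m)) (?x i)\<bar> \<le> C" by (rule smooth_bound_abs(1)[OF \<phi>(2) less_imp_le[OF T] t])
    show "\<bar>\<gamma> (?t (Nt - m)) (?x i) / (2 * \<nu>)\<bar> \<le> C0 / (2 * \<nu>)" using \<gamma>[OF t, of "?x i"] \<nu> by (simp add: divide_right_mono)
    show "0 \<le> \<Gamma> (Nt - m) i / (2 * \<nu>)" using \<Gamma>(1)[of "Nt - m" i] i \<nu> by simp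
    show "\<bar>\<Gamma> (Nt - m) i / (2 * \<nu>) - \<gamma> (?t (Nt - m)) (?x i) / (2 * \<nu>)\<bar> \<le> \<eta> / (2 * \<nu>)"
      using \<Gamma>(2)[of "Nt - m" i] i \<nu> unfolding diff_divide_distrib[symmetric] by (simp add: divide_right_mono)
  qed (use \<Phi>(2) n T N in \<open>simp_all add: grid_t_def\<close>)
  then show ?thesis using n by simp
qed

lemma forward_scheme_error:
  fixes \<psi> :: "real \<Rightarrow> real ^ 'd::finite \<Rightarrow> real"
  assumes T: "0 < T" and \<nu>: "0 < \<nu>" and N: "0 < Nt" "0 < Nx"
    and cfl: "2 * real CARD('d) * (T / real Nt * \<nu> / (1 / real Nx)\<^sup>2) \<le> 1"
    and \<Psi>: "\<And>n i. n < Nt \<Longrightarrow> i \<in> grid Nx \<Longrightarrow>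
        (\<Psi> (Suc n) i - \<Psi> n i) / (T / real Nt) - \<nu> * D2 Nx \<Psi> n i = - (\<Gamma> n i * \<Psi> (Suc n) i / (2 * \<nu>))"
      "\<And>i. i \<in> grid Nx \<Longrightarrow> \<bar>\<Psi> 0 i - \<psi> 0 (grid_x Nx i)\<bar> \<le> b"
    and \<psi>: "\<And>t x. t \<in> {0..T} \<Longrightarrow> dt T \<psi> t x - \<nu> * lap (\<psi> t) x = - (\<gamma> t x * \<psi> t x / (2 * \<nu>))" "smooth_bound C T \<psi>"
    and \<gamma>: "\<And>t x. t \<in> {0..T} \<Longrightarrow> \<bar>\<gamma> t x\<bar> \<le> C0"
    and \<Gamma>: "\<And>n i. n \<le> Nt \<Longrightarrow> i \<in> grid Nx \<Longrightarrow> 0 \<le> \<Gamma> n i"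
      "\<And>n i. n \<le> Nt \<Longrightarrow> i \<in> grid Nx \<Longrightarrow> \<bar>\<Gamma> n i - \<gamma> (grid_t T Nt n) (grid_x Nx i)\<bar> \<le> \<eta>"
    and n: "n \<le> Nt" "i \<in> grid Nx"
  shows "\<bar>\<Psi> n i - \<psi> (grid_t T Nt n) (grid_x Nx i)\<bar>
    \<le> b + T * (\<eta> * C / (2 * \<nu>) + (C + \<nu> * real CARD('d) * C + C0 * C / (2 * \<nu>)) * (T / real Nt + (1 / real Nx)\<^sup>2))"
proof -
  let ?\<tau> = "T / real Nt" and ?t = "\<lambda>n. grid_t T Nt n" and ?x = "grid_x Nx :: int ^ 'd \<Rightarrow> real ^ 'd"
  have tin: "n \<le> Nt \<Longrightarrow> grid_t T Nt n \<in> {0..T}" for n using grid_t_in[OF T _ N(1)] by blast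
  have "\<bar>\<Psi> n i - \<psi> (?t n) (?x i)\<bar> \<le> b + T * (\<eta> / (2 * \<nu>) * C
      + (C + \<nu> * real CARD('d) * C + C0 / (2 * \<nu>) * C) * (?\<tau> + (1 / real Nx)\<^sup>2))"
  proof (rule scheme_error[where y = "\<lambda>n i. \<psi> (?t n) (?x i)" and N = Nt
        and yt = "\<lambda>n i. dt T \<psi> (?t n) (?x i)" and yl = "\<lambda>n i. lap (\<psi> (?t n)) (?x i)"
        and G = "\<lambda>n i. \<Gamma> n i / (2 * \<nu>)" and c = "\<lambda>n i. \<gamma> (?t n) (?x i) / (2 * \<nu>)", OF N(2) _ _ less_imp_le[OF \<nu>] cfl])
    fix n and i :: "int ^ 'd" assume n: "n < Nt" and i: "i \<in> grid Nx"
    show "\<Psi> (Suc n) i * (1 + ?\<tau> * (\<Gamma> n i / (2 * \<nu>))) = \<Psi> n i + ?\<tau> * \<nu> * D2 Nx \<Psi> n i"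
      using \<Psi>(1)[OF n i] T N \<nu> by (simp add: field_simps)
    show "dt T \<psi> (?t n) (?x i) - \<nu> * lap (\<psi> (?t n)) (?x i) = - (\<gamma> (?t n) (?x i) / (2 * \<nu>) * \<psi> (?t n) (?x i))"
      using \<psi>(1)[OF tin[of n], of "?x i"] n by simp
    show "\<bar>(\<psi> (?t (Suc n)) (?x i) - \<psi> (?t n) (?x i)) / ?\<tau> - dt T \<psi> (?t n) (?x i)\<bar> \<le> C * ?\<tau>"
      "\<bar>\<psi> (?t (Suc n)) (?x i) - \<psi> (?t n) (?x i)\<bar> \<le> C * ?\<tau>"
      using smooth_bound_time_step[OF \<psi>(2) T n, where x = "?x i"] by blast+
    show "\<bar>D2 Nx (\<lambda>n i. \<psi> (?t n) (?x i)) n i - lap (\<psi> (?t n)) (?x i)\<bar> \<le> real CARD('d) * C * (1 / real Nx)\<^sup>2"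
      using smooth_bound_D2[OF \<psi>(2) T _ N, of n i] n by simp
  next
    fix n and i :: "int ^ 'd" assume n: "n \<le> Nt" and i: "i \<in> grid Nx"
    show "\<bar>\<psi> (?t n) (?x i)\<bar> \<le> C" by (rule smooth_bound_abs(1)[OF \<psi>(2) less_imp_le[OF T] tin[OF n]])
    show "\<bar>\<gamma> (?t n) (?x i) / (2 * \<nu>)\<bar> \<le> C0 / (2 * \<nu>)" using \<gamma>[OF tin[OF n], of "?x i"] \<nu> by (simp add: divide_right_mono)
    show "0 \<le> \<Gamma> n i / (2 * \<nu>)" using \<Gamma>(1)[OF n i] \<nu> by simp
    show "\<bar>\<Gamma> n i / (2 * \<nu>) - \<gamma> (?t n) (?x i) / (2 * \<nu>)\<bar> \<le> \<eta> / (2 * \<nu>)"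
      using \<Gamma>(2)[OF n i] \<nu> unfolding diff_divide_distrib[symmetric] by (simp add: divide_right_mono)
  qed (use \<Psi>(2) n T N in \<open>simp_all add: grid_t_def\<close>)
  then show ?thesis by simp
qed

lemma backward_scheme_bounds:
  fixes \<Phi> :: "nat \<Rightarrow> int ^ 'd::finite \<Rightarrow> real"
  assumes T: "0 < T" and \<nu>: "0 < \<nu>" and N: "0 < Nt" "0 < Nx"
    and cfl: "2 * real CARD('d) * (T / real Nt * \<nu> / (1 / real Nx)\<^sup>2) \<le> 1"
    and \<Phi>: "\<And>n i. n < Nt \<Longrightarrow> i \<in> grid Nx \<Longrightarrow>
        (\<Phi> (Suc n) i - \<Phi> n i) / (T / real Nt) + \<nu> * D2 Nx \<Phi> (Suc n) i = \<Gamma> (Suc n) i * \<Phi> n i / (2 * \<nu>)"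
      "\<And>i. i \<in> grid Nx \<Longrightarrow> b \<le> \<Phi> Nt i \<and> \<Phi> Nt i \<le> B" and b: "0 \<le> b"
    and \<Gamma>: "\<And>n i. n \<le> Nt \<Longrightarrow> i \<in> grid Nx \<Longrightarrow> 0 \<le> \<Gamma> n i \<and> \<Gamma> n i \<le> C0"
    and n: "n \<le> Nt" "i \<in> grid Nx"
  shows "b * exp (- C0 * T / (2 * \<nu>)) \<le> \<Phi> n i" "\<bar>\<Phi> n i\<bar> \<le> B"
proof -
  define \<tau> where "\<tau> = T / real Nt"
  define X :: "nat \<Rightarrow> int ^ 'd \<Rightarrow> real" where "X n i = \<Phi> (Nt - n) i" for n i
  have \<tau>: "0 < \<tau>" using T N by (simp add: \<tau>_def)
  have c: "2 * real CARD('d) * (\<tau> * \<nu> / (1 / real Nx)\<^sup>2) \<le> 1" using cfl by (simp add: \<tau>_def)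
  have C0: "0 \<le> C0" using \<Gamma>[OF n] by simp
  have step: "X (Suc m) i * (1 + \<tau> * (\<Gamma> (Nt - m) i / (2 * \<nu>))) = X m i + \<tau> * \<nu> * D2 Nx X m i" if "m < Nt" "i \<in> grid Nx" for m i
  proof -
    define n where "n = Nt - Suc m"
    have n: "n < Nt" "Nt - m = Suc n" "Nt - Suc m = n" using that by (auto simp: n_def)
    have "D2 Nx X m i = D2 Nx \<Phi> (Suc n) i" using n by (simp add: D2_def X_def)
    then show ?thesis
      unfolding X_def n(2,3) \<tau>_def by (metis backward_step_explicit[OF _ \<Phi>(1)[OF n(1) that(2)]] \<tau> \<tau>_def)
  qed
  have \<Gamma>': "0 \<le> \<Gamma> (Nt - m) i / (2 * \<nu>) \<and> \<Gamma> (Nt - m) i / (2 * \<nu>) \<le> C0 / (2 * \<nu>)" if "m < Nt" "i \<in> grid Nx" for m i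
    using \<Gamma>[of "Nt - m" i] that \<nu> by (auto intro: divide_right_mono)
  have "\<bar>X (Nt - n) i\<bar> \<le> B + real (Nt - n) * \<tau> * 0"
  proof (rule scheme_stability[where c = "\<lambda>n i. \<Gamma> (Nt - n) i / (2 * \<nu>)" and N = Nt, OF N(2) less_imp_le[OF \<tau>] less_imp_le[OF \<nu>] c])
    fix j :: "int ^ 'd" assume "j \<in> grid Nx"
    then show "\<bar>X 0 j\<bar> \<le> B" using \<Phi>(2)[of j] b by (simp add: X_def)
  qed (use step \<Gamma>' n in auto)
  then show "\<bar>\<Phi> n i\<bar> \<le> B" using n by (simp add: X_def)
  have "b * exp (- (C0 / (2 * \<nu>)) * (real (Nt - n) * \<tau>)) \<le> X (Nt - n) i"
  proof (rule scheme_lower_bound[where c = "\<lambda>n i. \<Gamma> (Nt - n) i / (2 * \<nu>)" and N = Nt, OF N(2) less_imp_le[OF \<tau>] less_imp_le[OF \<nu>] c])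
    fix j :: "int ^ 'd" assume "j \<in> grid Nx"
    then show "b \<le> X 0 j" using \<Phi>(2)[of j] by (simp add: X_def)
  qed (use step \<Gamma>' b n in auto)
  moreover have "C0 / (2 * \<nu>) * (real (Nt - n) * \<tau>) \<le> C0 / (2 * \<nu>) * T"
  proof (rule mult_left_mono)
    have "real (Nt - n) * \<tau> \<le> real Nt * \<tau>" using \<tau> by (intro mult_right_mono) auto
    then show "real (Nt - n) * \<tau> \<le> T" using N by (simp add: \<tau>_def)
  qed (use C0 \<nu> in simp)
  then have "b * exp (- C0 * T / (2 * \<nu>)) \<le> b * exp (- (C0 / (2 * \<nu>)) * (real (Nt - n) * \<tau>))"
    using b by (intro mult_left_mono) auto
  ultimately show "b * exp (- C0 * T / (2 * \<nu>)) \<le> \<Phi> n i" using n by (simp add: X_def)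
qed

lemma forward_scheme_nonneg:
  fixes \<Psi> :: "nat \<Rightarrow> int ^ 'd::finite \<Rightarrow> real"
  assumes T: "0 < T" and \<nu>: "0 < \<nu>" and N: "0 < Nt" "0 < Nx"
    and cfl: "2 * real CARD('d) * (T / real Nt * \<nu> / (1 / real Nx)\<^sup>2) \<le> 1"
    and \<Psi>: "\<And>n i. n < Nt \<Longrightarrow> i \<in> grid Nx \<Longrightarrow>
        (\<Psi> (Suc n) i - \<Psi> n i) / (T / real Nt) - \<nu> * D2 Nx \<Psi> n i = - (\<Gamma> n i * \<Psi> (Suc n) i / (2 * \<nu>))"
      "\<And>i. i \<in> grid Nx \<Longrightarrow> 0 \<le> \<Psi> 0 i"
    and \<Gamma>: "\<And>n i. n \<le> Nt \<Longrightarrow> i \<in> grid Nx \<Longrightarrow> 0 \<le> \<Gamma> n i \<and> \<Gamma> n i \<le> C0"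
    and n: "n \<le> Nt" "i \<in> grid Nx"
  shows "0 \<le> \<Psi> n i"
proof -
  define \<tau> where "\<tau> = T / real Nt"
  have \<tau>: "0 < \<tau>" using T N by (simp add: \<tau>_def)
  have c: "2 * real CARD('d) * (\<tau> * \<nu> / (1 / real Nx)\<^sup>2) \<le> 1" using cfl by (simp add: \<tau>_def)
  have step: "\<Psi> (Suc n) i * (1 + \<tau> * (\<Gamma> n i / (2 * \<nu>))) = \<Psi> n i + \<tau> * \<nu> * D2 Nx \<Psi> n i" if "n < Nt" "i \<in> grid Nx" for n i
    using \<Psi>(1)[OF that] \<tau> \<nu> unfolding \<tau>_def[symmetric] by (simp add: field_simps)
  have \<Gamma>': "0 \<le> \<Gamma> m i / (2 * \<nu>) \<and> \<Gamma> m i / (2 * \<nu>) \<le> C0 / (2 * \<nu>)" if "m < Nt" "i \<in> grid Nx" for m i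
    using \<Gamma>[of m i] that \<nu> by (auto intro: divide_right_mono)
  have "0 * exp (- (C0 / (2 * \<nu>)) * (real n * \<tau>)) \<le> \<Psi> n i"
    by (rule scheme_lower_bound[where c = "\<lambda>n i. \<Gamma> n i / (2 * \<nu>)" and N = Nt, OF N(2) less_imp_le[OF \<tau>] less_imp_le[OF \<nu>] c])
      (use step \<Gamma>' \<Psi>(2) n in auto)
  then show ?thesis by simp
qed

section \<open>Hopf--Cole transform of the system\<close>

lemma C12_torus_exp:
  fixes u :: "real \<Rightarrow> real ^ 'd::finite \<Rightarrow> real"
  assumes u: "C12_torus T u ut"
  shows "C12_torus T (\<lambda>t x. exp (u t x)) (\<lambda>t x. exp (u t x) * ut t x)"
    "t \<in> {0..T} \<Longrightarrow> grad (\<lambda>x. exp (u t x)) x = exp (u t x) *\<^sub>R grad (u t) x"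
    "t \<in> {0..T} \<Longrightarrow> lap (\<lambda>x. exp (u t x)) x = exp (u t x) * (lap (u t) x + (norm (grad (u t) x))\<^sup>2)"
proof -
  have 0: "C1_torus (\<lambda>x. exp (u t x))" if "t \<in> {0..T}" for t by (intro C1_torus_exp C12_torusD(1)[OF u that])
  have 1: "pd l (\<lambda>x. exp (u t x)) = (\<lambda>x. exp (u t x) * pd l (u t) x)" if "t \<in> {0..T}" for l t
    by (intro C1_torus_exp C12_torusD(1)[OF u that])
  have 2: "pd l (\<lambda>x. exp (u t x) * pd l (u t) x)
      = (\<lambda>x. exp (u t x) * pd l (u t) x * pd l (u t) x + exp (u t x) * pd l (pd l (u t)) x)" if "t \<in> {0..T}" for l t
    using C1_torus_mult(2)[OF 0[OF that] C12_torusD(2)[OF u that], of l l] by (simp add: 1[OF that])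
  have 3: "C1_torus (pd l (\<lambda>x. exp (u t x)))" if "t \<in> {0..T}" for l t
    unfolding 1[OF that] by (intro C1_torus_mult 0[OF that] C12_torusD(2)[OF u that])
  have e: "cont_Q T (\<lambda>t x. exp (u t x))"
    by (rule cont_Q_compose[of UNIV exp, OF _ C12_torusD(4)[OF u]]) (auto intro: continuous_intros)
  have 4: "cont_Q T (\<lambda>t. pd l (\<lambda>x. exp (u t x)))" for l
    by (rule cont_Q_cong[OF cont_Q_mult[OF e C12_torusD(6)[OF u, of l]]]) (simp add: 1)
  have 5: "cont_Q T (\<lambda>t. pd l (pd l (\<lambda>x. exp (u t x))))" for l
    by (rule cont_Q_cong[OF cont_Q_add[OF cont_Q_mult[OF cont_Q_mult[OF e C12_torusD(6)[OF u, of l]] C12_torusD(6)[OF u, of l]]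
          cont_Q_mult[OF e C12_torusD(7)[OF u, of l]]]]) (simp add: 1 2)
  have 6: "((\<lambda>s. exp (u s x)) has_real_derivative exp (u t x) * ut t x) (at t within {0..T})" if "t \<in> {0..T}" for t x
    by (rule derivative_eq_intros C12_torusD(3)[OF u that] refl)+
  show "C12_torus T (\<lambda>t x. exp (u t x)) (\<lambda>t x. exp (u t x) * ut t x)"
    unfolding C12_torus_def using 0 3 4 5 6 e cont_Q_mult[OF e C12_torusD(5)[OF u]] by auto
  show "grad (\<lambda>x. exp (u t x)) x = exp (u t x) *\<^sub>R grad (u t) x" if "t \<in> {0..T}"
    by (simp add: grad_def vec_eq_iff 1[OF that])
  show "lap (\<lambda>x. exp (u t x)) x = exp (u t x) * (lap (u t) x + (norm (grad (u t) x))\<^sup>2)" if "t \<in> {0..T}"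
    unfolding norm_grad_sq lap_def
    by (simp add: 1[OF that] 2[OF that] sum.distrib[symmetric] sum_distrib_left algebra_simps power2_eq_square)
qed

lemma classical_C12: "classical T u \<Longrightarrow> C12_torus T u (dt T u)"
  unfolding classical_def par_holder_12_def by (auto intro: par_C_imp_C12_torus)

lemma grad_kinetic_hamiltonian: "grad (\<lambda>p :: real ^ 'd::finite. 1 / 2 * (norm p)\<^sup>2) p = p"
proof -
  have "((\<lambda>h. 1 / 2 * (norm (p + h *\<^sub>R axis l 1))\<^sup>2) has_real_derivative p $ l) (at 0)" for l
  proof -
    have "(norm (p + h *\<^sub>R axis l 1))\<^sup>2 = (norm p)\<^sup>2 + 2 * h * p $ l + h\<^sup>2" for h
      unfolding power2_norm_eq_inner
      by (simp add: inner_add_left inner_add_right inner_axis inner_axis' algebra_simps power2_eq_square)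
    then show ?thesis by (auto intro!: derivative_eq_intros)
  qed
  then have "pd l (\<lambda>p :: real ^ 'd. 1 / 2 * (norm p)\<^sup>2) p = p $ l" for l by (rule has_derivative_imp_pd(2))
  then show ?thesis unfolding grad_def by (simp only: vec_lambda_eta)
qed

lemma cont_Q_of_time_modulus:
  fixes u :: "real \<Rightarrow> real ^ 'd::finite \<Rightarrow> real"
  assumes c: "\<And>t. t \<in> {0..T} \<Longrightarrow> continuous_on UNIV (u t)" and \<beta>: "0 < \<beta>"
    and K: "\<And>s t x. s \<in> {0..T} \<Longrightarrow> t \<in> {0..T} \<Longrightarrow> \<bar>u s x - u t x\<bar> \<le> K * dist s t powr \<beta>"
  shows "cont_Q T u"
proof (rule cont_Q_of_modulus)
  fix t0 x0 assume t0: "t0 \<in> {0..T}"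
  define h where "h p = K * dist (fst p) t0 powr \<beta> + \<bar>u t0 (snd p) - u t0 x0\<bar>" for p
  have "continuous_on ({0..T} \<times> UNIV) (\<lambda>p. u t0 (snd p))"
    by (intro continuous_on_compose2[OF c[OF t0]] continuous_intros) auto
  then have "continuous_on ({0..T} \<times> UNIV) h"
    unfolding h_def using \<beta> by (intro continuous_intros continuous_on_powr') auto
  moreover have "h (t0, x0) = 0" using \<beta> by (simp add: h_def)
  moreover have "\<bar>u t x - u t0 x0\<bar> \<le> h (t, x)" if "t \<in> {0..T}" for t x
    using K[OF that t0, of x] unfolding h_def fst_conv snd_conv by linarith
  ultimately show "\<exists>h. continuous_on ({0..T} \<times> UNIV) h \<and> h (t0, x0) = 0
      \<and> (\<forall>t\<in>{0..T}. \<forall>x. \<bar>u t x - u t0 x0\<bar> \<le> h (t, x))" by blast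
qed

lemma cont_Q_bounded:
  fixes u :: "real \<Rightarrow> real ^ 'd::finite \<Rightarrow> real"
  assumes "cont_Q T u" "\<And>t. t \<in> {0..T} \<Longrightarrow> periodic (u t)"
  obtains B where "0 < B" "\<And>t x. t \<in> {0..T} \<Longrightarrow> \<bar>u t x\<bar> \<le> B"
  using assms periodic_bounded[of T u] unfolding cont_Q_def by metis

lemma density_path_bounded:
  assumes "density_path T m"
  obtains B where "0 < B" "\<And>t x. t \<in> {0..T} \<Longrightarrow> \<bar>m t x\<bar> \<le> B"
proof (rule cont_Q_bounded[of T m])
  show "cont_Q T m" using assms by (simp add: density_path_def)
  show "periodic (m t)" if "t \<in> {0..T}" for t using assms that by (simp add: density_path_def D0_def)
qed (use that in blast)

section \<open>The generalised conditional gradient iteration\<close>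

locale gcg = potential_coupling T f \<alpha>\<^sub>0 C0 C1 Lf F
  for T :: real and f :: "'d::finite coupling" and \<alpha>\<^sub>0 C0 C1 Lf :: real and F +
  fixes \<nu> C k1 k2 :: real and g m\<^sub>0 :: "real ^ 'd \<Rightarrow> real" and v :: "real \<Rightarrow> real ^ 'd \<Rightarrow> real ^ 'd"
    and ubar mbar mg :: "real \<Rightarrow> real ^ 'd \<Rightarrow> real" and mb \<phi> \<psi> :: "nat \<Rightarrow> real \<Rightarrow> real ^ 'd \<Rightarrow> real"
    and \<delta> :: "nat \<Rightarrow> real"
  assumes \<nu>: "0 < \<nu>" and tiv: "TIV \<alpha>\<^sub>0 g m\<^sub>0" and v: "\<And>l. par_holder_x1 \<alpha>\<^sub>0 T (\<lambda>t x. v t x $ l)"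
    and init: "initial_guess T \<nu> v m\<^sub>0 mg" and k2: "1 \<le> k2" and k1: "k2 \<le> k1"
    and \<delta>: "\<And>k. \<delta> k = k2 / (real k + k1)"
    and mfg: "MFG_solution T \<nu> (\<lambda>t x p. 1 / 2 * (norm p)\<^sup>2) f g m\<^sub>0 ubar mbar"
    and ch: "CH_GCG T \<nu> f g m\<^sub>0 \<delta> mg mb \<phi> \<psi>" and C: "0 < C"
    and smooth: "\<And>k. smooth_bound C T (\<phi> k)" "\<And>k. smooth_bound C T (\<psi> k)"
begin

lemma T0: "0 \<in> {0..T}" "T \<in> {0..T}" using T by auto

lemma step_size: "0 \<le> \<delta> k" "\<delta> k \<le> 1"
  using k1 k2 by (auto simp: \<delta> divide_simps)

lemma data_C1: "C1_torus g" "C1_torus m\<^sub>0" "\<And>x. 0 \<le> m\<^sub>0 x"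
proof -
  have "torus_C 2 g" "torus_C 2 m\<^sub>0" "m\<^sub>0 \<in> D0" using tiv by (auto simp: TIV_def torus_holder_def)
  then show "C1_torus g" "C1_torus m\<^sub>0" "\<And>x. 0 \<le> m\<^sub>0 x"
    using torus_C_imp_C1_torus[of 2 g "[]"] torus_C_imp_C1_torus[of 2 m\<^sub>0 "[]"] by (auto simp: D0_def)
qed

lemma data_bounded:
  obtains G M where "\<And>x. \<bar>g x\<bar> \<le> G" "\<And>x. \<bar>m\<^sub>0 x\<bar> \<le> M" "0 < M"
proof -
  obtain G where "\<And>x. \<bar>g x\<bar> \<le> G"
    using periodic_bounded[of T "\<lambda>t. g"] data_C1(1) cont_Q_space[of g T] T0 unfolding C1_torus_def cont_Q_def by metis
  moreover obtain M where "0 < M" "\<And>x. \<bar>m\<^sub>0 x\<bar> \<le> M"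
    using periodic_bounded[of T "\<lambda>t. m\<^sub>0"] data_C1(2) cont_Q_space[of m\<^sub>0 T] T0 unfolding C1_torus_def cont_Q_def by metis
  ultimately show ?thesis using that by blast
qed

definition g_bound :: real where "g_bound = (SOME G. \<forall>x. \<bar>g x\<bar> \<le> G)"

lemma g_bound: "\<bar>g x\<bar> \<le> g_bound"
  using data_bounded someI_ex[of "\<lambda>G. \<forall>x. \<bar>g x\<bar> \<le> G"] unfolding g_bound_def by metis

text \<open>A common lower bound of all the functions \<open>\<phi>\<close>, continuous and discrete; it keeps the quotient
  $m_0/\phi$ and the logarithm under control.\<close>

definition \<phi>_min :: real where "\<phi>_min = exp (- g_bound / (2 * \<nu>)) * exp (- C0 * T / (2 * \<nu>))"

lemma \<phi>_min_pos: "0 < \<phi>_min" by (simp add: \<phi>_min_def)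

lemma terminal_lower_bound: "exp (- g_bound / (2 * \<nu>)) \<le> exp (- g x / (2 * \<nu>))"
  using g_bound[of x] \<nu> by (auto simp: abs_le_iff divide_right_mono)

lemma coupling_in_bounds: "density_path T m \<Longrightarrow> t \<in> {0..T} \<Longrightarrow> 0 \<le> f t x (m t)" 
  "density_path T m \<Longrightarrow> t \<in> {0..T} \<Longrightarrow> f t x (m t) \<le> C0"
  using f_bound[of t "m t" x] unfolding density_path_def by auto

lemma backward_solution_ge_\<phi>_min:
  assumes "density_path T m" "backward_solution T \<nu> (\<lambda>t x. f t x (m t)) \<Phi> \<Phi>t" "\<And>x. \<Phi> T x = exp (- g x / (2 * \<nu>))" "t \<in> {0..T}"
  shows "\<phi>_min \<le> \<Phi> t x"
  unfolding \<phi>_min_def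
  by (rule backward_solution_lower_bound[OF \<nu> assms(2) coupling_in_bounds[OF assms(1)] _ _ assms(4)])
    (use assms(3) terminal_lower_bound in auto)

subsection \<open>The solution of the system\<close>

text \<open>The Hopf--Cole transform turns the Hamilton--Jacobi equation of the system into the linear backward
  equation that the iterates satisfy, so that both can be compared by the maximum principle.\<close>

definition phibar :: "real \<Rightarrow> real ^ 'd \<Rightarrow> real" where
  "phibar t x = exp (- 1 / (2 * \<nu>) * ubar t x)"

definition phibart :: "real \<Rightarrow> real ^ 'd \<Rightarrow> real" where
  "phibart t x = phibar t x * (- 1 / (2 * \<nu>) * dt T ubar t x)"

lemma mfgD:
  "C12_torus T ubar (dt T ubar)" "C12_torus T mbar (dt T mbar)" "t \<in> {0..T} \<Longrightarrow> 0 \<le> mbar t x"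
  "t \<in> {0<..<T} \<Longrightarrow> - dt T ubar t x - \<nu> * lap (ubar t) x + 1 / 2 * (norm (grad (ubar t) x))\<^sup>2 = f t x (mbar t)"
  "ubar T x = g x"
  "t \<in> {0<..<T} \<Longrightarrow> dt T mbar t x - \<nu> * lap (mbar t) x - div_x (\<lambda>y. mbar t y *\<^sub>R grad (ubar t) y) x = 0"
  "mbar 0 x = m\<^sub>0 x"
  using mfg unfolding MFG_solution_def grad_kinetic_hamiltonian by (auto intro: classical_C12)

lemma mbar_path: "density_path T mbar"
  by (rule C12_torus_density_path[OF mfgD(2,3)])

lemma phibar_pos: "0 < phibar t x" by (simp add: phibar_def)

lemma phibar_C12: "C12_torus T phibar phibart"
  using C12_torus_exp(1)[OF C12_torus_cmult(1)[OF mfgD(1), where c = "- 1 / (2 * \<nu>)"]]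
  unfolding phibar_def[abs_def] phibart_def[abs_def] .

lemma grad_cmult: "C1_torus w \<Longrightarrow> grad (\<lambda>x. c * w x) x = c *\<^sub>R grad w x"
  by (simp add: grad_def vec_eq_iff C1_torus_cmult(2))

lemma phibar_drift: "t \<in> {0..T} \<Longrightarrow> hc_drift \<nu> phibar t x = grad (ubar t) x"
  using C12_torus_exp(2)[OF C12_torus_cmult(1)[OF mfgD(1), where c = "- 1 / (2 * \<nu>)"], of t x] \<nu>
    grad_cmult[OF C12_torusD(1)[OF mfgD(1)], of t "- 1 / (2 * \<nu>)" x]
  unfolding hc_drift_def phibar_def[abs_def] by simp

lemma phibar_terminal: "phibar T x = exp (- g x / (2 * \<nu>))"
  by (simp add: phibar_def mfgD(5))

lemma phibar_solution: "backward_solution T \<nu> (\<lambda>t x. f t x (mbar t)) phibar phibart"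
  unfolding backward_solution_def
proof (intro conjI ballI allI)
  show "C12_torus T phibar phibart" by (rule phibar_C12)
  fix t x assume t: "t \<in> {0..T}"
  show "phibart t x + \<nu> * lap (phibar t) x = f t x (mbar t) * phibar t x / (2 * \<nu>)"
  proof (rule closed_interval_eq[OF T _ _ _ t, of "\<lambda>t. phibart t x + \<nu> * lap (phibar t) x"])
    show "continuous_on {0..T} (\<lambda>t. phibart t x + \<nu> * lap (phibar t) x)"
      by (intro continuous_intros cont_Q_track[OF C12_torusD(5)[OF phibar_C12]] cont_Q_track[OF C12_torus_lap[OF phibar_C12]])
    show "continuous_on {0..T} (\<lambda>t. f t x (mbar t) * phibar t x / (2 * \<nu>))"
      using \<nu> by (intro continuous_intros cont_Q_track[OF cont_Q_coupling[OF mbar_path]] cont_Q_track[OF C12_torusD(4)[OF phibar_C12]]) auto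
    fix t assume t0: "t \<in> {0<..<T}"
    then have t: "t \<in> {0..T}" by simp
    let ?c = "- 1 / (2 * \<nu>)"
    note u = C12_torus_cmult[OF mfgD(1), where c = ?c]
    have L: "lap (phibar t) x = phibar t x * (?c * lap (ubar t) x + ?c\<^sup>2 * (norm (grad (ubar t) x))\<^sup>2)"
      using C12_torus_exp(3)[OF u(1) t, of x] u(2)[OF t, of x] grad_cmult[OF C12_torusD(1)[OF mfgD(1) t], of ?c x]
      unfolding phibar_def[abs_def] by (simp add: power_mult_distrib power2_abs power_divide)
    show "phibart t x + \<nu> * lap (phibar t) x = f t x (mbar t) * phibar t x / (2 * \<nu>)"
      unfolding L phibart_def mfgD(4)[OF t0, of x, symmetric] using \<nu> by (simp add: field_simps power2_eq_square)
  qed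
qed

definition ebar :: "real \<Rightarrow> real ^ 'd \<Rightarrow> real" where
  "ebar t x = mbar t x * (norm (hc_drift \<nu> phibar t x))\<^sup>2 / 2"

lemma mbar_state: "fp_state T \<nu> m\<^sub>0 mbar (dt T mbar) (\<lambda>t x. mbar t x *\<^sub>R (- hc_drift \<nu> phibar t x)) ebar"
proof -
  have p: "C1_torus (\<lambda>x. (- hc_drift \<nu> phibar t x) $ l)" if t: "t \<in> {0..T}" for t l
    using C1_torus_cmult(1)[OF C12_torusD(2)[OF mfgD(1) t], of "- 1" l] by (simp add: phibar_drift[OF t] grad_def)
  have eq: "dt T mbar t x - \<nu> * lap (mbar t) x + div_x (\<lambda>y. mbar t y *\<^sub>R (- hc_drift \<nu> phibar t y)) x = 0"
    if t0: "t \<in> {0<..<T}" for t x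
  proof -
    have t: "t \<in> {0..T}" using t0 by simp
    have "C1_torus (\<lambda>y. mbar t y * pd l (ubar t) y)" for l
      by (intro C1_torus_mult C12_torusD(1)[OF mfgD(2) t] C12_torusD(2)[OF mfgD(1) t])
    from C1_torus_cmult(2)[OF this, where c = "- 1"]
    have "div_x (\<lambda>y. mbar t y *\<^sub>R (- hc_drift \<nu> phibar t y)) x = - div_x (\<lambda>y. mbar t y *\<^sub>R grad (ubar t) y) x"
      unfolding div_x_def sum_negf[symmetric] by (simp add: phibar_drift[OF t] grad_def)
    then show ?thesis using mfgD(6)[OF t0, of x] by simp
  qed
  have "fp_state T \<nu> m\<^sub>0 mbar (dt T mbar) (\<lambda>t x. mbar t x *\<^sub>R (- hc_drift \<nu> phibar t x))
      (\<lambda>t x. mbar t x * (norm (- hc_drift \<nu> phibar t x))\<^sup>2 / 2)"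
    by (rule fp_state_of_drift[OF mfgD(2,3,7) cont_Q_minus[OF cont_Q_hc_drift[OF phibar_C12 phibar_pos]] p eq])
  then show ?thesis by (simp add: ebar_def[abs_def])
qed

lemma mbar_optimal: "ebar t x + mbar t x *\<^sub>R (- hc_drift \<nu> phibar t x) \<bullet> hc_drift \<nu> phibar t x
    + mbar t x * (norm (hc_drift \<nu> phibar t x))\<^sup>2 / 2 = 0"
  by (simp add: ebar_def power2_norm_eq_inner)

subsection \<open>One continuous iteration\<close>

lemma chD:
  "t \<in> {0<..<T} \<Longrightarrow> dt T (\<phi> k) t x + \<nu> * lap (\<phi> k t) x = f t x (mb k t) * \<phi> k t x / (2 * \<nu>)"
  "\<phi> k T x = exp (- g x / (2 * \<nu>))"
  "t \<in> {0<..<T} \<Longrightarrow> dt T (\<psi> k) t x - \<nu> * lap (\<psi> k t) x = - (f t x (mb k t) * \<psi> k t x / (2 * \<nu>))"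
  "\<psi> k 0 x = m\<^sub>0 x / \<phi> k 0 x"
  "t \<in> {0..T} \<Longrightarrow> mb (Suc k) t x = (1 - \<delta> k) * mb k t x + \<delta> k * (\<phi> k t x * \<psi> k t x)"
  "t \<in> {0..T} \<Longrightarrow> mb 0 t x = mg t x"
  using ch unfolding CH_GCG_def by (auto simp: field_simps)

lemmas \<phi>_C12 = smooth_bound_C12[OF smooth(1)]
lemmas \<psi>_C12 = smooth_bound_C12[OF smooth(2)]

lemma \<phi>_solution:
  assumes "density_path T (mb k)"
  shows "backward_solution T \<nu> (\<lambda>t x. f t x (mb k t)) (\<phi> k) (dt T (\<phi> k))"
  unfolding backward_solution_def
proof (intro conjI ballI allI \<phi>_C12)
  fix t x assume t: "t \<in> {0..T}"
  show "dt T (\<phi> k) t x + \<nu> * lap (\<phi> k t) x = f t x (mb k t) * \<phi> k t x / (2 * \<nu>)"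
  proof (rule closed_interval_eq[OF T _ _ _ t, where g = "\<lambda>t. dt T (\<phi> k) t x + \<nu> * lap (\<phi> k t) x"])
    show "continuous_on {0..T} (\<lambda>t. dt T (\<phi> k) t x + \<nu> * lap (\<phi> k t) x)"
      by (intro continuous_intros cont_Q_track[OF C12_torusD(5)[OF \<phi>_C12]] cont_Q_track[OF C12_torus_lap[OF \<phi>_C12]])
    show "continuous_on {0..T} (\<lambda>t. f t x (mb k t) * \<phi> k t x / (2 * \<nu>))"
      using \<nu> by (intro continuous_intros cont_Q_track[OF cont_Q_coupling[OF assms]] cont_Q_track[OF C12_torusD(4)[OF \<phi>_C12]]) auto
  qed (rule chD(1))
qed

lemma \<psi>_solution:
  assumes "density_path T (mb k)" and t: "t \<in> {0..T}"
  shows "dt T (\<psi> k) t x - \<nu> * lap (\<psi> k t) x = - (f t x (mb k t) * \<psi> k t x / (2 * \<nu>))"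
proof (rule closed_interval_eq[OF T _ _ _ t, where g = "\<lambda>t. dt T (\<psi> k) t x - \<nu> * lap (\<psi> k t) x"])
  show "continuous_on {0..T} (\<lambda>t. dt T (\<psi> k) t x - \<nu> * lap (\<psi> k t) x)"
    by (intro continuous_intros cont_Q_track[OF C12_torusD(5)[OF \<psi>_C12]] cont_Q_track[OF C12_torus_lap[OF \<psi>_C12]])
  show "continuous_on {0..T} (\<lambda>t. - (f t x (mb k t) * \<psi> k t x / (2 * \<nu>)))"
    using \<nu> by (intro continuous_intros cont_Q_track[OF cont_Q_coupling[OF assms(1)]] cont_Q_track[OF C12_torusD(4)[OF \<psi>_C12]]) auto
qed (rule chD(3))

lemma \<phi>_ge_min: "density_path T (mb k) \<Longrightarrow> t \<in> {0..T} \<Longrightarrow> \<phi>_min \<le> \<phi> k t x"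
  by (rule backward_solution_ge_\<phi>_min[OF _ \<phi>_solution chD(2)])

lemma \<phi>_pos: "density_path T (mb k) \<Longrightarrow> t \<in> {0..T} \<Longrightarrow> 0 < \<phi> k t x"
  using \<phi>_ge_min \<phi>_min_pos less_le_trans by blast

lemma \<psi>_nonneg:
  assumes "density_path T (mb k)" "t \<in> {0..T}"
  shows "0 \<le> \<psi> k t x"
proof (rule forward_maximum_principle[OF less_imp_le[OF \<nu>] \<psi>_C12 _ _ _ assms(2), where c = "\<lambda>t x. f t x (mb k t) / (2 * \<nu>)"])
  show "0 \<le> f t x (mb k t) / (2 * \<nu>)" if "t \<in> {0..T}" for t x
    using coupling_in_bounds(1)[OF assms(1) that] \<nu> by simp
  show "0 \<le> dt T (\<psi> k) t x - \<nu> * lap (\<psi> k t) x + f t x (mb k t) / (2 * \<nu>) * \<psi> k t x" if "t \<in> {0..T}" for t x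
    unfolding \<psi>_solution[OF assms(1) that] by simp
  show "0 \<le> \<psi> k 0 x" for x using data_C1(3)[of x] \<phi>_pos[OF assms(1) T0(1), of x] by (simp add: chD(4))
qed

lemma product_bounds:
  assumes "density_path T (mb k)" "t \<in> {0..T}"
  shows "0 \<le> \<phi> k t x * \<psi> k t x" "\<phi> k t x * \<psi> k t x \<le> C * C"
  using \<phi>_pos[OF assms, of x] \<psi>_nonneg[OF assms, of x] smooth_bound_abs(1)[OF smooth(1)[of k] less_imp_le[OF T] assms(2), of x]
    smooth_bound_abs(1)[OF smooth(2)[of k] less_imp_le[OF T] assms(2), of x] C
  by (auto intro!: mult_mono)

lemma product_lipschitz:
  assumes "t \<in> {0..T}"
  shows "(real CARD('d) * (2 * C * C))-lipschitz_on UNIV (\<lambda>x. \<phi> k t x * \<psi> k t x)"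
proof (rule pd_bound_imp_lipschitz)
  note p = C1_torus_mult[OF C12_torusD(1)[OF \<phi>_C12[of k] assms] C12_torusD(1)[OF \<psi>_C12[of k] assms]]
  show "pd_exists l (\<lambda>x. \<phi> k t x * \<psi> k t x) x" for l x using C1_torusD(2)[OF p(1)] .
  show "\<bar>pd l (\<lambda>x. \<phi> k t x * \<psi> k t x) x\<bar> \<le> 2 * C * C" for l x
  proof -
    note b = smooth_bound_abs[OF smooth(1)[of k] less_imp_le[OF T] assms] smooth_bound_abs[OF smooth(2)[of k] less_imp_le[OF T] assms]
    have "\<bar>pd l (\<phi> k t) x * \<psi> k t x\<bar> \<le> C * C" "\<bar>\<phi> k t x * pd l (\<psi> k t) x\<bar> \<le> C * C"
      unfolding abs_mult using b C by (auto intro!: mult_mono)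
    then show ?thesis unfolding p(2) by linarith
  qed
qed

lemma product_path:
  assumes "density_path T (mb k)"
  shows "density_path T (\<lambda>t x. \<phi> k t x * \<psi> k t x)"
proof -
  have "cont_Q T (\<lambda>t x. \<phi> k t x * \<psi> k t x)" by (intro cont_Q_mult C12_torusD(4)[OF \<phi>_C12] C12_torusD(4)[OF \<psi>_C12])
  moreover have "(\<lambda>x. \<phi> k t x * \<psi> k t x) \<in> D0" if "t \<in> {0..T}" for t
    using C1_torusD(1,3)[OF C1_torus_mult(1)[OF C12_torusD(1)[OF \<phi>_C12[of k] that] C12_torusD(1)[OF \<psi>_C12[of k] that]]]
      product_bounds(1)[OF assms that] by (simp add: D0_def)
  moreover have "0 < real CARD('d) * (2 * C * C)" using C by simp
  ultimately show ?thesis unfolding density_path_def using product_lipschitz by blast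
qed

lemma initial_guess_state:
  shows "density_path T (mb 0)"
    "fp_state T \<nu> m\<^sub>0 mg (dt T mg) (\<lambda>t x. mg t x *\<^sub>R v t x) (\<lambda>t x. mg t x * (norm (v t x))\<^sup>2 / 2)"
proof -
  have mg: "C12_torus T mg (dt T mg)" "\<And>t x. t \<in> {0..T} \<Longrightarrow> 0 \<le> mg t x" "\<And>x. mg 0 x = m\<^sub>0 x"
    "\<And>t x. t \<in> {0<..<T} \<Longrightarrow> dt T mg t x - \<nu> * lap (mg t) x + div_x (\<lambda>y. mg t y *\<^sub>R v t y) x = 0"
    using init unfolding initial_guess_def by (auto intro: classical_C12)
  have "density_path T mg" by (rule C12_torus_density_path[OF mg(1,2)])
  then show "density_path T (mb 0)"
    by (rule density_path_combine[OF _ \<open>density_path T mg\<close>, where a = 1 and b = 0]) (simp_all add: chD(6))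
  have vC: "C1_torus (\<lambda>x. v t x $ l)" if "t \<in> {0..T}" for t l
    using v[of l] that torus_C_imp_C1_torus[of 1 "\<lambda>x. v t x $ l" "[]"] unfolding par_holder_x1_def by auto
  have "cont_Q T (\<lambda>t x. v t x $ l)" for l
  proof -
    obtain K where "\<And>s t x. s \<in> {0..T} \<Longrightarrow> t \<in> {0..T} \<Longrightarrow> \<bar>v s x $ l - v t x $ l\<bar> \<le> K * dist s t powr (\<alpha>\<^sub>0 / 2)"
      using v[of l] unfolding par_holder_x1_def by blast
    then show ?thesis
      by (intro cont_Q_of_time_modulus[where \<beta> = "\<alpha>\<^sub>0 / 2" and K = K]) (use C1_torusD(3)[OF vC] \<alpha> in auto)
  qed
  from cont_Q_vec_lambda[where g = "\<lambda>l t x. v t x $ l", OF this] have cv: "cont_Q T v" by (simp add: vec_lambda_eta)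
  show "fp_state T \<nu> m\<^sub>0 mg (dt T mg) (\<lambda>t x. mg t x *\<^sub>R v t x) (\<lambda>t x. mg t x * (norm (v t x))\<^sup>2 / 2)"
    by (rule fp_state_of_drift[OF mg(1-3) cv vC mg(4)])
qed

text \<open>Nonnegativity, which the coupling requires of its argument, passes from the averaged density to the
  factors by the maximum principle and back by averaging.\<close>

lemma mb_path: "density_path T (mb k)"
proof (induction k)
  case 0
  then show ?case by (rule initial_guess_state(1))
next
  case (Suc k)
  show ?case
    by (rule density_path_combine[OF Suc product_path[OF Suc] _ _ chD(5)]) (use step_size in auto)
qed

text \<open>The kinetic energy densities are averaged like the densities. The result is an upper bound for the
  kinetic energy of the averaged momentum.\<close>

primrec kinetic :: "nat \<Rightarrow> real \<Rightarrow> real ^ 'd \<Rightarrow> real" where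
  "kinetic 0 = (\<lambda>t x. mg t x * (norm (v t x))\<^sup>2 / 2)"
| "kinetic (Suc k) = (\<lambda>t x. (1 - \<delta> k) * kinetic k t x
    + \<delta> k * (2 * \<nu>\<^sup>2 * \<psi> k t x * (norm (grad (\<phi> k t) x))\<^sup>2 / \<phi> k t x))"

lemma product_state: "fp_state T \<nu> m\<^sub>0 (\<lambda>t x. \<phi> k t x * \<psi> k t x) (\<lambda>t x. dt T (\<phi> k) t x * \<psi> k t x + \<phi> k t x * dt T (\<psi> k) t x)
    (\<lambda>t x. (2 * \<nu> * \<psi> k t x) *\<^sub>R grad (\<phi> k t) x) (\<lambda>t x. 2 * \<nu>\<^sup>2 * \<psi> k t x * (norm (grad (\<phi> k t) x))\<^sup>2 / \<phi> k t x)"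
proof (rule fp_state_of_factors[OF \<nu> \<phi>_solution[OF mb_path] \<phi>_pos[OF mb_path] \<psi>_C12 \<psi>_nonneg[OF mb_path] \<psi>_solution[OF mb_path]])
  show "\<phi> k 0 x * \<psi> k 0 x = m\<^sub>0 x" for x using \<phi>_pos[OF mb_path T0(1), of k x] by (simp add: chD(4))
qed

lemma mb_state: "\<exists>mt Q. fp_state T \<nu> m\<^sub>0 (mb k) mt Q (kinetic k)"
proof (induction k)
  case 0
  have "fp_state T \<nu> m\<^sub>0 (mb 0) (\<lambda>t x. (1 - 0) * dt T mg t x + 0 * dt T mg t x)
      (\<lambda>t x. (1 - 0) *\<^sub>R (mg t x *\<^sub>R v t x) + 0 *\<^sub>R (mg t x *\<^sub>R v t x))
      (\<lambda>t x. (1 - 0) * (mg t x * (norm (v t x))\<^sup>2 / 2) + 0 * (mg t x * (norm (v t x))\<^sup>2 / 2))"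
    by (rule fp_state_combine[OF initial_guess_state(2) initial_guess_state(2)]) (use T in \<open>auto simp: chD(6)\<close>)
  then show ?case by auto
next
  case (Suc k)
  then obtain mt Q where S: "fp_state T \<nu> m\<^sub>0 (mb k) mt Q (kinetic k)" by blast
  show ?case
    using fp_state_combine[OF S product_state step_size less_imp_le[OF T] chD(5)] by auto
qed

subsection \<open>Convergence of the continuous iteration\<close>

text \<open>The bounds are uniform in \<open>k\<close> because convex combinations preserve them.\<close>

lemma mb_bounds:
  obtains A R where "0 < A" "0 < R" "C * C \<le> A" "\<And>k t x. t \<in> {0..T} \<Longrightarrow> 0 \<le> mb k t x" "\<And>k t x. t \<in> {0..T} \<Longrightarrow> mb k t x \<le> A"
    "\<And>k t. t \<in> {0..T} \<Longrightarrow> R-lipschitz_on UNIV (mb k t)"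
proof -
  obtain R0 where R0: "0 < R0" "\<And>t. t \<in> {0..T} \<Longrightarrow> R0-lipschitz_on UNIV (mb 0 t)"
    using mb_path[of 0] unfolding density_path_def by blast
  obtain A0 where A0: "\<And>t x. t \<in> {0..T} \<Longrightarrow> \<bar>mb 0 t x\<bar> \<le> A0"
    using density_path_bounded[OF mb_path] by metis
  define A where "A = max A0 (C * C)"
  define R where "R = max R0 (real CARD('d) * (2 * C * C))"
  have nn: "0 \<le> mb k t x" if "t \<in> {0..T}" for k t x
    using mb_path[of k] that by (auto simp: density_path_def D0_def)
  have A: "mb k t x \<le> A" if t: "t \<in> {0..T}" for k t x
  proof (induction k)
    case 0
    then show ?case using A0[OF t, of x] by (simp add: A_def)
  next
    case (Suc k)
    have "\<phi> k t x * \<psi> k t x \<le> A" using product_bounds(2)[OF mb_path t, of k x] by (simp add: A_def)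
    with Suc have "(1 - \<delta> k) * mb k t x + \<delta> k * (\<phi> k t x * \<psi> k t x) \<le> (1 - \<delta> k) * A + \<delta> k * A"
      using step_size[of k] by (intro add_mono mult_left_mono) auto
    then show ?case unfolding chD(5)[OF t] by (simp add: algebra_simps)
  qed
  have L: "R-lipschitz_on UNIV (mb k t)" if t: "t \<in> {0..T}" for k t
  proof (induction k)
    case 0
    then show ?case by (rule lipschitz_on_mono[OF R0(2)[OF t]]) (auto simp: R_def)
  next
    case (Suc k)
    have "R-lipschitz_on UNIV (\<lambda>x. \<phi> k t x * \<psi> k t x)"
      by (rule lipschitz_on_mono[OF product_lipschitz[OF t]]) (auto simp: R_def)
    from lipschitz_combine[OF Suc this, of "1 - \<delta> k" "\<delta> k"]
    have "R-lipschitz_on UNIV (\<lambda>x. (1 - \<delta> k) * mb k t x + \<delta> k * (\<phi> k t x * \<psi> k t x))"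
      using step_size[of k] by (simp add: algebra_simps)
    moreover have "mb (Suc k) t = (\<lambda>x. (1 - \<delta> k) * mb k t x + \<delta> k * (\<phi> k t x * \<psi> k t x))"
      by (rule ext) (rule chD(5)[OF t])
    ultimately show ?case by simp
  qed
  have "0 < C * C" using C by simp
  then show ?thesis using that[of A R] R0(1) nn A L by (auto simp: A_def R_def)
qed

definition energy_gap :: "nat \<Rightarrow> real" where
  "energy_gap k = energy g (mb k) (kinetic k) - energy g mbar ebar"

lemma energy_gap_lower:
  assumes "fp_state T \<nu> m\<^sub>0 (mb k) mt Q (kinetic k)"
  shows "cyl_int T (\<lambda>t x. kinetic k t x + Q t x \<bullet> hc_drift \<nu> phibar t x + mb k t x * (norm (hc_drift \<nu> phibar t x))\<^sup>2 / 2)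
    \<le> energy_gap k"
  unfolding energy_gap_def
  by (rule energy_gap_lower_bound[OF \<nu> mb_path mbar_path assms mbar_state phibar_solution phibar_pos phibar_terminal mbar_optimal])

lemma energy_gap_nonneg: "0 \<le> energy_gap k"
proof -
  obtain mt Q where S: "fp_state T \<nu> m\<^sub>0 (mb k) mt Q (kinetic k)" using mb_state by blast
  have "0 \<le> cyl_int T (\<lambda>t x. kinetic k t x + Q t x \<bullet> hc_drift \<nu> phibar t x + mb k t x * (norm (hc_drift \<nu> phibar t x))\<^sup>2 / 2)"
    by (rule cyl_int_nonneg) (rule fp_stateD(9)[OF S])
  then show ?thesis using energy_gap_lower[OF S] by linarith
qed

lemma product_optimal:
  assumes "t \<in> {0..T}"
  shows "2 * \<nu>\<^sup>2 * \<psi> k t x * (norm (grad (\<phi> k t) x))\<^sup>2 / \<phi> k t x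
    + (2 * \<nu> * \<psi> k t x) *\<^sub>R grad (\<phi> k t) x \<bullet> hc_drift \<nu> (\<phi> k) t x
    + \<phi> k t x * \<psi> k t x * (norm (hc_drift \<nu> (\<phi> k) t x))\<^sup>2 / 2 = 0"
proof -
  have N: "(norm (hc_drift \<nu> (\<phi> k) t x))\<^sup>2 = 4 * \<nu>\<^sup>2 * (norm (grad (\<phi> k t) x))\<^sup>2 / (\<phi> k t x)\<^sup>2"
    by (simp add: hc_drift_def power_mult_distrib power_divide power2_abs)
  have I: "(2 * \<nu> * \<psi> k t x) *\<^sub>R grad (\<phi> k t) x \<bullet> hc_drift \<nu> (\<phi> k) t x = - 4 * \<nu>\<^sup>2 * \<psi> k t x * (norm (grad (\<phi> k t) x))\<^sup>2 / \<phi> k t x"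
  proof -
    have "grad (\<phi> k t) x \<bullet> grad (\<phi> k t) x = (norm (grad (\<phi> k t) x))\<^sup>2" by (simp add: power2_norm_eq_inner)
    then show ?thesis by (simp add: hc_drift_def power2_eq_square[of \<nu>])
  qed
  show ?thesis unfolding N I using \<phi>_pos[OF mb_path assms, of k x] by (simp add: field_simps power2_eq_square)
qed

lemma energy_gap_rate:
  obtains B where "0 < B" "\<And>k. energy_gap k \<le> B / sqrt (real k + k1)"
proof -
  obtain A R where A: "0 < A" "C * C \<le> A" "\<And>k t x. t \<in> {0..T} \<Longrightarrow> 0 \<le> mb k t x" "\<And>k t x. t \<in> {0..T} \<Longrightarrow> mb k t x \<le> A"
    using mb_bounds by metis
  have step: "energy_gap (Suc k) \<le> (1 - k2 / (real k + k1)) * energy_gap k + Lf * T * A\<^sup>2 * (k2 / (real k + k1))\<^sup>2" for k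
  proof -
    have "energy g (mb (Suc k)) (\<lambda>t x. (1 - \<delta> k) * kinetic k t x
          + \<delta> k * (2 * \<nu>\<^sup>2 * \<psi> k t x * (norm (grad (\<phi> k t) x))\<^sup>2 / \<phi> k t x)) - energy g mbar ebar
        \<le> (1 - \<delta> k) * (energy g (mb k) (kinetic k) - energy g mbar ebar) + Lf * T * A\<^sup>2 * (\<delta> k)\<^sup>2"
    proof (rule energy_descent[OF \<nu> mb_path product_path[OF mb_path] mbar_path _ product_state mbar_state \<phi>_solution[OF mb_path]])
      show "cont_Q T (kinetic k)" using mb_state[of k] fp_stateD(6) by blast
      show "\<bar>\<phi> k t x * \<psi> k t x - mb k t x\<bar> \<le> A" if "t \<in> {0..T}" for t x
        using product_bounds[OF mb_path that, of k x] A(2) A(3,4)[OF that, of k x] by linarith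
    qed (simp_all only: chD(2) chD(5) product_optimal step_size C1_torusD(3)[OF data_C1(1)] \<phi>_pos[OF mb_path])
    then show ?thesis by (simp add: energy_gap_def \<delta>)
  qed
  have "0 \<le> Lf * T * A\<^sup>2" using Lf T by simp
  from step_size_recursion[OF k2 k1 this energy_gap_nonneg step] that show ?thesis by blast
qed

text \<open>One half comes from the decay of the energy gap, the factor $1/(d+2)$ from the passage from the mean
  square to the maximum.\<close>

definition rate :: real where "rate = 1 / (2 * (real CARD('d) + 2))"

lemma density_rate:
  obtains B where "0 < B" "\<And>k t x. t \<in> {0..T} \<Longrightarrow> \<bar>mb k t x - mbar t x\<bar> \<le> B / (real k + k1) powr rate"
proof -
  obtain A R where A: "0 < A" "0 < R" "\<And>k t x. t \<in> {0..T} \<Longrightarrow> 0 \<le> mb k t x" "\<And>k t x. t \<in> {0..T} \<Longrightarrow> mb k t x \<le> A"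
    "\<And>k t. t \<in> {0..T} \<Longrightarrow> R-lipschitz_on UNIV (mb k t)" using mb_bounds by metis
  obtain R' where R': "0 < R'" "\<And>t. t \<in> {0..T} \<Longrightarrow> R'-lipschitz_on UNIV (mbar t)"
    using mbar_path unfolding density_path_def by blast
  obtain A' where A': "0 < A'" "\<And>t x. t \<in> {0..T} \<Longrightarrow> \<bar>mbar t x\<bar> \<le> A'"
    using density_path_bounded[OF mbar_path] by metis
  obtain V where V: "\<And>t x. t \<in> {0..T} \<Longrightarrow> norm (hc_drift \<nu> phibar t x) \<le> V"
  proof -
    have "periodic (\<lambda>x. norm (grad (ubar t) x))" if "t \<in> {0..T}" for t
      using C1_torusD(1)[OF C12_torusD(2)[OF mfgD(1) that]] by (simp add: periodic_def grad_def)
    then obtain V where "\<And>t x. t \<in> {0..T} \<Longrightarrow> \<bar>norm (grad (ubar t) x)\<bar> \<le> V"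
      using cont_Q_bounded[OF cont_Q_norm[OF C12_torus_grad[OF mfgD(1)]]] by metis
    then show thesis using that[of V] phibar_drift by simp
  qed
  obtain B where B: "0 < B" "\<And>k. energy_gap k \<le> B / sqrt (real k + k1)" by (rule energy_gap_rate) blast
  define N where "N = CARD('d) + 2"
  define c where "c = 2 * A / \<nu> * exp (V\<^sup>2 / \<nu> * T)"
  define c' where "c' = 4 * (2 * ((R + R') + (A + A')) * real CARD('d)) ^ CARD('d)"
  have c: "0 < c" "0 < c'" using A A' R' \<nu> by (auto simp: c_def c'_def)
  define Z where "Z = c' * (c * B)"
  have Z: "0 < Z" using c B by (simp add: Z_def)
  have cube: "\<bar>mb k t x - mbar t x\<bar> \<le> Z powr (1 / real N) / (real k + k1) powr rate" if t: "t \<in> {0..T}" and x: "x \<in> cbox 0 1" for k t x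
  proof -
    have k: "0 < real k + k1" using k1 k2 by simp
    obtain mt Q where S: "fp_state T \<nu> m\<^sub>0 (mb k) mt Q (kinetic k)" using mb_state by blast
    have "torus_int (\<lambda>x. (mb k t x - mbar t x)\<^sup>2) \<le> c * cyl_int T (\<lambda>t x. kinetic k t x + Q t x \<bullet> hc_drift \<nu> phibar t x
        + mb k t x * (norm (hc_drift \<nu> phibar t x))\<^sup>2 / 2)"
      unfolding c_def
      by (rule fp_energy_estimate[OF T \<nu> S mbar_state cont_Q_hc_drift[OF phibar_C12 phibar_pos] V A(1) A(4) t])
    also have "\<dots> \<le> c * energy_gap k" using energy_gap_lower[OF S] c by (intro mult_left_mono) auto
    also have "\<dots> \<le> c * (B / sqrt (real k + k1))" using B(2) c by (intro mult_left_mono) auto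
    finally have L2: "torus_int (\<lambda>x. (mb k t x - mbar t x)\<^sup>2) \<le> c * (B / sqrt (real k + k1))" .
    have "(\<bar>1\<bar> * R + \<bar>- 1\<bar> * R')-lipschitz_on UNIV (\<lambda>x. 1 * mb k t x + (- 1) * mbar t x)"
      by (rule lipschitz_combine[OF A(5)[OF t] R'(2)[OF t]])
    then have "(R + R')-lipschitz_on UNIV (\<lambda>x. mb k t x - mbar t x)" by simp
    moreover have "\<bar>mb k t x - mbar t x\<bar> \<le> A + A'" for x using A(3,4)[OF t, of k x] A'(2)[OF t, of x] by linarith
    ultimately have "\<bar>mb k t x - mbar t x\<bar> ^ N \<le> c' * torus_int (\<lambda>x. (mb k t x - mbar t x)\<^sup>2)"
      unfolding N_def c'_def using A R' by (intro lipschitz_max_le_mean_square x) auto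
    also have "\<dots> \<le> c' * (c * (B / sqrt (real k + k1)))" using L2 c by (intro mult_left_mono) auto
    also have "\<dots> = Z / sqrt (real k + k1)" by (simp add: Z_def)
    finally have pw: "\<bar>mb k t x - mbar t x\<bar> ^ N \<le> Z / sqrt (real k + k1)" .
    show ?thesis
    proof (cases "mb k t x = mbar t x")
      case False
      define a where "a = \<bar>mb k t x - mbar t x\<bar>"
      have a: "0 < a" using False by (simp add: a_def)
      have N: "0 < N" by (simp add: N_def)
      have "a = (a ^ N) powr (1 / real N)" using a N by (simp add: powr_realpow[symmetric] powr_powr)
      also have "\<dots> \<le> (Z / sqrt (real k + k1)) powr (1 / real N)"
        using pw a by (intro powr_mono2) (auto simp: a_def)
      also have "\<dots> = Z powr (1 / real N) / (real k + k1) powr rate"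
        using Z k by (simp add: powr_divide powr_half_sqrt[symmetric] powr_powr rate_def N_def algebra_simps)
      finally show ?thesis by (simp add: a_def)
    qed simp
  qed
  have "\<bar>mb k t x - mbar t x\<bar> \<le> Z powr (1 / real N) / (real k + k1) powr rate" if t: "t \<in> {0..T}" for k t x
  proof -
    obtain y where y: "y \<in> cbox 0 1" "\<And>w :: real ^ 'd \<Rightarrow> real. periodic w \<Longrightarrow> w x = w y"
      using unit_cube_representative[of x] by blast
    have "periodic (mb k t)" "periodic (mbar t)" using mb_path[of k] mbar_path t by (auto simp: density_path_def D0_def)
    then show ?thesis using cube[OF t y(1), of k] y(2)[of "mb k t"] y(2)[of "mbar t"] by simp
  qed
  then show ?thesis using that[of "Z powr (1 / real N)"] Z by simp
qed

lemma phibar_bounded: obtains B where "0 < B" "\<And>t x. t \<in> {0..T} \<Longrightarrow> \<bar>phibar t x\<bar> \<le> B"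
  using cont_Q_bounded[OF C12_torusD(4)[OF phibar_C12] C1_torusD(1)[OF C12_torusD(1)[OF phibar_C12]]] by metis

lemma \<phi>_rate:
  obtains B where "0 < B" "\<And>k t x. t \<in> {0..T} \<Longrightarrow> \<bar>\<phi> k t x - phibar t x\<bar> \<le> B / (real k + k1) powr rate"
proof -
  obtain B where B: "0 < B" "\<And>k t x. t \<in> {0..T} \<Longrightarrow> \<bar>mb k t x - mbar t x\<bar> \<le> B / (real k + k1) powr rate"
    by (rule density_rate) blast
  obtain P where P: "0 < P" "\<And>t x. t \<in> {0..T} \<Longrightarrow> \<bar>phibar t x\<bar> \<le> P" by (rule phibar_bounded) blast
  have "\<bar>\<phi> k t x - phibar t x\<bar> \<le> T * (Lf * (B / (real k + k1) powr rate) * P / (2 * \<nu>))" if "t \<in> {0..T}" for k t x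
  proof (rule backward_solution_stability[OF \<nu> \<phi>_solution[OF mb_path] phibar_solution coupling_in_bounds(1)[OF mb_path] _ P(2) _ that])
    show "\<phi> k T x = phibar T x" for x using chD(2)[of k x] phibar_terminal[of x] by metis
    fix t x assume t: "t \<in> {0..T}"
    have "\<bar>f t x (mb k t) - f t x (mbar t)\<bar> \<le> Lf * \<bar>mb k t x - mbar t x\<bar>"
      using f_density[OF t, of "mbar t" "mb k t" x] mb_path[of k] mbar_path t by (auto simp: density_path_def)
    also have "\<dots> \<le> Lf * (B / (real k + k1) powr rate)" using B(2)[OF t] Lf by (intro mult_left_mono) auto
    finally show "\<bar>f t x (mb k t) - f t x (mbar t)\<bar> \<le> Lf * (B / (real k + k1) powr rate)" .
  qed
  then show ?thesis using that[of "T * (Lf * B * P / (2 * \<nu>))"] T Lf B(1) P(1) \<nu> by (simp add: mult_ac)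
qed

end

section \<open>Convergence of the discrete iteration\<close>

lemma ln_difference_bound:
  fixes a b c :: real
  assumes "0 < c" "c \<le> a" "c \<le> b"
  shows "\<bar>ln a - ln b\<bar> \<le> \<bar>a - b\<bar> / c"
proof -
  have one: "ln x - ln y \<le> \<bar>x - y\<bar> / c" if "c \<le> x" "c \<le> y" for x y
  proof -
    have "ln x - ln y = ln (x / y)" using that assms(1) by (simp add: ln_div)
    also have "\<dots> \<le> x / y - 1" using that assms(1) by (intro ln_le_minus_one) auto
    also have "\<dots> = (x - y) / y" using that assms(1) by (simp add: field_simps)
    also have "\<dots> \<le> \<bar>x - y\<bar> / y" using that assms(1) by (intro divide_right_mono) auto
    also have "\<dots> \<le> \<bar>x - y\<bar> / c" using that assms(1) by (intro divide_left_mono) auto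
    finally show ?thesis .
  qed
  have "ln b - ln a \<le> \<bar>a - b\<bar> / c" using one[OF assms(3,2)] by (simp only: abs_minus_commute)
  then show ?thesis using one[OF assms(2,3)] by (intro abs_leI) simp_all
qed

lemma err_I_le:
  assumes "0 < T" "0 < Nt" "0 < Nx" "0 \<le> X"
    and "\<And>n i. n \<le> Nt \<Longrightarrow> i \<in> grid Nx \<Longrightarrow> \<bar>\<Phi> n i - \<psi> (grid_t T Nt n) (grid_x Nx i)\<bar> \<le> X"
  shows "err_I T Nt Nx \<Phi> \<psi> \<le> sqrt T * X"
proof -
  have "(Max ((\<lambda>i. \<bar>\<Phi> n i - \<psi> (grid_t T Nt n) (grid_x Nx i)\<bar>) ` grid Nx))\<^sup>2 * (T / real Nt) \<le> X\<^sup>2 * (T / real Nt)"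
    if n: "n < Nt" for n
  proof (intro mult_right_mono power_mono)
    let ?S = "(\<lambda>i. \<bar>\<Phi> n i - \<psi> (grid_t T Nt n) (grid_x Nx i)\<bar>) ` grid Nx"
    have S: "finite ?S" "?S \<noteq> {}" using finite_grid grid_nonempty[OF assms(3)] by auto
    show "Max ?S \<le> X" using S assms(5)[of n] n by (subst Max_le_iff) auto
    have "Max ?S \<in> ?S" by (rule Max_in[OF S])
    then show "0 \<le> Max ?S" by auto
  qed (use assms in auto)
  then have "(\<Sum>n<Nt. (Max ((\<lambda>i. \<bar>\<Phi> n i - \<psi> (grid_t T Nt n) (grid_x Nx i)\<bar>) ` grid Nx))\<^sup>2 * (T / real Nt))
      \<le> (\<Sum>n<Nt. X\<^sup>2 * (T / real Nt))" by (intro sum_mono) auto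
  also have "\<dots> = T * X\<^sup>2" using assms by simp
  finally have "err_I T Nt Nx \<Phi> \<psi> \<le> sqrt (T * X\<^sup>2)" unfolding err_I_def by (rule real_sqrt_le_mono)
  then show ?thesis using assms by (simp add: real_sqrt_mult)
qed

lemma err_E_le:
  assumes "0 < Nx"
    and "\<And>n i. n \<le> Nt \<Longrightarrow> i \<in> grid Nx \<Longrightarrow> \<bar>\<Phi> n i - \<psi> (grid_t T Nt n) (grid_x Nx i)\<bar> \<le> X"
  shows "err_E T Nt Nx \<Phi> \<psi> \<le> X"
  unfolding err_E_def
proof (subst Max_le_iff)
  show "finite ((\<lambda>(n, i). \<bar>\<Phi> n i - \<psi> (grid_t T Nt n) (grid_x Nx i)\<bar>) ` ({0..Nt} \<times> grid Nx))"
    using finite_grid by auto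
  show "(\<lambda>(n, i). \<bar>\<Phi> n i - \<psi> (grid_t T Nt n) (grid_x Nx i)\<bar>) ` ({0..Nt} \<times> grid Nx) \<noteq> {}"
    using grid_nonempty[OF assms(1)] by auto
qed (use assms(2) in auto)

lemma log_poly_growth_power:
  fixes b :: real
  assumes "0 < b" "1 \<le> (P :: nat)"
  shows "log_poly_growth (\<lambda>k. b * real (Suc k) ^ P)"
  unfolding log_poly_growth_def
proof (rule exI[of _ b], rule conjI[OF assms(1)], rule exI[of _ "b * 2 ^ P"], rule conjI, use assms in simp,
    rule exI[of _ "real P"], rule conjI, use assms in simp, rule eventually_sequentiallyI[of 1], rule conjI)
  fix k :: nat assume k: "1 \<le> k"
  have "ln (real k) \<le> real k" using ln_le_minus_one[of "real k"] k by simp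
  also have "\<dots> \<le> real (Suc k) ^ 1" by simp
  also have "\<dots> \<le> real (Suc k) ^ P" using assms(2) by (intro power_increasing) auto
  finally show "b * ln (real k) \<le> b * real (Suc k) ^ P" using assms(1) by (intro mult_left_mono) auto
  have "real (Suc k) ^ P \<le> (2 * real k) ^ P" using k by (intro power_mono) auto
  also have "\<dots> = 2 ^ P * real k powr real P" using k by (simp add: power_mult_distrib powr_realpow)
  finally show "b * real (Suc k) ^ P \<le> b * 2 ^ P * real k powr real P" using assms(1) by simp
qed

context gcg
begin

definition m0_bound :: real where "m0_bound = (SOME M. 0 < M \<and> (\<forall>x. \<bar>m\<^sub>0 x\<bar> \<le> M))"

lemma m0_bound: "0 < m0_bound" "\<bar>m\<^sub>0 x\<bar> \<le> m0_bound"
proof -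
  have "\<exists>M. 0 < M \<and> (\<forall>x. \<bar>m\<^sub>0 x\<bar> \<le> M)" using data_bounded by metis
  from someI_ex[OF this] show "0 < m0_bound" "\<bar>m\<^sub>0 x\<bar> \<le> m0_bound" unfolding m0_bound_def by auto
qed

text \<open>The constants by which one iteration amplifies the error of the averaged density, first in the
  function \<open>\<phi>\<close> and then in the product of the factors.\<close>

definition phi_amplification :: real where
  "phi_amplification = T * (Lf * C / (2 * \<nu>) + (C + \<nu> * real CARD('d) * C + C0 * C / (2 * \<nu>)))"

definition density_amplification :: real where
  "density_amplification = C * (phi_amplification + (m0_bound * phi_amplification / (\<phi>_min * \<phi>_min) + phi_amplification))"

lemma C0_nonneg: "0 \<le> C0"
  using coupling_in_bounds[OF mb_path T0(1), of 0 0] by linarith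

lemma phi_amplification_pos: "0 < phi_amplification"
proof -
  have "0 < Lf * C / (2 * \<nu>)" "0 < C + \<nu> * real CARD('d) * C" "0 \<le> C0 * C / (2 * \<nu>)"
    using Lf C \<nu> C0_nonneg by (auto intro!: add_pos_pos)
  then show ?thesis unfolding phi_amplification_def using T by (intro mult_pos_pos) auto
qed

lemma density_amplification_pos: "0 < density_amplification"
  unfolding density_amplification_def using C phi_amplification_pos m0_bound(1) \<phi>_min_pos by (intro mult_pos_pos add_pos_pos divide_pos_pos) auto

lemma discreteD:
  assumes "discrete_GCG T \<nu> f g m\<^sub>0 \<delta> mg Nt Nx Mb M \<Gamma> \<Phi> \<Psi>" "i \<in> grid Nx"
  shows "n \<le> Nt \<Longrightarrow> Mb 0 n i = mg (grid_t T Nt n) (grid_x Nx i)"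
    "n \<le> Nt \<Longrightarrow> \<Gamma> k n i = f (grid_t T Nt n) (grid_x Nx i) (piecewise_const Nx (Mb k n))"
    "n < Nt \<Longrightarrow> (\<Phi> k (Suc n) i - \<Phi> k n i) / (T / real Nt) + \<nu> * D2 Nx (\<Phi> k) (Suc n) i = \<Gamma> k (Suc n) i * \<Phi> k n i / (2 * \<nu>)"
    "\<Phi> k Nt i = exp (- g (grid_x Nx i) / (2 * \<nu>))"
    "n < Nt \<Longrightarrow> (\<Psi> k (Suc n) i - \<Psi> k n i) / (T / real Nt) - \<nu> * D2 Nx (\<Psi> k) n i = - (\<Gamma> k n i * \<Psi> k (Suc n) i / (2 * \<nu>))"
    "\<Psi> k 0 i = m\<^sub>0 (grid_x Nx i) / \<Phi> k 0 i"
    "n \<le> Nt \<Longrightarrow> M k n i = \<Phi> k n i * \<Psi> k n i"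
    "n \<le> Nt \<Longrightarrow> Mb (Suc k) n i = (1 - \<delta> k) * Mb k n i + \<delta> k * M k n i"
proof -
  note D = assms(1)[unfolded discrete_GCG_def]
  show "n \<le> Nt \<Longrightarrow> Mb 0 n i = mg (grid_t T Nt n) (grid_x Nx i)" using D assms(2) by blast
  note E = D[THEN conjunct2, rule_format, OF assms(2), of k]
  show "n \<le> Nt \<Longrightarrow> \<Gamma> k n i = f (grid_t T Nt n) (grid_x Nx i) (piecewise_const Nx (Mb k n))" using E by blast
  show "n < Nt \<Longrightarrow> (\<Phi> k (Suc n) i - \<Phi> k n i) / (T / real Nt) + \<nu> * D2 Nx (\<Phi> k) (Suc n) i = \<Gamma> k (Suc n) i * \<Phi> k n i / (2 * \<nu>)"
  proof -
    assume n: "n < Nt"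
    have "\<forall>n\<in>{1..Nt}. (\<Phi> k n i - \<Phi> k (n - 1) i) / (T / real Nt) + \<nu> * D2 Nx (\<Phi> k) n i = 1 / (2 * \<nu>) * \<Gamma> k n i * \<Phi> k (n - 1) i"
      using E by blast
    from bspec[OF this, of "Suc n"] n show ?thesis by simp
  qed
  show "\<Phi> k Nt i = exp (- g (grid_x Nx i) / (2 * \<nu>))" using E by blast
  show "n < Nt \<Longrightarrow> (\<Psi> k (Suc n) i - \<Psi> k n i) / (T / real Nt) - \<nu> * D2 Nx (\<Psi> k) n i = - (\<Gamma> k n i * \<Psi> k (Suc n) i / (2 * \<nu>))"
  proof -
    assume n: "n < Nt"
    have "\<forall>n<Nt. (\<Psi> k (n + 1) i - \<Psi> k n i) / (T / real Nt) - \<nu> * D2 Nx (\<Psi> k) n i = - (1 / (2 * \<nu>)) * \<Gamma> k n i * \<Psi> k (n + 1) i"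
      using E by blast
    then show ?thesis using n by simp
  qed
  show "\<Psi> k 0 i = m\<^sub>0 (grid_x Nx i) / \<Phi> k 0 i" using E by blast
  show "n \<le> Nt \<Longrightarrow> M k n i = \<Phi> k n i * \<Psi> k n i" using E by blast
  show "n \<le> Nt \<Longrightarrow> Mb (Suc k) n i = (1 - \<delta> k) * Mb k n i + \<delta> k * M k n i" using E by blast
qed

text \<open>An error of the averaged density enters the schemes only through the potential. The error of the
  backward scheme at time zero is the initial error of the forward scheme, divided by the square of the
  lower bound.\<close>

lemma discrete_step_error:
  assumes N: "0 < Nt" "0 < Nx" and cfl: "2 * real CARD('d) * \<nu> * ((T / real Nt) / (1 / real Nx)\<^sup>2) \<le> 1"
    and D: "discrete_GCG T \<nu> f g m\<^sub>0 \<delta> mg Nt Nx Mb M \<Gamma> \<Phi> \<Psi>"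
    and nn: "\<And>n i. n \<le> Nt \<Longrightarrow> i \<in> grid Nx \<Longrightarrow> 0 \<le> Mb k n i"
    and E: "\<And>n i. n \<le> Nt \<Longrightarrow> i \<in> grid Nx \<Longrightarrow> \<bar>Mb k n i - mb k (grid_t T Nt n) (grid_x Nx i)\<bar> \<le> E"
    and n: "n \<le> Nt" "i \<in> grid Nx"
  shows "\<bar>\<Phi> k n i - \<phi> k (grid_t T Nt n) (grid_x Nx i)\<bar> \<le> phi_amplification * (E + (T / real Nt + (1 / real Nx)\<^sup>2))"
    "\<bar>M k n i - \<phi> k (grid_t T Nt n) (grid_x Nx i) * \<psi> k (grid_t T Nt n) (grid_x Nx i)\<bar> \<le> density_amplification * (E + (T / real Nt + (1 / real Nx)\<^sup>2))"
    "\<phi>_min \<le> \<Phi> k n i" "0 \<le> M k n i"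
proof -
  let ?t = "\<lambda>n. grid_t T Nt n" and ?x = "grid_x Nx :: int ^ 'd \<Rightarrow> real ^ 'd"
  define H where "H = T / real Nt + (1 / real Nx)\<^sup>2"
  define Z where "Z = phi_amplification * (E + H)"
  have H: "0 \<le> H" using T by (simp add: H_def)
  have E0: "0 \<le> E" using E[OF n] abs_ge_zero order_trans by blast
  note D = discreteD[OF D]
  have cfl': "2 * real CARD('d) * (T / real Nt * \<nu> / (1 / real Nx)\<^sup>2) \<le> 1" using cfl by (simp add: mult_ac)
  have tin: "n \<le> Nt \<Longrightarrow> ?t n \<in> {0..T}" for n using grid_t_in[OF T _ N(1)] by blast
  have dens: "piecewise_const Nx (Mb k n) \<in> grid_densities" if "n \<le> Nt" for n
    unfolding grid_densities_def using N(2) nn[OF that] by blast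
  have \<Gamma>b: "0 \<le> \<Gamma> k n i \<and> \<Gamma> k n i \<le> C0" if "n \<le> Nt" "i \<in> grid Nx" for n i
    using D(2)[OF that(2,1)] f_bound[OF tin[OF that(1)], of "piecewise_const Nx (Mb k n)"] dens[OF that(1)] by simp
  have \<Gamma>e: "\<bar>\<Gamma> k n i - f (?t n) (?x i) (mb k (?t n))\<bar> \<le> Lf * E" if ni: "n \<le> Nt" "i \<in> grid Nx" for n i
  proof -
    have "mb k (?t n) \<in> D0" using mb_path[of k] tin[OF ni(1)] by (simp add: density_path_def)
    then have "\<bar>f (?t n) (?x i) (piecewise_const Nx (Mb k n)) - f (?t n) (?x i) (mb k (?t n))\<bar>
        \<le> Lf * \<bar>piecewise_const Nx (Mb k n) (?x i) - mb k (?t n) (?x i)\<bar>"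
      using f_density[OF tin[OF ni(1)]] dens[OF ni(1)] by blast
    also have "\<dots> \<le> Lf * E" unfolding piecewise_const_grid[OF N(2) ni(2)] using E[OF ni] Lf by (intro mult_left_mono) auto
    finally show ?thesis unfolding D(2)[OF ni(2,1)] .
  qed
  have \<gamma>b: "\<bar>f t x (mb k t)\<bar> \<le> C0" if "t \<in> {0..T}" for t x
    using coupling_in_bounds[OF mb_path[of k] that, of x] by simp
  have \<Phi>T: "\<Phi> k Nt i = \<phi> k T (?x i)" if "i \<in> grid Nx" for i using D(4)[OF that] chD(2) by simp
  have AZ: "T * (Lf * E * C / (2 * \<nu>) + (C + \<nu> * real CARD('d) * C + C0 * C / (2 * \<nu>)) * (T / real Nt + (1 / real Nx)\<^sup>2)) \<le> Z"
  proof -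
    let ?a = "Lf * C / (2 * \<nu>)" and ?b = "C + \<nu> * real CARD('d) * C + C0 * C / (2 * \<nu>)"
    have ab: "0 \<le> ?a" "0 \<le> ?b" using Lf C \<nu> C0_nonneg by auto
    have "a * E + b * H \<le> (a + b) * (E + H)" if "0 \<le> a" "0 \<le> b" for a b
      using mult_nonneg_nonneg[OF that(1) H] mult_nonneg_nonneg[OF that(2) E0] by (simp add: algebra_simps)
    from this[OF ab] have "?a * E + ?b * H \<le> (?a + ?b) * (E + H)" .
    then have "T * (?a * E + ?b * H) \<le> T * ((?a + ?b) * (E + H))" using T by (intro mult_left_mono) auto
    then show ?thesis by (simp add: Z_def phi_amplification_def H_def mult_ac)
  qed
  have e\<Phi>: "\<bar>\<Phi> k n i - \<phi> k (?t n) (?x i)\<bar> \<le> Z" if "n \<le> Nt" "i \<in> grid Nx" for n i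
    by (rule order_trans[OF backward_scheme_error[OF T \<nu> N cfl' D(3) \<Phi>T \<phi>_solution[OF mb_path] smooth(1) \<gamma>b _ \<Gamma>e that] AZ])
      (use \<Gamma>b in auto)
  then show "\<bar>\<Phi> k n i - \<phi> k (?t n) (?x i)\<bar> \<le> phi_amplification * (E + (T / real Nt + (1 / real Nx)\<^sup>2))"
    using n by (simp add: Z_def H_def)
  have \<Phi>Tb: "exp (- g_bound / (2 * \<nu>)) \<le> \<Phi> k Nt i \<and> \<Phi> k Nt i \<le> C" if "i \<in> grid Nx" for i
    using D(4)[OF that, of k] terminal_lower_bound[of "?x i"] \<Phi>T[OF that]
      smooth_bound_abs(1)[OF smooth(1)[of k] less_imp_le[OF T] T0(2), of "?x i"] by simp
  have \<Phi>b: "\<phi>_min \<le> \<Phi> k n i" "\<bar>\<Phi> k n i\<bar> \<le> C" if "n \<le> Nt" "i \<in> grid Nx" for n i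
    unfolding \<phi>_min_def
    by (rule backward_scheme_bounds[OF T \<nu> N cfl' D(3) \<Phi>Tb _ \<Gamma>b that]; simp)+
  then show "\<phi>_min \<le> \<Phi> k n i" using n by blast
  have init: "\<bar>\<Psi> k 0 i - \<psi> k 0 (?x i)\<bar> \<le> m0_bound * Z / (\<phi>_min * \<phi>_min)" if i: "i \<in> grid Nx" for i
  proof -
    have p: "\<phi>_min \<le> \<Phi> k 0 i" "\<phi>_min \<le> \<phi> k 0 (?x i)" using \<Phi>b(1)[of 0 i] i \<phi>_ge_min[OF mb_path T0(1)] by auto
    have pos: "0 < \<Phi> k 0 i" "0 < \<phi> k 0 (?x i)" using p \<phi>_min_pos by linarith+
    have e: "\<bar>\<phi> k 0 (?x i) - \<Phi> k 0 i\<bar> \<le> Z" using e\<Phi>[of 0 i] i by (simp add: grid_t_def abs_minus_commute)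
    have "\<Psi> k 0 i - \<psi> k 0 (?x i) = m\<^sub>0 (?x i) * (\<phi> k 0 (?x i) - \<Phi> k 0 i) / (\<Phi> k 0 i * \<phi> k 0 (?x i))"
      using pos by (simp add: D(6)[OF i] chD(4) field_simps)
    then have "\<bar>\<Psi> k 0 i - \<psi> k 0 (?x i)\<bar> = \<bar>m\<^sub>0 (?x i)\<bar> * \<bar>\<phi> k 0 (?x i) - \<Phi> k 0 i\<bar> / (\<Phi> k 0 i * \<phi> k 0 (?x i))"
      using pos by (simp add: abs_mult)
    also have "\<dots> \<le> m0_bound * Z / (\<phi>_min * \<phi>_min)"
      using m0_bound(1) m0_bound(2)[of "?x i"] e p pos \<phi>_min_pos
      by (intro frac_le mult_mono mult_nonneg_nonneg mult_pos_pos) auto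
    finally show ?thesis .
  qed
  have e\<Psi>: "\<bar>\<Psi> k n i - \<psi> k (?t n) (?x i)\<bar> \<le> m0_bound * Z / (\<phi>_min * \<phi>_min) + Z"
    by (rule order_trans[OF forward_scheme_error[OF T \<nu> N cfl' D(5) init \<psi>_solution[OF mb_path] smooth(2) \<gamma>b _ \<Gamma>e n] add_left_mono[OF AZ]])
      (use \<Gamma>b in auto)
  have "M k n i - \<phi> k (?t n) (?x i) * \<psi> k (?t n) (?x i)
      = \<Phi> k n i * (\<Psi> k n i - \<psi> k (?t n) (?x i)) + \<psi> k (?t n) (?x i) * (\<Phi> k n i - \<phi> k (?t n) (?x i))"
    using D(7)[OF n(2,1)] by (simp add: algebra_simps)
  also have "\<bar>\<dots>\<bar> \<le> \<bar>\<Phi> k n i\<bar> * \<bar>\<Psi> k n i - \<psi> k (?t n) (?x i)\<bar> + \<bar>\<psi> k (?t n) (?x i)\<bar> * \<bar>\<Phi> k n i - \<phi> k (?t n) (?x i)\<bar>"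
    unfolding abs_mult[symmetric] by (rule abs_triangle_ineq)
  also have "\<dots> \<le> C * (m0_bound * Z / (\<phi>_min * \<phi>_min) + Z) + C * Z"
    using \<Phi>b(2)[OF n] e\<Psi> e\<Phi>[OF n] smooth_bound_abs(1)[OF smooth(2)[of k] less_imp_le[OF T] tin[OF n(1)], of "?x i"] C
    by (intro add_mono mult_mono) auto
  also have "\<dots> = density_amplification * (E + H)" by (simp add: density_amplification_def Z_def algebra_simps add_divide_distrib)
  finally show "\<bar>M k n i - \<phi> k (?t n) (?x i) * \<psi> k (?t n) (?x i)\<bar> \<le> density_amplification * (E + (T / real Nt + (1 / real Nx)\<^sup>2))"
    by (simp add: H_def)
  have "0 \<le> \<Psi> k 0 i" if "i \<in> grid Nx" for i
    using D(6)[OF that, of k] data_C1(3) \<Phi>b(1)[of 0 i] \<phi>_min_pos that by (auto intro!: divide_nonneg_nonneg)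
  then have "0 \<le> \<Psi> k n i" by (intro forward_scheme_nonneg[OF T \<nu> N cfl' D(5) _ \<Gamma>b n])
  then show "0 \<le> M k n i" using D(7)[OF n(2,1)] \<Phi>b(1)[OF n] \<phi>_min_pos by simp
qed

text \<open>The additional one makes the exponent positive, which the logarithmic lower bound on the growth
  requires.\<close>

definition growth_exponent :: nat where "growth_exponent = nat \<lceil>k2 * density_amplification\<rceil> + 1"

text \<open>Bernoulli's inequality turns the amplification factor into a ratio of consecutive powers, so that
  the product over all iterations telescopes.\<close>

lemma growth_step: "1 + \<delta> k * density_amplification \<le> (real (Suc (Suc k)) / real (Suc k)) ^ growth_exponent"
proof -
  have "k2 * density_amplification \<le> real growth_exponent" unfolding growth_exponent_def by linarith
  moreover have "\<delta> k \<le> k2 / real (Suc k)" unfolding \<delta> using k1 k2 by (intro divide_left_mono) auto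
  ultimately have "\<delta> k * density_amplification \<le> real growth_exponent * (1 / real (Suc k))"
    using mult_right_mono[of "\<delta> k" "k2 / real (Suc k)" density_amplification] density_amplification_pos
      divide_right_mono[of "k2 * density_amplification" "real growth_exponent" "real (Suc k)"] by simp
  then have "1 + \<delta> k * density_amplification \<le> 1 + real growth_exponent * (1 / real (Suc k))" by simp
  also have "\<dots> \<le> (1 + 1 / real (Suc k)) ^ growth_exponent"
    by (rule Bernoulli_inequality) (simp add: order_trans[of _ 0])
  also have "1 + 1 / real (Suc k) = real (Suc (Suc k)) / real (Suc k)" by (simp add: field_simps)
  finally show ?thesis .
qed

text \<open>With \<open>H\<close> for the sum of the mesh parameters, an error $(b-1) H$ becomes at most
  $(b (1 + A\delta_k) - 1) H$; the subtracted one accounts for the exact start.\<close>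

lemma discrete_density_error:
  assumes N: "0 < Nt" "0 < Nx" and cfl: "2 * real CARD('d) * \<nu> * ((T / real Nt) / (1 / real Nx)\<^sup>2) \<le> 1"
    and D: "discrete_GCG T \<nu> f g m\<^sub>0 \<delta> mg Nt Nx Mb M \<Gamma> \<Phi> \<Psi>"
    and n: "n \<le> Nt" "i \<in> grid Nx"
  shows "0 \<le> Mb k n i"
    "\<bar>Mb k n i - mb k (grid_t T Nt n) (grid_x Nx i)\<bar> \<le> (real (Suc k) ^ growth_exponent - 1) * (T / real Nt + (1 / real Nx)\<^sup>2)"
proof -
  define H where "H = T / real Nt + (1 / real Nx)\<^sup>2"
  have H: "0 \<le> H" using T by (simp add: H_def)
  have tin: "n \<le> Nt \<Longrightarrow> grid_t T Nt n \<in> {0..T}" for n using grid_t_in[OF T _ N(1)] by blast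
  define P where "P = growth_exponent"
  have "\<forall>n\<le>Nt. \<forall>i\<in>grid Nx. 0 \<le> Mb k n i \<and> \<bar>Mb k n i - mb k (grid_t T Nt n) (grid_x Nx i)\<bar> \<le> (real (Suc k) ^ P - 1) * H"
  proof (induction k)
    case 0
    show ?case
    proof (intro allI impI ballI)
      fix n and i :: "int ^ 'd" assume n: "n \<le> Nt" "i \<in> grid Nx"
      have "Mb 0 n i = mb 0 (grid_t T Nt n) (grid_x Nx i)"
        using discreteD(1)[OF D n(2,1)] chD(6)[OF tin[OF n(1)]] by simp
      moreover have "0 \<le> mb 0 (grid_t T Nt n) (grid_x Nx i)"
        using mb_path[of 0] tin[OF n(1)] by (auto simp: density_path_def D0_def)
      ultimately show "0 \<le> Mb 0 n i \<and> \<bar>Mb 0 n i - mb 0 (grid_t T Nt n) (grid_x Nx i)\<bar> \<le> (real (Suc 0) ^ P - 1) * H" by simp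
    qed
  next
    case (Suc k)
    show ?case
    proof (intro allI impI ballI)
      fix n and i :: "int ^ 'd" assume n: "n \<le> Nt" "i \<in> grid Nx"
      let ?t = "grid_t T Nt n" and ?x = "grid_x Nx i"
      define b where "b = real (Suc k) ^ P"
      have IH: "0 \<le> Mb k n i" "\<bar>Mb k n i - mb k ?t ?x\<bar> \<le> (b - 1) * H" using Suc n by (auto simp: b_def)
      have S: "\<bar>M k n i - \<phi> k ?t ?x * \<psi> k ?t ?x\<bar> \<le> density_amplification * ((b - 1) * H + H)" "0 \<le> M k n i"
        using discrete_step_error(2,4)[OF N cfl D _ _ n, of k "(b - 1) * H"] Suc unfolding H_def[symmetric] b_def by auto
      have s: "0 \<le> \<delta> k" "\<delta> k \<le> 1" by (rule step_size)+
      have Mb: "Mb (Suc k) n i = (1 - \<delta> k) * Mb k n i + \<delta> k * M k n i" by (rule discreteD(8)[OF D n(2,1)])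
      have "Mb (Suc k) n i - mb (Suc k) ?t ?x
          = (1 - \<delta> k) * (Mb k n i - mb k ?t ?x) + \<delta> k * (M k n i - \<phi> k ?t ?x * \<psi> k ?t ?x)"
        unfolding Mb chD(5)[OF tin[OF n(1)]] by (simp add: algebra_simps)
      also have "\<bar>\<dots>\<bar> \<le> (1 - \<delta> k) * \<bar>Mb k n i - mb k ?t ?x\<bar> + \<delta> k * \<bar>M k n i - \<phi> k ?t ?x * \<psi> k ?t ?x\<bar>"
        using abs_triangle_ineq[of "(1 - \<delta> k) * (Mb k n i - mb k ?t ?x)" "\<delta> k * (M k n i - \<phi> k ?t ?x * \<psi> k ?t ?x)"] s
        by (simp add: abs_mult)
      also have "\<dots> \<le> 1 * ((b - 1) * H) + \<delta> k * (density_amplification * ((b - 1) * H + H))"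
        using IH S s by (intro add_mono mult_mono mult_left_mono) auto
      also have "\<dots> = (b * (1 + \<delta> k * density_amplification) - 1) * H" by (simp add: algebra_simps)
      also have "\<dots> \<le> (real (Suc (Suc k)) ^ P - 1) * H"
      proof (rule mult_right_mono[OF _ H])
        have "b * (1 + \<delta> k * density_amplification) \<le> b * (real (Suc (Suc k)) / real (Suc k)) ^ P"
          unfolding P_def by (rule mult_left_mono[OF growth_step]) (simp add: b_def)
        also have "\<dots> = real (Suc (Suc k)) ^ P" by (simp add: b_def power_divide)
        finally show "b * (1 + \<delta> k * density_amplification) - 1 \<le> real (Suc (Suc k)) ^ P - 1" by simp
      qed
      finally show "0 \<le> Mb (Suc k) n i \<and> \<bar>Mb (Suc k) n i - mb (Suc k) ?t ?x\<bar> \<le> (real (Suc (Suc k)) ^ P - 1) * H"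
        unfolding Mb using IH S s by auto
    qed
  qed
  then show "0 \<le> Mb k n i"
    "\<bar>Mb k n i - mb k (grid_t T Nt n) (grid_x Nx i)\<bar> \<le> (real (Suc k) ^ growth_exponent - 1) * (T / real Nt + (1 / real Nx)\<^sup>2)"
    using n by (auto simp: P_def H_def)
qed

lemma discrete_convergence:
  "\<exists>C1m C1u :: nat \<Rightarrow> real. \<exists>C2m>0. \<exists>C2u>0. (\<forall>k. 0 < C1m k) \<and> (\<forall>k. 0 < C1u k)
    \<and> log_poly_growth C1m \<and> log_poly_growth C1u
    \<and> (\<forall>Nt Nx Mb M \<Gamma> \<Phi> \<Psi>. 0 < Nt \<longrightarrow> 0 < Nx
        \<longrightarrow> 2 * real CARD('d) * \<nu> * ((T / real Nt) / (1 / real Nx)\<^sup>2) \<le> 1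
        \<longrightarrow> discrete_GCG T \<nu> f g m\<^sub>0 \<delta> mg Nt Nx Mb M \<Gamma> \<Phi> \<Psi>
        \<longrightarrow> (\<forall>k. err_I T Nt Nx (Mb k) mbar \<le> C1m k * (T / real Nt + (1 / real Nx)\<^sup>2) + C2m / (real k + k1) powr rate
            \<and> err_E T Nt Nx (\<lambda>n i. - 2 * \<nu> * ln (\<Phi> k n i)) ubar
                \<le> C1u k * (T / real Nt + (1 / real Nx)\<^sup>2) + C2u / (real k + k1) powr rate))"
proof -
  obtain Bm where Bm: "0 < Bm" "\<And>k t x. t \<in> {0..T} \<Longrightarrow> \<bar>mb k t x - mbar t x\<bar> \<le> Bm / (real k + k1) powr rate"
    by (rule density_rate) blast
  obtain Bu where Bu: "0 < Bu" "\<And>k t x. t \<in> {0..T} \<Longrightarrow> \<bar>\<phi> k t x - phibar t x\<bar> \<le> Bu / (real k + k1) powr rate"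
    by (rule \<phi>_rate) blast
  define P where "P = growth_exponent"
  define cu where "cu = 2 * \<nu> / \<phi>_min"
  have P: "1 \<le> P" by (simp add: P_def growth_exponent_def)
  have cu: "0 < cu" using \<nu> \<phi>_min_pos by (simp add: cu_def)
  let ?C1m = "\<lambda>k. sqrt T * real (Suc k) ^ P" and ?C1u = "\<lambda>k. (cu * phi_amplification) * real (Suc k) ^ P"
  have main: "err_I T Nt Nx (Mb k) mbar \<le> ?C1m k * (T / real Nt + (1 / real Nx)\<^sup>2) + sqrt T * Bm / (real k + k1) powr rate
      \<and> err_E T Nt Nx (\<lambda>n i. - 2 * \<nu> * ln (\<Phi> k n i)) ubar \<le> ?C1u k * (T / real Nt + (1 / real Nx)\<^sup>2) + cu * Bu / (real k + k1) powr rate"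
    if N: "0 < Nt" "0 < Nx" and cfl: "2 * real CARD('d) * \<nu> * ((T / real Nt) / (1 / real Nx)\<^sup>2) \<le> 1"
      and D: "discrete_GCG T \<nu> f g m\<^sub>0 \<delta> mg Nt Nx Mb M \<Gamma> \<Phi> \<Psi>" for Nt Nx Mb M \<Gamma> \<Phi> \<Psi> k
  proof
    define H where "H = T / real Nt + (1 / real Nx)\<^sup>2"
    have H: "0 \<le> H" using T by (simp add: H_def)
    have tin: "n \<le> Nt \<Longrightarrow> grid_t T Nt n \<in> {0..T}" for n using grid_t_in[OF T _ N(1)] by blast
    note dd = discrete_density_error[OF N cfl D, folded H_def P_def]
    let ?R = "(real k + k1) powr rate"
    have "\<bar>Mb k n i - mbar (grid_t T Nt n) (grid_x Nx i)\<bar> \<le> real (Suc k) ^ P * H + Bm / ?R" if n: "n \<le> Nt" "i \<in> grid Nx" for n i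
    proof -
      have "(real (Suc k) ^ P - 1) * H \<le> real (Suc k) ^ P * H" using H by (intro mult_right_mono) auto
      then show ?thesis using dd(2)[OF n, of k] Bm(2)[OF tin[OF n(1)], of k "grid_x Nx i"] by linarith
    qed
    then have "err_I T Nt Nx (Mb k) mbar \<le> sqrt T * (real (Suc k) ^ P * H + Bm / ?R)"
      using H Bm(1) by (intro err_I_le[OF T N]) auto
    then show "err_I T Nt Nx (Mb k) mbar \<le> ?C1m k * (T / real Nt + (1 / real Nx)\<^sup>2) + sqrt T * Bm / ?R"
      unfolding H_def[symmetric] by (simp add: algebra_simps)
    show "err_E T Nt Nx (\<lambda>n i. - 2 * \<nu> * ln (\<Phi> k n i)) ubar \<le> ?C1u k * (T / real Nt + (1 / real Nx)\<^sup>2) + cu * Bu / ?R"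
      unfolding H_def[symmetric]
    proof (rule err_E_le[OF N(2)])
      fix n and i :: "int ^ 'd" assume n: "n \<le> Nt" "i \<in> grid Nx"
      let ?t = "grid_t T Nt n" and ?x = "grid_x Nx i"
      have t: "?t \<in> {0..T}" by (rule tin[OF n(1)])
      note st = discrete_step_error[OF N cfl D dd(1)[where k = k] dd(2)[where k = k] n, folded H_def]
      have "\<bar>\<Phi> k n i - \<phi> k ?t ?x\<bar> \<le> phi_amplification * (real (Suc k) ^ P * H)"
        using st(1) by (simp add: algebra_simps)
      then have e: "\<bar>\<Phi> k n i - phibar ?t ?x\<bar> \<le> phi_amplification * (real (Suc k) ^ P * H) + Bu / ?R"
        using Bu(2)[OF t, of k ?x] by linarith
      have low: "\<phi>_min \<le> phibar ?t ?x" by (rule backward_solution_ge_\<phi>_min[OF mbar_path phibar_solution phibar_terminal t])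
      have u: "ubar ?t ?x = - 2 * \<nu> * ln (phibar ?t ?x)" using \<nu> by (simp add: phibar_def)
      have "\<bar>- 2 * \<nu> * ln (\<Phi> k n i) - ubar ?t ?x\<bar> = 2 * \<nu> * \<bar>ln (\<Phi> k n i) - ln (phibar ?t ?x)\<bar>"
      proof -
        have "- 2 * \<nu> * ln (\<Phi> k n i) - ubar ?t ?x = - (2 * \<nu>) * (ln (\<Phi> k n i) - ln (phibar ?t ?x))"
          unfolding u by (simp add: algebra_simps)
        then show ?thesis using \<nu> by (simp add: abs_mult)
      qed
      also have "\<dots> \<le> 2 * \<nu> * (\<bar>\<Phi> k n i - phibar ?t ?x\<bar> / \<phi>_min)"
        using \<nu> by (intro mult_left_mono ln_difference_bound[OF \<phi>_min_pos st(3) low]) auto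
      also have "\<dots> = cu * \<bar>\<Phi> k n i - phibar ?t ?x\<bar>" by (simp add: cu_def)
      also have "\<dots> \<le> cu * (phi_amplification * (real (Suc k) ^ P * H) + Bu / ?R)" using e cu by (intro mult_left_mono) auto
      finally show "\<bar>- 2 * \<nu> * ln (\<Phi> k n i) - ubar ?t ?x\<bar> \<le> ?C1u k * H + cu * Bu / ?R" by (simp add: algebra_simps)
    qed
  qed
  show ?thesis
  proof (rule exI[of _ ?C1m], rule exI[of _ ?C1u], rule exI[of _ "sqrt T * Bm"], rule conjI, use T Bm in simp,
      rule exI[of _ "cu * Bu"], intro conjI)
    show "0 < cu * Bu" using cu Bu by simp
    show "\<forall>k. 0 < ?C1m k" using T by simp
    show "\<forall>k. 0 < ?C1u k" using cu phi_amplification_pos by simp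
    show "log_poly_growth ?C1m" "log_poly_growth ?C1u"
      using log_poly_growth_power[OF _ P] T cu phi_amplification_pos by simp_all
  qed (intro allI impI, rule main, assumption+)
qed

end

theorem theorem3p9:
  fixes T \<nu> \<alpha>\<^sub>0 k1 k2 r C :: real
    and f :: "real \<Rightarrow> real ^ 'd \<Rightarrow> (real ^ 'd \<Rightarrow> real) \<Rightarrow> real"
    and g m\<^sub>0 :: "real ^ 'd \<Rightarrow> real"
    and v :: "real \<Rightarrow> real ^ 'd \<Rightarrow> real ^ 'd"
    and mbar\<^sub>0 ubar mbar :: "real \<Rightarrow> real ^ 'd \<Rightarrow> real"
    and mb \<phi> \<psi> :: "nat \<Rightarrow> real \<Rightarrow> real ^ 'd \<Rightarrow> real"
    and \<delta> :: "nat \<Rightarrow> real"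
  assumes "0 < T" and "0 < \<nu>" and "0 < \<alpha>\<^sub>0" and "\<alpha>\<^sub>0 < 1"
    and "coupling_on_torus T f"
    and "f_B T f" and "f_L' \<alpha>\<^sub>0 T f" and "f_M T f" and "f_P T f"
    and "TIV \<alpha>\<^sub>0 g m\<^sub>0"
    and "\<And>l. par_holder_x1 \<alpha>\<^sub>0 T (\<lambda>t x. v t x $ l)"
    and "initial_guess T \<nu> v m\<^sub>0 mbar\<^sub>0"
    and "1 \<le> k2" and "k2 \<le> k1"
    and "\<And>k. \<delta> k = k2 / (real k + k1)"
    and "if CARD('d) = 1 then r = 2 else r > real CARD('d)"
    and "MFG_solution T \<nu> (\<lambda>t x p. 1 / 2 * (norm p)\<^sup>2) f g m\<^sub>0 ubar mbar"
    and "CH_GCG T \<nu> f g m\<^sub>0 \<delta> mbar\<^sub>0 mb \<phi> \<psi>"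
    and "0 < C"
    and "\<And>k. par_C 2 4 T (\<phi> k)" and "\<And>k. par_C 2 4 T (\<psi> k)"
    and "\<And>k. par_norm 2 4 T (\<phi> k) \<le> C" and "\<And>k. par_norm 2 4 T (\<psi> k) \<le> C"
  shows "\<exists>s>0. \<exists>C1m C1u :: nat \<Rightarrow> real. \<exists>C2m>0. \<exists>C2u>0.
      (\<forall>k. 0 < C1m k) \<and> (\<forall>k. 0 < C1u k)
    \<and> log_poly_growth C1m \<and> log_poly_growth C1u
    \<and> (\<forall>Nt Nx Mb M \<Gamma> \<Phi> \<Psi>. 0 < Nt \<longrightarrow> 0 < Nx
        \<longrightarrow> 2 * real CARD('d) * \<nu> * ((T / real Nt) / (1 / real Nx)\<^sup>2) \<le> 1
        \<longrightarrow> discrete_GCG T \<nu> f g m\<^sub>0 \<delta> mbar\<^sub>0 Nt Nx Mb M \<Gamma> \<Phi> \<Psi>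
        \<longrightarrow> (\<forall>k.
              err_I T Nt Nx (Mb k) mbar
                \<le> C1m k * (T / real Nt + (1 / real Nx)\<^sup>2) + C2m / (real k + k1) powr (s / r)
            \<and> err_E T Nt Nx (\<lambda>n i. - 2 * \<nu> * ln (\<Phi> k n i)) ubar
                \<le> C1u k * (T / real Nt + (1 / real Nx)\<^sup>2) + C2u / (real k + k1) powr (s / r)))"
proof -
  obtain C0 where C0: "\<forall>t\<in>{0..T}. \<forall>x. \<forall>m\<in>D0 \<union> grid_densities. 0 \<le> f t x m \<and> f t x m \<le> C0"
    using assms(6) unfolding f_B_def by blast
  obtain C1 Lf where Lf: "0 < Lf"
    and time: "\<forall>t1\<in>{0..T}. \<forall>t2\<in>{0..T}. \<forall>x. \<forall>m\<in>D0 \<union> grid_densities. \<bar>f t2 x m - f t1 x m\<bar> \<le> C1 * \<bar>t2 - t1\<bar> powr \<alpha>\<^sub>0"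
    and dens: "\<forall>t\<in>{0..T}. \<forall>x. \<forall>m1\<in>D0 \<union> grid_densities. \<forall>m2\<in>D0 \<union> grid_densities. \<bar>f t x m2 - f t x m1\<bar> \<le> Lf * \<bar>m2 x - m1 x\<bar>"
    and space: "\<forall>R>0. \<exists>C. \<forall>t\<in>{0..T}. \<forall>m\<in>D0. R-lipschitz_on UNIV m \<longrightarrow> C-lipschitz_on UNIV (\<lambda>x. f t x m)"
    using assms(7) unfolding f_L'_def by blast
  obtain F where F1: "\<forall>t\<in>{0..T}. \<forall>m\<in>D0. \<forall>\<epsilon>>0. \<exists>\<eta>>0. \<forall>t'\<in>{0..T}. \<forall>m'\<in>D0.
        \<bar>t' - t\<bar> < \<eta> \<longrightarrow> (\<forall>x. \<bar>m' x - m x\<bar> < \<eta>) \<longrightarrow> \<bar>F t' m' - F t m\<bar> < \<epsilon>"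
    and F2: "\<forall>t\<in>{0..T}. \<forall>m1\<in>D0. \<forall>m2\<in>D0. F t m2 - F t m1 = integral {0..1} (\<lambda>s. integral (cbox 0 1) (\<lambda>x.
          f t x (\<lambda>y. s * m2 y + (1 - s) * m1 y) * (m2 x - m1 x)))"
    using assms(9) unfolding f_P_def by blast
  interpret potential_coupling T f \<alpha>\<^sub>0 C0 C1 Lf F
  proof unfold_locales
    show "0 < T" "0 < \<alpha>\<^sub>0" "0 < Lf" "f_M T f" by (fact assms Lf)+
    show "0 \<le> f t x m \<and> f t x m \<le> C0" if "t \<in> {0..T}" "m \<in> D0 \<union> grid_densities" for t x m
      using C0[rule_format, OF that] .
    show "\<bar>f t x m - f s x m\<bar> \<le> C1 * \<bar>t - s\<bar> powr \<alpha>\<^sub>0"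
      if "t \<in> {0..T}" "s \<in> {0..T}" "m \<in> D0 \<union> grid_densities" for t s x m
      using time[rule_format, OF that(2,1,3)] .
    show "\<bar>f t x m2 - f t x m1\<bar> \<le> Lf * \<bar>m2 x - m1 x\<bar>"
      if "t \<in> {0..T}" "m1 \<in> D0 \<union> grid_densities" "m2 \<in> D0 \<union> grid_densities" for t x m1 m2
      using dens[rule_format, OF that] .
    show "\<exists>C. \<forall>t\<in>{0..T}. \<forall>m\<in>D0. R-lipschitz_on UNIV m \<longrightarrow> C-lipschitz_on UNIV (\<lambda>x. f t x m)" if "0 < R" for R
      by (rule space[rule_format, OF that])
    show "\<exists>\<eta>>0. \<forall>t'\<in>{0..T}. \<forall>m'\<in>D0.
        \<bar>t' - t\<bar> < \<eta> \<longrightarrow> (\<forall>x. \<bar>m' x - m x\<bar> < \<eta>) \<longrightarrow> \<bar>F t' m' - F t m\<bar> < \<epsilon>"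
      if "t \<in> {0..T}" "m \<in> D0" "0 < \<epsilon>" for t m \<epsilon>
      by (rule bspec[OF bspec[OF F1 that(1)] that(2), rule_format, OF that(3)])
    show "F t m2 - F t m1 = integral {0..1} (\<lambda>s. integral (cbox 0 1) (\<lambda>x.
          f t x (\<lambda>y. s * m2 y + (1 - s) * m1 y) * (m2 x - m1 x)))"
      if "t \<in> {0..T}" "m1 \<in> D0" "m2 \<in> D0" for t m1 m2
      using F2[rule_format, OF that] .
  qed
  interpret gcg T f \<alpha>\<^sub>0 C0 C1 Lf F \<nu> C k1 k2 g m\<^sub>0 v ubar mbar mbar\<^sub>0 mb \<phi> \<psi> \<delta>
    by unfold_locales (use assms in \<open>simp_all add: smooth_bound_def\<close>)
  have r: "0 < r" using assms(16) by (auto split: if_splits intro: less_trans[of 0 "real CARD('d)"])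
  have "0 < rate" by (simp add: rate_def add_pos_pos)
  then have s: "0 < r * rate" and rate: "r * rate / r = rate" using r by simp_all
  show ?thesis
    by (rule exI[of _ "r * rate"], rule conjI[OF s], unfold rate) (rule discrete_convergence)
qed

end
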